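(* Let $d\in\{2,3,\ldots\}$ and $R>0$. Define $\mathcal{I}_d:(0,\infty)\to\mathbb{R}$ by $$\mathcal{I}_d(\rho):=\int_\rho^\infty\frac{dx}{\sinh^{d-1}x}.$$ For $\mathbf{x},\mathbf{x}'\in\mathbf{H}_R^d$ with $\mathbf{x}\neq\mathbf{x}'$ put $\widehat{\mathbf{x}}=\mathbf{x}/R$, $\widehat{\mathbf{x}}'=\mathbf{x}'/R$, let $\rho:=\cosh^{-1}([\widehat{\mathbf{x}},\widehat{\mathbf{x}}'])$ be the geodesic distance between $\widehat{\mathbf{x}}$ and $\widehat{\mathbf{x}}'$ on the unit radius hyperboloid $\mathbf{H}^d=\mathbf{H}_1^d$, and define $\mathcal{H}_R^d:(\mathbf{H}_R^d\times\mathbf{H}_R^d)\setminus\{(\mathbf{x},\mathbf{x}):\mathbf{x}\in\mathbf{H}_R^d\}\to\mathbb{R}$ by $$\mathcal{H}_R^d(\mathbf{x},\mathbf{x}'):=\frac{\Gamma(d/2)}{2\pi^{d/2}R^{d-2}}\,\mathcal{I}_d(\rho).$$ Then $\mathcal{H}_R^d$ is a fundamental solution for $-\Delta$, where $\Delta$ is the Laplace-Beltrami operator on $\mathbf{H}_R^d$. Moreover, for all $\rho\in(0,\infty)$: (i) if $d$ is even, $$\mathcal{I}_d(\rho)=(-1)^{d/2-1}\frac{(d-3)!!}{(d-2)!!}\left[\log\coth\frac{\rho}{2}+\cosh\rho\sum_{k=1}^{d/2-1}\frac{(2k-2)!!\,(-1)^k}{(2k-1)!!\,\sinh^{2k}\rho}\right];$$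 (ii) if $d$ is odd, both $$\mathcal{I}_d(\rho)=(-1)^{(d-1)/2}\left[\frac{(d-3)!!}{(d-2)!!}+\left(\frac{d-3}{2}\right)!\sum_{k=1}^{(d-1)/2}\frac{(-1)^k\coth^{2k-1}\rho}{(2k-1)\,(k-1)!\,((d-2k-1)/2)!}\right]$$ and $$\mathcal{I}_d(\rho)=(-1)^{(d-1)/2}\frac{(d-3)!!}{(d-2)!!}\left[1+\cosh\rho\sum_{k=1}^{(d-1)/2}\frac{(2k-3)!!\,(-1)^k}{(2k-2)!!\,\sinh^{2k-1}\rho}\right];$$ (iii) for every $d\in\{2,3,\ldots\}$, $$\mathcal{I}_d(\rho)=\frac{1}{(d-1)\cosh^{d-1}\rho}\,{}_2F_1\left(\frac{d-1}{2},\frac{d}{2};\frac{d+1}{2};\frac{1}{\cosh^2\rho}\right),$$ $$\mathcal{I}_d(\rho)=\frac{1}{(d-1)\cosh\rho\,\sinh^{d-2}\rho}\,{}_2F_1\left(\frac12,1;\frac{d+1}{2};\frac{1}{\cosh^2\rho}\right),$$ $$\mathcal{I}_d(\rho)=\frac{e^{-i\pi(d/2-1)}}{2^{d/2-1}\,\Gamma(d/2)\,\sinh^{d/2-1}\rho}\,Q_{d/2-1}^{d/2-1}(\cosh\rho).$$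
   Context: Minkowski bilinear form on $\mathbb{R}^{d+1}$ with coordinates $(x_0,x_1,\ldots,x_d)$: $[\mathbf{x},\mathbf{y}]=x_0y_0-x_1y_1-\cdots-x_dy_d$. For $R>0$, the $R$-radius hyperboloid $\mathbf{H}_R^d$ is the upper sheet $\{\mathbf{x}\in\mathbb{R}^{d+1}:[\mathbf{x},\mathbf{x}]=R^2,\ x_0>0\}$, with the Riemannian metric $g$ obtained by restricting $-[\cdot,\cdot]$ to tangent spaces; it has constant sectional curvature $-1/R^2$. In geodesic polar coordinates $\mathbf{x}=(R\cosh r,\,R\sinh r\,\omega)$ with $r\ge 0$, $\omega\in\mathbf{S}^{d-1}$, the metric is $ds^2=R^2(dr^2+\sinh^2 r\,d\omega^2)$ where $d\omega^2$ is the round metric on the unit sphere $\mathbf{S}^{d-1}$, the Riemannian volume measure is $d\mathrm{vol}_g=R^d\sinh^{d-1}r\,dr\,d\omega$, and the Laplace-Beltrami operator is $$\Delta f=\frac{1}{R^2}\left[\frac{\partial^2 f}{\partial r^2}+(d-1)\coth r\frac{\partial f}{\partial r}+\frac{1}{\sinh^2 r}\Delta_{\mathbf{S}^{d-1}}f\right].$$ The geodesic distance on $\mathbf{H}_R^d$ is $R\cosh^{-1}\left([\mathbf{x},\mathbf{x}']/R^2\right)$. A function $\mathcal{H}$ defined off the diagonal is a fundamental solution for $-\Delta$ if $-\Delta\mathcal{H}(\cdot,\mathbf{x}')=\delta_g(\cdot,\mathbf{x}')$ (the Dirac delta at $\mathbf{x}'$ with respect to $d\mathrm{vol}_g$), i.e.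 $\int_{\mathbf{H}_R^d}(-\Delta\varphi)(\mathbf{x}')\,\mathcal{H}(\mathbf{x},\mathbf{x}')\,d\mathrm{vol}_g'=\varphi(\mathbf{x})$ for all $\mathbf{x}\in\mathbf{H}_R^d$ and all test functions $\varphi\in C_c^\infty(\mathbf{H}_R^d)$, where $d\mathrm{vol}_g'$ is the volume measure in the variable $\mathbf{x}'$. Conventions: empty sums are $0$. Double factorial: $n!!=n(n-2)\cdots 2$ for even $n\ge 2$, $n!!=n(n-2)\cdots 1$ for odd $n\ge 1$, and $(-1)!!=0!!=1$. The Gauss hypergeometric function is ${}_2F_1(a,b;c;z)=\sum_{n=0}^\infty\frac{(a)_n(b)_n}{(c)_n n!}z^n$ for $|z|<1$, with $(a)_n=\prod_{i=1}^n(a+i-1)$. The associated Legendre function of the second kind $Q_\nu^\mu:(1,\infty)\to\mathbb{C}$ is defined, for $\nu+\mu+1\notin\{0,-1,-2,\ldots\}$, by $$Q_\nu^\mu(z)=\frac{\sqrt{\pi}\,e^{i\pi\mu}\,\Gamma(\nu+\mu+1)\,(z^2-1)^{\mu/2}}{2^{\nu+1}\,\Gamma(\nu+\frac32)\,z^{\nu+\mu+1}}\,{}_2F_1\left(\frac{\nu+\mu+2}{2},\frac{\nu+\mu+1}{2};\nu+\frac32;\frac{1}{z^2}\right).$$ *)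

theory Defs
  imports "HOL-Analysis.Analysis"
begin

text \<open>
  A point \<open>(x\<^sub>0, x\<^sub>1, \<dots>, x\<^sub>d)\<close> of \<open>(d+1)\<close>-dimensional Minkowski space is a pair
  of type \<open>real \<times> (real ^ 'n)\<close> with \<open>CARD('n) = d\<close>; the first component is \<open>x\<^sub>0\<close>.
\<close>

definition mink :: "real \<times> (real ^ 'n) \<Rightarrow> real \<times> (real ^ 'n) \<Rightarrow> real" where
  "mink x y = fst x * fst y - (\<Sum>i\<in>UNIV. snd x $ i * snd y $ i)"

definition hyperboloid :: "real \<Rightarrow> (real \<times> (real ^ 'n)) set" where
  "hyperboloid R = {x. mink x x = R\<^sup>2 \<and> fst x > 0}"

text \<open>
  For \<open>R > 0\<close> the hyperboloid is the graph of \<open>y \<mapsto> sqrt (R\<^sup>2 + \<bar>y\<bar>\<^sup>2)\<close> over the whole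
  of \<open>d\<close>-dimensional Euclidean space.  This gives a single global smooth chart, without the
  coordinate singularity of geodesic polar coordinates.  The metric, the volume measure and the
  Laplace-Beltrami operator are written in this chart by the usual local coordinate formulas,
  whose values do not depend on the chart.
\<close>

definition hyp_chart :: "real \<Rightarrow> real ^ 'n \<Rightarrow> real \<times> (real ^ 'n)" where
  "hyp_chart R y = (sqrt (R\<^sup>2 + (norm y)\<^sup>2), y)"

lemma bij_betw_hyp_chart:
  assumes "R > 0"
  shows "bij_betw (hyp_chart R) (UNIV :: (real ^ 'n) set) (hyperboloid R)"
proof (rule bij_betw_byWitness[where f' = snd])
  have sq: "(\<Sum>i\<in>UNIV. y $ i * y $ i) = (norm y)\<^sup>2" for y :: "real ^ 'n"
    by (simp add: power2_norm_eq_inner inner_vec_def)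
  show "hyp_chart R ` (UNIV :: (real ^ 'n) set) \<subseteq> hyperboloid R"
    using assms by (auto simp: hyp_chart_def hyperboloid_def mink_def sq add_pos_nonneg)
  show "\<forall>x\<in>hyperboloid R. hyp_chart R (snd x :: real ^ 'n) = x"
  proof
    fix x :: "real \<times> (real ^ 'n)"
    assume x: "x \<in> hyperboloid R"
    then have "R\<^sup>2 + (norm (snd x))\<^sup>2 = (fst x)\<^sup>2" "fst x > 0"
      by (simp_all add: hyperboloid_def mink_def sq power2_eq_square[of "fst x"])
    then show "hyp_chart R (snd x) = x"
      by (simp add: hyp_chart_def prod_eq_iff)
  qed
qed (auto simp: hyp_chart_def)

definition partial :: "'n \<Rightarrow> (real ^ 'n \<Rightarrow> 'b::real_normed_vector) \<Rightarrow> real ^ 'n \<Rightarrow> 'b" where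
  "partial i f y = frechet_derivative f (at y) (axis i 1)"

text \<open>
  The Gram matrix of the coordinate tangent vectors with respect to the restriction of
  \<open>- mink\<close> to the tangent spaces.
\<close>

definition metric_matrix :: "real \<Rightarrow> real ^ 'n \<Rightarrow> real ^ 'n ^ 'n" where
  "metric_matrix R y =
     (\<chi> i j. - mink (partial i (hyp_chart R) y) (partial j (hyp_chart R) y))"

definition vol_density :: "real \<Rightarrow> real ^ 'n \<Rightarrow> real" where
  "vol_density R y = sqrt (det (metric_matrix R y))"

text \<open>
  The Riemannian volume measure, as a Borel measure on the ambient space that is concentrated
  on the hyperboloid.
\<close>

definition hyp_vol :: "real \<Rightarrow> (real \<times> (real ^ 'n)) measure" where
  "hyp_vol R = distr (density lborel (\<lambda>y. ennreal (vol_density R y))) borel (hyp_chart R)"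

text \<open>
  \<open>\<Delta> f = (1 / sqrt g) \<Sum>i. \<partial>\<^sub>i (sqrt g \<Sum>j. g\<^sup>i\<^sup>j \<partial>\<^sub>j f)\<close>
  for \<open>g\<close> the determinant of the metric and \<open>g\<^sup>i\<^sup>j\<close> the entries of its inverse.
\<close>

definition laplace_beltrami :: "real \<Rightarrow> (real \<times> (real ^ 'n) \<Rightarrow> real) \<Rightarrow> real \<times> (real ^ 'n) \<Rightarrow> real" where
  "laplace_beltrami R f x =
     (1 / vol_density R (snd x)) *
     (\<Sum>i\<in>UNIV. partial i
        (\<lambda>y. vol_density R y *
          (\<Sum>j\<in>UNIV. matrix_inv (metric_matrix R y) $ i $ j * partial j (f \<circ> hyp_chart R) y))
        (snd x))"

fun C_k :: "nat \<Rightarrow> (real ^ 'n \<Rightarrow> real) \<Rightarrow> bool" where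
  "C_k 0 f \<longleftrightarrow> continuous_on UNIV f"
| "C_k (Suc k) f \<longleftrightarrow> f differentiable_on UNIV \<and> (\<forall>i. C_k k (partial i f))"

text \<open>
  The values of \<open>\<phi>\<close> off the hyperboloid are irrelevant.  The hyperboloid is closed in the ambient
  space, so that the ambient closure below is the support of \<open>\<phi>\<close>.
\<close>

definition test_function :: "real \<Rightarrow> (real \<times> (real ^ 'n) \<Rightarrow> real) \<Rightarrow> bool" where
  "test_function R \<phi> \<longleftrightarrow>
     (\<forall>k. C_k k (\<phi> \<circ> hyp_chart R)) \<and> compact (closure {x \<in> hyperboloid R. \<phi> x \<noteq> 0})"

text \<open>
  The integrals run over the hyperboloid without the point \<open>x\<close> (which has measure zero), so the
  values of \<open>H\<close> on the diagonal are irrelevant.  Since the Bochner integral of a non-integrable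
  function is \<open>0\<close>, integrability is required explicitly.
\<close>

definition fundamental_solution ::
    "real \<Rightarrow> (real \<times> (real ^ 'n) \<Rightarrow> real \<times> (real ^ 'n) \<Rightarrow> real) \<Rightarrow> bool" where
  "fundamental_solution R H \<longleftrightarrow>
     (\<forall>\<phi> x. test_function R \<phi> \<longrightarrow> x \<in> hyperboloid R \<longrightarrow>
        set_integrable (hyp_vol R) (hyperboloid R - {x}) (\<lambda>x'. - laplace_beltrami R \<phi> x' * H x x') \<and>
        (LINT x':hyperboloid R - {x}|hyp_vol R. - laplace_beltrami R \<phi> x' * H x x') = \<phi> x)"

definition hyp_I :: "nat \<Rightarrow> real \<Rightarrow> real" where
  "hyp_I d \<rho> = (LINT x:{\<rho><..}|lborel. 1 / sinh x ^ (d - 1))"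

definition hyp_rho :: "real \<Rightarrow> real \<times> (real ^ 'n) \<Rightarrow> real \<times> (real ^ 'n) \<Rightarrow> real" where
  "hyp_rho R x x' = arcosh (mink (x /\<^sub>R R) (x' /\<^sub>R R))"

definition hyp_H :: "real \<Rightarrow> real \<times> (real ^ 'n) \<Rightarrow> real \<times> (real ^ 'n) \<Rightarrow> real" where
  "hyp_H R x x' =
     Gamma (real CARD('n) / 2) / (2 * pi powr (real CARD('n) / 2) * R ^ (CARD('n) - 2)) *
     hyp_I CARD('n) (hyp_rho R x x')"

definition coth :: "real \<Rightarrow> real" where
  "coth x = cosh x / sinh x"

text \<open>Double factorial; the argument is an integer so that \<open>(-1)!! = 1\<close> makes sense.\<close>

function dfact :: "int \<Rightarrow> int" where
  "dfact n = (if n \<le> 0 then 1 else n * dfact (n - 2))"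
  by auto
termination by (relation "Wellfounded.measure nat") auto

declare dfact.simps [simp del]

definition hyp2F1 :: "'a \<Rightarrow> 'a \<Rightarrow> 'a \<Rightarrow> 'a \<Rightarrow> 'a::{real_normed_field,banach}" where
  "hyp2F1 a b c z =
     (\<Sum>n. pochhammer a n * pochhammer b n / (pochhammer c n * fact n) * z ^ n)"

text \<open>
  The associated Legendre function of the second kind, for real \<open>z > 1\<close> and for
  \<open>\<nu> + \<mu> + 1\<close> not in \<open>{0, -1, -2, \<dots>}\<close>.  All bases of the complex powers are positive reals.
\<close>

definition legendre_Q :: "complex \<Rightarrow> complex \<Rightarrow> real \<Rightarrow> complex" where
  "legendre_Q \<nu> \<mu> z =
     of_real (sqrt pi) * exp (\<i> * of_real pi * \<mu>) * Gamma (\<nu> + \<mu> + 1) *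
       of_real (z\<^sup>2 - 1) powr (\<mu> / 2) /
     (2 powr (\<nu> + 1) * Gamma (\<nu> + 3 / 2) * of_real z powr (\<nu> + \<mu> + 1)) *
     hyp2F1 ((\<nu> + \<mu> + 2) / 2) ((\<nu> + \<mu> + 1) / 2) (\<nu> + 3 / 2) (1 / of_real (z\<^sup>2))"

end

theory Submission
  imports Defs
begin

text \<open>The value of \<open>m\<close> is forced by
  \<open>m\<^sup>2 * (1 - \<epsilon>) = 1\<close>, which gives \<open>(m * c)\<^sup>2 - 1 =
  m\<^sup>2 * (c\<^sup>2 - 1 + \<epsilon>)\<close>. The chain rule then produces the power
  \<open>1 - d\<close> of \<open>m\<close>, and the factor \<open>m ^ (d - 1)\<close> offsets it.
  The Laplacian of a function of \<open>c\<close> with derivative \<open>G\<close> is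
  \<open>((c\<^sup>2 - 1) * G' + d * c * G) / R\<^sup>2\<close>. For \<open>\<epsilon> = 0\<close>
  the two terms cancel, so the candidate is harmonic off the pole; for \<open>\<epsilon> > 0\<close>
  only a multiple of \<open>\<epsilon>\<close> survives. Green's formula equates two integrals, and
  each has its own obstacle in the limit. In the one with the Laplacian of the test function, the
  approximations are dominated by a multiple of the singular candidate, so its local integrability
  is the only estimate needed at the pole. In the other one, the chart is not isotropic: near the
  pole \<open>v\<close>, of height \<open>w v\<close>, the function \<open>c\<^sup>2 - 1\<close>
  behaves like the quadratic form
  \<open>(x \<bullet> x - (b \<bullet> x)\<^sup>2) / R\<^sup>2\<close> with
  \<open>b = v /\<^sub>R w v\<close>. Its factor \<open>sqrt (1 - b \<bullet> b) = R / w v\<close>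
  offsets the height in the volume density, so the limiting mass is the same at every pole.\<close>

text \<open>
  Every formula for \<open>hyp_I d\<close> is verified either by differentiation, since \<open>hyp_I d\<close> is the only
  antiderivative of \<open>- 1 / sinh x ^ (d - 1)\<close> that vanishes at infinity, or by induction along a
  recurrence from \<open>d\<close> to \<open>d + 2\<close>.

  For the fundamental solution, let \<open>c\<close> be the hyperbolic cosine of the distance to the pole, so that the
  candidate is \<open>F c\<close> with \<open>F' = - (c\<^sup>2 - 1) powr (- d / 2)\<close>.  For \<open>m = (1 - \<epsilon>) powr (- 1 / 2)\<close> the function
  \<open>m ^ (d - 1) * F (m * c)\<close> is smooth at the pole and has derivative \<open>- (c\<^sup>2 - 1 + \<epsilon>) powr (- d / 2)\<close>.
  Its Laplacian is the explicit negative function \<open>- d * c * \<epsilon> * (c\<^sup>2 - 1 + \<epsilon>) powr (- d / 2 - 1) / R\<^sup>2\<close>.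
  Green's formula in the global chart needs no boundary terms, and after the rescaling
  \<open>y = v + sqrt \<epsilon> *\<^sub>R x\<close> dominated convergence shows that these functions concentrate at the pole.  The
  limit of their mass is computed from the map \<open>x \<mapsto> x /\<^sub>R sqrt (1 + x \<bullet> x)\<close> onto the unit ball, whose
  Jacobian determinant is \<open>(1 + x \<bullet> x) powr (- d / 2 - 1)\<close>.
\<close>

section \<open>The radial integral\<close>

text \<open>For \<open>x > \<rho>\<close> the bound
  \<open>exp (- 2 * x) \<le> exp (- 2 * \<rho>)\<close> makes one factor \<open>1 / sinh x\<close>
  at most a constant times \<open>exp (- x)\<close>; the other \<open>n - 1\<close> factors are
  bounded by their value at \<open>\<rho>\<close>. \<open>C\<close> collects the constants, apart
  from a factor 2.\<close>

lemma set_integrable_inverse_sinh_power: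
  assumes "n \<ge> 1" "\<rho> > 0"
  shows "set_integrable lborel {\<rho><..} (\<lambda>x::real. 1 / sinh x ^ n)"
proof -
  define C where "C = 1 / sinh \<rho> ^ (n - 1) * (1 / (1 - exp (- 2 * \<rho>)))"
  have s\<rho>: "sinh \<rho> > 0" using assms by simp
  have e\<rho>: "exp (- 2 * \<rho>) < 1" using assms by simp
  have C: "C > 0" unfolding C_def using s\<rho> e\<rho> by simp
  have int: "set_integrable lborel {\<rho>..} (\<lambda>x. 2 * C * exp (- x))"
  proof -
    have lim: "((\<lambda>x. - 2 * C * exp (- x)) \<longlongrightarrow> 0) at_top"
      by (rule tendsto_eq_intros filterlim_compose[OF exp_at_bot] filterlim_uminus_at_bot_at_top | simp)+
    have "(\<integral>\<^sup>+x. ennreal (2 * C * exp (- x)) * indicator {\<rho> ..} x \<partial>lborel) = ennreal (0 - - 2 * C * exp (- \<rho>))"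
      by (rule nn_integral_FTC_atLeast[OF _ _ _ lim])
         (use C in \<open>auto intro!: derivative_eq_intros\<close>)
    then have "integrable lborel (\<lambda>x. 2 * C * exp (- x) * indicator {\<rho>..} x)"
      by (intro integrableI_nonneg)
         (use C in \<open>auto simp: ennreal_mult'' ennreal_indicator[symmetric] ennreal_mult_less_top\<close>)
    then show ?thesis
      by (simp add: set_integrable_def mult.commute)
  qed
  have int': "set_integrable lborel {\<rho><..} (\<lambda>x. 2 * C * exp (- x))"
    by (rule set_integrable_subset[OF int]) auto
  show ?thesis
  proof (rule set_integrable_bound[OF int'])
    show "set_borel_measurable lborel {\<rho><..} (\<lambda>x. 1 / sinh x ^ n)"
      unfolding set_borel_measurable_def measurable_lborel2
      by (intro borel_measurable_continuous_on_indicator)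
         (use assms in \<open>auto intro!: continuous_intros simp: sinh_def\<close>)
  next
    have "norm (1 / sinh x ^ n) \<le> norm (2 * C * exp (- x))" if "x > \<rho>" for x
    proof -
      have s: "sinh x \<ge> sinh \<rho>" using that by simp
      have "exp (-x) = exp x * exp (- 2 * x)" by (simp flip: exp_add)
      also have "\<dots> \<le> exp x * exp (- 2 * \<rho>)" using that by simp
      finally have "exp x * (1 - exp (- 2 * \<rho>)) \<le> 2 * sinh x"
        by (simp add: sinh_def algebra_simps)
      then have 1: "1 / sinh x \<le> 2 * exp (-x) * (1 / (1 - exp (- 2 * \<rho>)))"
        using e\<rho> s s\<rho> by (simp add: field_simps exp_minus)
      have "1 / sinh x ^ n = 1 / sinh x ^ (n - 1) * (1 / sinh x)"
        using assms by (cases n) auto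
      also have "\<dots> \<le> 1 / sinh \<rho> ^ (n - 1) * (2 * exp (-x) * (1 / (1 - exp (- 2 * \<rho>))))"
        using s s\<rho> 1 by (intro mult_mono divide_left_mono power_mono) auto
      also have "\<dots> = 2 * C * exp (-x)" by (simp add: C_def)
      finally show ?thesis using s s\<rho> C by simp
    qed
    then show "AE x in lborel. x \<in> {\<rho><..} \<longrightarrow> norm (1 / sinh x ^ n) \<le> norm (2 * C * exp (- x))"
      by simp
  qed
qed

text \<open>The form in which the radial integral enters the fundamental theorem on a half-line and,
  later, Tonelli's theorem.\<close>

lemma hyp_I_has_nn_integral:
  assumes "d \<ge> 2" "\<rho> > 0"
  shows "(\<integral>\<^sup>+x. ennreal (1 / sinh x ^ (d - 1)) * indicator {\<rho><..} x \<partial>lborel) = ennreal (hyp_I d \<rho>)"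
proof -
  have int: "integrable lborel (\<lambda>x. indicator {\<rho><..} x *\<^sub>R (1 / sinh x ^ (d - 1)))"
    using set_integrable_inverse_sinh_power[of "d - 1" \<rho>] assms by (simp add: set_integrable_def)
  have "ennreal (hyp_I d \<rho>) = (\<integral>\<^sup>+x. ennreal (indicator {\<rho><..} x *\<^sub>R (1 / sinh x ^ (d - 1))) \<partial>lborel)"
    unfolding hyp_I_def set_lebesgue_integral_def
    by (rule nn_integral_eq_integral[OF int, symmetric]) (use assms in \<open>auto simp: indicator_def\<close>)
  also have "(\<integral>\<^sup>+x. ennreal (indicator {\<rho><..} x *\<^sub>R (1 / sinh x ^ (d - 1))) \<partial>lborel) =
      (\<integral>\<^sup>+x. ennreal (1 / sinh x ^ (d - 1)) * indicator {\<rho><..} x \<partial>lborel)"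
    by (intro nn_integral_cong) (auto simp: indicator_def)
  finally show ?thesis ..
qed

text \<open>At \<open>\<rho> = 0\<close> the integral diverges and the Bochner integral is
  \<open>0\<close> by convention, so the endpoint can be included.\<close>

lemma hyp_I_nonneg:
  assumes "\<rho> \<ge> 0"
  shows "hyp_I d \<rho> \<ge> 0"
  unfolding hyp_I_def set_lebesgue_integral_def
  by (rule integral_nonneg_AE) (use assms in \<open>auto simp: indicator_def\<close>)

lemma hyp_I_eqI:
  assumes d: "d \<ge> 2"
    and G: "\<And>x. x > 0 \<Longrightarrow> (G has_real_derivative - 1 / sinh x ^ (d - 1)) (at x)"
    and lim: "(G \<longlongrightarrow> 0) at_top"
    and \<rho>: "\<rho> > 0"
  shows "hyp_I d \<rho> = G \<rho>"
proof -
  \<comment> \<open>The fundamental theorem on a half-line asks for an integrand that is Borel on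
    the whole line, hence the cut-off at \<open>0\<close>.\<close>
  define g where "g x = indicator {0<..} x *\<^sub>R (1 / sinh x ^ (d - 1))" for x :: real
  have gm: "g \<in> borel_measurable borel"
    unfolding g_def
    by (intro borel_measurable_continuous_on_indicator)
       (auto intro!: continuous_intros simp: sinh_def)
  have "(\<integral>\<^sup>+x. ennreal (g x) * indicator {\<rho>..} x \<partial>lborel) = ennreal (0 - - G \<rho>)"
  proof (rule nn_integral_FTC_atLeast[OF gm])
    show "((\<lambda>x. - G x) \<longlongrightarrow> 0) at_top" using tendsto_minus[OF lim] by simp
    show "((\<lambda>x. - G x) has_real_derivative g x) (at x)" if "\<rho> \<le> x" for x
      using DERIV_minus[OF G[of x]] that \<rho> by (simp add: g_def)
  qed (use \<rho> in \<open>auto simp: g_def\<close>)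
  also have "(\<integral>\<^sup>+x. ennreal (g x) * indicator {\<rho>..} x \<partial>lborel) =
     (\<integral>\<^sup>+x. ennreal (1 / sinh x ^ (d - 1)) * indicator {\<rho><..} x \<partial>lborel)"
  proof (rule nn_integral_cong_AE)
    have "AE x in lborel. x \<noteq> \<rho>" by (rule AE_lborel_singleton)
    then show "AE x in lborel. ennreal (g x) * indicator {\<rho>..} x = ennreal (1 / sinh x ^ (d - 1)) * indicator {\<rho><..} x"
      by eventually_elim (use \<rho> in \<open>auto simp: g_def indicator_def\<close>)
  qed
  finally have *: "ennreal (hyp_I d \<rho>) = ennreal (G \<rho>)"
    using hyp_I_has_nn_integral[OF d \<rho>] by simp
  \<comment> \<open>\<open>ennreal\<close> sends negative numbers to \<open>0\<close>, so the
    preceding equality descends to the reals only once \<open>G \<rho>\<close> is known to be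
    nonnegative. This holds because \<open>G\<close> decreases to its limit
    \<open>0\<close>.\<close>
  have "G \<rho> \<ge> 0"
  proof (rule tendsto_le[OF _ tendsto_const lim])
    show "\<forall>\<^sub>F x in at_top. G x \<le> G \<rho>"
      using eventually_ge_at_top[of \<rho>]
    proof eventually_elim
      case (elim x)
      show ?case
      proof (rule DERIV_nonpos_imp_nonincreasing[OF elim])
        fix t assume "\<rho> \<le> t"
        then show "\<exists>y. (G has_real_derivative y) (at t) \<and> y \<le> 0"
          using G[of t] \<rho> by (intro exI[of _ "- 1 / sinh t ^ (d - 1)"]) auto
      qed
    qed
  qed auto
  with * hyp_I_nonneg[of \<rho> d] \<rho> show ?thesis
    by simp
qed

section \<open>Hypergeometric representations\<close>

text \<open>Ratio test: the quotients \<open>(x + n) / (y + n)\<close> tend to 1, so the ratio of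
  consecutive terms tends to \<open>\<bar>z\<bar>\<close> in absolute value.\<close>

lemma hypergeom_coeff_summable:
  fixes a b c z :: real
  assumes "c > 0" "\<bar>z\<bar> < 1"
  shows "summable (\<lambda>n. pochhammer a n * pochhammer b n / (pochhammer c n * fact n) * z ^ n)"
proof -
  define u where "u n = pochhammer a n * pochhammer b n / (pochhammer c n * fact n)" for n
  have cn: "c + real n > 0" for n using assms by simp
  have u_Suc: "u (Suc n) = u n * ((a + n) * (b + n) / ((c + n) * (1 + real n)))" for n
    using cn[of n] by (simp add: u_def pochhammer_Suc field_simps)
  have lim: "(\<lambda>n. \<bar>((a + n) * (b + n) / ((c + n) * (1 + real n)))\<bar> * \<bar>z\<bar>) \<longlonglongrightarrow> \<bar>z\<bar>"
  proof -
    have 1: "(\<lambda>n. (x + real n) / (y + real n)) \<longlonglongrightarrow> 1" if "y > 0" for x y :: real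
    proof -
      have "filterlim (\<lambda>n. y + real n) at_top sequentially"
        by (intro filterlim_tendsto_add_at_top[OF tendsto_const] filterlim_real_sequentially)
      then have "(\<lambda>n. 1 + (x - y) / (y + real n)) \<longlonglongrightarrow> 1 + 0"
        by (intro tendsto_intros tendsto_divide_0[OF tendsto_const] filterlim_at_top_imp_at_infinity)
      moreover have "1 + (x - y) / (y + real n) = (x + real n) / (y + real n)" for n
        using that by (simp add: field_simps add_pos_nonneg)
      ultimately show ?thesis by simp
    qed
    have "(\<lambda>n. \<bar>((a + real n) / (c + n)) * ((b + real n) / (1 + real n))\<bar> * \<bar>z\<bar>) \<longlonglongrightarrow> \<bar>1 * 1\<bar> * \<bar>z\<bar>"
      by (intro 1 tendsto_mult tendsto_rabs tendsto_const) (use assms in auto)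
    then show ?thesis by simp
  qed
  obtain r where r: "\<bar>z\<bar> < r" "r < 1" using assms(2) dense by blast
  from order_tendstoD(2)[OF lim r(1)] obtain N where
    N: "\<And>n. n \<ge> N \<Longrightarrow> \<bar>((a + n) * (b + n) / ((c + n) * (1 + real n)))\<bar> * \<bar>z\<bar> < r"
    unfolding eventually_sequentially by auto
  have "summable (\<lambda>n. u n * z ^ n)"
  proof (rule summable_ratio_test[OF r(2), of N])
    fix n assume n: "n \<ge> N"
    have "norm (u (Suc n) * z ^ Suc n) = (\<bar>((a + n) * (b + n) / ((c + n) * (1 + real n)))\<bar> * \<bar>z\<bar>) * norm (u n * z ^ n)"
      by (simp add: u_Suc abs_mult mult_ac)
    also have "\<dots> \<le> r * norm (u n * z ^ n)"
      by (rule mult_right_mono[OF less_imp_le[OF N[OF n]]]) simp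
    finally show "norm (u (Suc n) * z ^ Suc n) \<le> r * norm (u n * z ^ n)" .
  qed
  then show ?thesis by (simp add: u_def)
qed

text \<open>The Euler operator \<open>z * d/dz\<close> multiplies the \<open>n\<close>-th
  coefficient by \<open>n\<close>. In this form a recurrence between coefficients turns into a
  differential equation without shifting the index.\<close>

lemma power_series_has_derivative_times:
  fixes u :: "nat \<Rightarrow> real"
  assumes sm: "\<And>z. \<bar>z\<bar> < 1 \<Longrightarrow> summable (\<lambda>n. u n * z ^ n)" and z: "\<bar>z\<bar> < 1"
  shows "\<exists>D. ((\<lambda>z. \<Sum>n. u n * z ^ n) has_real_derivative D) (at z) \<and>
             (\<lambda>n. real n * u n * z ^ n) sums (z * D)"
proof -
  obtain r where r: "\<bar>z\<bar> < r" "r < 1" using z dense by blast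
  have r0: "r \<ge> 0" using r by linarith
  define D where "D = (\<Sum>n. diffs u n * z ^ n)"
  have 1: "((\<lambda>z. \<Sum>n. u n * z ^ n) has_real_derivative D) (at z)"
    unfolding D_def
    by (rule termdiffs_strong[of u r]) (use r r0 sm[of r] in auto)
  have "summable (\<lambda>n. diffs u n * z ^ n)"
    by (rule termdiff_converges[of z 1]) (use z sm in auto)
  then have "(\<lambda>n. diffs u n * z ^ n) sums D"
    unfolding D_def by (rule summable_sums)
  then have "(\<lambda>n. z * (diffs u n * z ^ n)) sums (z * D)"
    by (rule sums_mult)
  then have "(\<lambda>n. real (Suc n) * u (Suc n) * z ^ Suc n) sums (z * D)"
    by (simp add: diffs_def mult_ac)
  then have "(\<lambda>n. real n * u n * z ^ n) sums (z * D + real 0 * u 0 * z ^ 0)"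
    by (rule sums_Suc)
  then show ?thesis using 1 by auto
qed

lemma hyp2F1_at_0: "hyp2F1 a b c 0 = (1::real)"
  using suminf_finite[of "{0::nat}" "\<lambda>n. pochhammer a n * pochhammer b n / (pochhammer c n * fact n) * 0 ^ n"]
  by (simp add: hyp2F1_def)

lemma hyp2F1_cosh_tendsto:
  assumes "c > 0"
  shows "((\<lambda>x. hyp2F1 a b c (1 / (cosh x)\<^sup>2)) \<longlongrightarrow> (1::real)) at_top"
proof -
  obtain D where "((\<lambda>z. hyp2F1 a b c z) has_real_derivative D) (at 0)"
    unfolding hyp2F1_def
    using power_series_has_derivative_times[OF hypergeom_coeff_summable[OF assms, of _ a b], of 0] by auto
  then have "isCont (\<lambda>z. hyp2F1 a b c z) 0" by (rule DERIV_isCont)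
  moreover have "((\<lambda>x::real. 1 / (cosh x)\<^sup>2) \<longlongrightarrow> 0) at_top"
    by (intro tendsto_divide_0[OF tendsto_const] filterlim_at_top_imp_at_infinity
        filterlim_pow_at_top cosh_real_at_top) auto
  ultimately show ?thesis
    using isCont_tendsto_compose[of 0 "\<lambda>z. hyp2F1 a b c z"] by (simp add: hyp2F1_at_0)
qed

lemma inverse_cosh_power_tendsto:
  assumes "n > 0"
  shows "((\<lambda>x::real. 1 / (k * cosh x ^ n)) \<longlongrightarrow> 0) at_top"
proof -
  have "((\<lambda>x::real. (1 / k) * (1 / cosh x ^ n)) \<longlongrightarrow> (1/k) * 0) at_top"
    by (intro tendsto_intros tendsto_divide_0[OF tendsto_const] filterlim_at_top_imp_at_infinity
        filterlim_pow_at_top cosh_real_at_top assms)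
  then show ?thesis by simp
qed

lemma inverse_cosh_square_less_1: "x > 0 \<Longrightarrow> \<bar>1 / (cosh x)\<^sup>2\<bar> < (1::real)"
  by (simp add: cosh_square_eq add_pos_nonneg divide_less_eq)

lemma inverse_cosh_square_has_derivative:
  "((\<lambda>x::real. 1 / (cosh x)\<^sup>2) has_real_derivative - 2 * sinh x / cosh x ^ 3) (at x)"
  by (auto intro!: derivative_eq_intros simp: power2_eq_square power3_eq_cube field_simps)

text \<open>The base is the square of \<open>sinh x / cosh x\<close>. The left-hand side is the sum
  of the binomial series that appears in the next derivative.\<close>

lemma cosh_over_sinh_powr:
  assumes "x > 0"
  shows "(1 - 1 / (cosh x)\<^sup>2) powr (- (real d / 2)) = cosh x ^ d / sinh x ^ d"
proof -
  have s: "sinh x > 0" using assms by simp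
  have "1 - 1 / (cosh x)\<^sup>2 = (sinh x / cosh x)\<^sup>2"
    by (simp add: power_divide diff_divide_distrib sinh_square_eq)
  then have "(1 - 1 / (cosh x)\<^sup>2) powr (- (real d / 2)) = (sinh x / cosh x) powr (2 * (- (real d / 2)))"
    using s by (simp add: powr_powr flip: powr_numeral)
  also have "\<dots> = cosh x ^ d / sinh x ^ d"
    using s by (simp add: powr_minus powr_realpow power_divide)
  finally show ?thesis .
qed

text \<open>The lower parameter exceeds the first upper parameter by 1, so the Pochhammer symbols
  telescope and \<open>(d - 1 + 2 * n) * u n\<close> is \<open>d - 1\<close> times the coefficient
  of the binomial series of \<open>(1 - z) powr (- d / 2)\<close>. Hence
  \<open>(d - 1) * F + 2 * z * F'\<close> is elementary, and up to a factor this combination is the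
  derivative sought.\<close>

lemma hyp2F1_cosh_has_derivative:
  assumes d: "d \<ge> 2" and x: "x > 0"
  shows "((\<lambda>x. 1 / (real (d - 1) * cosh x ^ (d - 1)) *
           hyp2F1 ((real d - 1) / 2) (real d / 2) ((real d + 1) / 2) (1 / (cosh x)\<^sup>2)) has_real_derivative
      - 1 / sinh x ^ (d - 1)) (at x)"
proof -
  let ?F = "hyp2F1 ((real d - 1) / 2) (real d / 2) ((real d + 1) / 2)"
  define u where "u n = pochhammer ((real d - 1) / 2) n * pochhammer (real d / 2) n / (pochhammer ((real d + 1) / 2) n * fact n)" for n
  have c0: "(real d + 1) / 2 > 0" by simp
  have sm: "summable (\<lambda>n. u n * z ^ n)" if "\<bar>z\<bar> < 1" for z
    unfolding u_def by (rule hypergeom_coeff_summable[OF c0 that])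
  have F: "?F = (\<lambda>z. \<Sum>n. u n * z ^ n)"
    by (auto simp: hyp2F1_def u_def)
  have un: "(real (d - 1) + 2 * real n) * u n = real (d - 1) * (pochhammer (real d / 2) n / fact n)" for n
  proof -
    let ?a = "(real d - 1) / 2"
    have "pochhammer ?a n * (?a + n) = ?a * pochhammer (?a + 1) n"
      by (metis pochhammer_Suc pochhammer_rec)
    moreover have "pochhammer (?a + 1) n > 0" using d by (intro pochhammer_pos) (simp add: add_pos_nonneg)
    moreover have "?a + 1 = (real d + 1) / 2" by (simp add: field_simps)
    ultimately have p: "pochhammer ?a n * (?a + n) = ?a * pochhammer ((real d + 1) / 2) n"
      "pochhammer ((real d + 1) / 2) n > 0" by simp_all
    have d1: "real (d - 1) = 2 * ?a" using d by (simp add: of_nat_diff)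
    have "(real (d - 1) + 2 * real n) * u n = 2 * (pochhammer ?a n * (?a + n)) * pochhammer (real d / 2) n / (pochhammer ((real d + 1) / 2) n * fact n)"
      unfolding d1 u_def by (simp add: algebra_simps)
    also have "\<dots> = 2 * ?a * (pochhammer (real d / 2) n / fact n)"
      unfolding p(1) using p(2) by (simp add: field_simps)
    finally show ?thesis unfolding d1 .
  qed
  let ?z = "1 / (cosh x)\<^sup>2"
  have z: "\<bar>?z\<bar> < 1" by (rule inverse_cosh_square_less_1[OF x])
  obtain D where D: "(?F has_real_derivative D) (at ?z)"
    and D': "(\<lambda>n. real n * u n * ?z ^ n) sums (?z * D)"
    using power_series_has_derivative_times[OF sm z] unfolding F by auto
  have "(\<lambda>n. u n * ?z ^ n) sums ?F ?z"
    unfolding F by (rule summable_sums[OF sm[OF z]])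
  from sums_add[OF sums_mult[OF this, of "real (d - 1)"] sums_mult[OF D', of 2]]
  have "(\<lambda>n. (real (d - 1) + 2 * real n) * u n * ?z ^ n) sums (real (d - 1) * ?F ?z + 2 * (?z * D))"
    by (simp add: algebra_simps)
  then have 1: "(\<lambda>n. real (d - 1) * (pochhammer (real d / 2) n / fact n * ?z ^ n)) sums (real (d - 1) * ?F ?z + 2 * (?z * D))"
    unfolding un by (simp add: mult_ac)
  \<comment> \<open>Newton's series with a negative exponent; the signs of the generalised binomial
    coefficients cancel those of the powers of \<open>- ?z\<close>.\<close>
  have "(\<lambda>n. ((- (real d / 2)) gchoose n) * (- ?z) ^ n) sums (1 + - ?z) powr (- (real d / 2))"
    by (rule gen_binomial_real) (use z in auto)
  moreover have "((- (real d / 2)) gchoose n) * (- ?z) ^ n = pochhammer (real d / 2) n / fact n * ?z ^ n" for n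
    by (simp add: gbinomial_pochhammer power_minus[of "?z"] field_simps flip: power_mult_distrib)
  ultimately have "(\<lambda>n. pochhammer (real d / 2) n / fact n * ?z ^ n) sums (cosh x ^ d / sinh x ^ d)"
    using cosh_over_sinh_powr[OF x, of d] by simp
  from sums_unique2[OF sums_mult[OF this, of "real (d - 1)"] 1]
  have key: "real (d - 1) * ?F ?z + 2 * (?z * D) = real (d - 1) * (cosh x ^ d / sinh x ^ d)" by simp
  have dF: "((\<lambda>x. ?F (1 / (cosh x)\<^sup>2)) has_real_derivative D * (- 2 * sinh x / cosh x ^ 3)) (at x)"
    by (rule DERIV_chain2[OF D inverse_cosh_square_has_derivative])
  have dc: "((\<lambda>x::real. 1 / (real (d - 1) * cosh x ^ (d - 1))) has_real_derivative - sinh x / cosh x ^ d) (at x)"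
  proof -
    obtain m where m: "d = Suc (Suc m)" using d by (metis add_2_eq_Suc le_Suc_ex)
    have "((\<lambda>x::real. 1 / real (Suc m) * inverse (cosh x) ^ Suc m) has_real_derivative
        1 / real (Suc m) * ((1 + of_nat m) * (- (inverse (cosh x) * sinh x * inverse (cosh x)) * inverse (cosh x) ^ m))) (at x)"
      by (intro DERIV_cmult DERIV_power_Suc DERIV_inverse') (auto intro!: derivative_eq_intros)
    moreover have "1 / real (Suc m) * ((1 + of_nat m) * (- (inverse (cosh x) * sinh x * inverse (cosh x)) * inverse (cosh x) ^ m))
        = - sinh x / cosh x ^ d"
    proof -
      have "1 / real (Suc m) * (1 + of_nat m) = (1::real)" by simp
      then show ?thesis
        by (simp only: mult.assoc[symmetric]) (simp add: m power_inverse field_simps)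
    qed
    moreover have "1 / real (d - 1) * inverse (cosh y) ^ Suc m = 1 / (real (d - 1) * cosh y ^ (d - 1))" for y
      by (simp add: m power_inverse field_simps del: of_nat_Suc)
    ultimately show ?thesis by (simp add: m del: of_nat_Suc power_Suc)
  qed
  have s: "sinh x > 0" "cosh x > 0" using x by simp_all
  have c: "cosh x ^ d = cosh x * cosh x ^ (d - 1)" "sinh x ^ d = sinh x * sinh x ^ (d - 1)"
    using d by (simp_all flip: power_Suc)
  have d1: "real (d - 1) > 0" using d by simp
  have "(- sinh x / cosh x ^ d) * ?F ?z + (D * (- 2 * sinh x / cosh x ^ 3)) * (1 / (real (d - 1) * cosh x ^ (d - 1)))
      = - (sinh x / (cosh x ^ d * real (d - 1))) * (real (d - 1) * ?F ?z + 2 * (?z * D))"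
    using s d1 by (simp add: c field_simps power3_eq_cube power2_eq_square)
  also have "\<dots> = - 1 / sinh x ^ (d - 1)"
    unfolding key using s d1 by (simp add: c)
  finally have e: "(- sinh x / cosh x ^ d) * ?F ?z + (D * (- 2 * sinh x / cosh x ^ 3)) * (1 / (real (d - 1) * cosh x ^ (d - 1)))
     = - 1 / sinh x ^ (d - 1)" .
  show ?thesis
    using DERIV_mult[OF dc dF] unfolding e[symmetric] .
qed

lemma hyp2F1_cosh_tendsto_0:
  assumes d: "d \<ge> 2"
  shows "((\<lambda>x. 1 / (real (d - 1) * cosh x ^ (d - 1)) *
           hyp2F1 ((real d - 1) / 2) (real d / 2) ((real d + 1) / 2) (1 / (cosh x)\<^sup>2)) \<longlongrightarrow> 0) at_top"
proof -
  have "((\<lambda>x. 1 / (real (d - 1) * cosh x ^ (d - 1)) *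
           hyp2F1 ((real d - 1) / 2) (real d / 2) ((real d + 1) / 2) (1 / (cosh x)\<^sup>2)) \<longlongrightarrow> 0 * 1) at_top"
    by (intro tendsto_mult inverse_cosh_power_tendsto hyp2F1_cosh_tendsto) (use d in auto)
  then show ?thesis by simp
qed

lemma hyp_I_eq_hyp2F1_cosh:
  assumes d: "d \<ge> 2" and \<rho>: "\<rho> > 0"
  shows "hyp_I d \<rho> = 1 / (real (d - 1) * cosh \<rho> ^ (d - 1)) *
           hyp2F1 ((real d - 1) / 2) (real d / 2) ((real d + 1) / 2) (1 / (cosh \<rho>)\<^sup>2)"
  by (rule hyp_I_eqI[OF d hyp2F1_cosh_has_derivative[OF d] hyp2F1_cosh_tendsto_0[OF d] \<rho>])

text \<open>The derivative is read off from the hypergeometric form, which agrees with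
  \<open>hyp_I d\<close> on the open half-line.\<close>

lemma hyp_I_has_derivative:
  assumes d: "d \<ge> 2" and \<rho>: "\<rho> > 0"
  shows "(hyp_I d has_real_derivative - 1 / sinh \<rho> ^ (d - 1)) (at \<rho>)"
  by (rule has_field_derivative_transform_within_open[OF hyp2F1_cosh_has_derivative[OF d \<rho>], of "{0<..}"])
     (use \<rho> hyp_I_eq_hyp2F1_cosh[OF d] in auto)

lemma hyp_I_tendsto_0:
  assumes d: "d \<ge> 2"
  shows "(hyp_I d \<longlongrightarrow> 0) at_top"
proof (rule Lim_transform_eventually[OF hyp2F1_cosh_tendsto_0[OF d]])
  show "\<forall>\<^sub>F x in at_top. 1 / (real (d - 1) * cosh x ^ (d - 1)) *
           hyp2F1 ((real d - 1) / 2) (real d / 2) ((real d + 1) / 2) (1 / (cosh x)\<^sup>2) = hyp_I d x"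
    using eventually_gt_at_top[of 0] by eventually_elim (use hyp_I_eq_hyp2F1_cosh[OF d] in auto)
qed

text \<open>
  Since one upper parameter is \<open>1\<close>, the coefficient recurrence \<open>(c + n) u (n + 1) = (1 / 2 + n) u n\<close> is
  equivalent to a differential equation of first order.
\<close>

lemma hyp_I_eq_hyp2F1_sinh:
  assumes d: "d \<ge> 2" and \<rho>: "\<rho> > 0"
  shows "hyp_I d \<rho> = 1 / (real (d - 1) * cosh \<rho> * sinh \<rho> ^ (d - 2)) *
           hyp2F1 (1 / 2) 1 ((real d + 1) / 2) (1 / (cosh \<rho>)\<^sup>2)"
proof (rule hyp_I_eqI[OF d _ _ \<rho>])
  let ?c = "(real d + 1) / 2"
  let ?F = "hyp2F1 (1 / 2) 1 ?c"
  define u where "u n = pochhammer (1 / 2) n * pochhammer 1 n / (pochhammer ?c n * fact n)" for n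
  have c0: "?c > 0" by simp
  have sm: "summable (\<lambda>n. u n * z ^ n)" if "\<bar>z\<bar> < 1" for z
    unfolding u_def by (rule hypergeom_coeff_summable[OF c0 that])
  have F: "?F = (\<lambda>z. \<Sum>n. u n * z ^ n)"
    by (auto simp: hyp2F1_def u_def)
  have un: "u n = pochhammer (1 / 2) n / pochhammer ?c n" for n
    by (simp add: u_def flip: pochhammer_fact)
  have u_Suc: "(?c + real n) * u (Suc n) = (1/2 + real n) * u n" for n
  proof -
    have "k * (a * h / (p * k)) = h * (a / p)" if "k > 0" for k a h p :: real
      using that by simp
    moreover have "?c + real n > 0" using c0 by linarith
    ultimately show ?thesis unfolding un pochhammer_Suc by blast
  qed
  fix x :: real assume x: "x > 0"
  define z where "z = 1 / (cosh x)\<^sup>2"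
  have z: "\<bar>z\<bar> < 1" unfolding z_def by (rule inverse_cosh_square_less_1[OF x])
  obtain D where D: "(?F has_real_derivative D) (at z)"
    and D': "(\<lambda>n. real n * u n * z ^ n) sums (z * D)"
    using power_series_has_derivative_times[OF sm z] unfolding F by auto
  have S: "(\<lambda>n. u n * z ^ n) sums ?F z"
    unfolding F by (rule summable_sums[OF sm[OF z]])
  have e: "?c - 1 + real (Suc n) = ?c + real n" for n by (simp add: field_simps)
  from sums_mult[OF sums_add[OF sums_mult[OF S, of "1/2"] D'], of z]
  have "(\<lambda>n. (1/2 + real n) * u n * z ^ Suc n) sums (z * (1 / 2 * ?F z + z * D))"
    by (simp add: algebra_simps)
  then have "(\<lambda>n. (?c - 1 + real (Suc n)) * u (Suc n) * z ^ Suc n) sums (z * (1 / 2 * ?F z + z * D))"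
    unfolding u_Suc[symmetric] by (simp only: e)
  \<comment> \<open>The shifted recurrence does not reach the term \<open>n = 0\<close>. Adding it
    contributes \<open>?c - 1\<close>, the inhomogeneous term of the differential equation.\<close>
  then have 1: "(\<lambda>n. (?c - 1 + real n) * u n * z ^ n) sums (z * (1 / 2 * ?F z + z * D) + (?c - 1 + real 0) * u 0 * z ^ 0)"
    by (rule sums_Suc)
  from sums_add[OF sums_mult[OF S, of "?c - 1"] D']
  have 2: "(\<lambda>n. (?c - 1 + real n) * u n * z ^ n) sums ((?c - 1) * ?F z + z * D)"
    by (simp add: algebra_simps)
  define S where "S = sinh x"
  define C where "C = cosh x"
  define Y where "Y = ?F z"
  have s: "S > 0" "C > 0" using x by (simp_all add: S_def C_def)
  have CS: "C\<^sup>2 = S\<^sup>2 + 1" by (simp add: S_def C_def cosh_square_eq)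
  from sums_unique2[OF 1 2] have "(?c - 1) * Y + z * D = z * (1 / 2 * Y + z * D) + (?c - 1)"
    by (simp add: un Y_def)
  moreover have "z * (1 - z) * D = q * (1 - Y) + z * Y / 2" if "q * Y + z * D = z * (1 / 2 * Y + z * D) + q" for q
    using that by (simp add: algebra_simps)
  \<comment> \<open>The differential equation solved for its derivative term; with
    \<open>z = 1 / C\<^sup>2\<close> it allows \<open>D\<close> to be eliminated in favour of
    \<open>Y\<close>.\<close>
  ultimately have k1: "z * (1 - z) * D = (?c - 1) * (1 - Y) + z * Y / 2"
    by blast
  have "1 - z = (C\<^sup>2 - 1) / C\<^sup>2"
    using s by (simp add: z_def C_def[symmetric] diff_divide_distrib)
  also have "C\<^sup>2 - 1 = S\<^sup>2" using CS by simp
  finally have "z * (1 - z) = 1 / C\<^sup>2 * (S\<^sup>2 / C\<^sup>2)"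
    by (simp only: z_def C_def)
  also have "\<dots> = S\<^sup>2 / C ^ 4"
    by (simp flip: power_add)
  finally have "S\<^sup>2 / C ^ 4 * D = (?c - 1) * (1 - Y) + z * Y / 2"
    using k1 by simp
  also have "\<dots> = (real d - 1) / 2 * (1 - Y) + Y / (2 * C\<^sup>2)"
    by (simp add: z_def C_def field_simps)
  finally have k2: "S\<^sup>2 / C ^ 4 * D = (real d - 1) / 2 * (1 - Y) + Y / (2 * C\<^sup>2)" .
  have "D = ((real d - 1) / 2 * (1 - Y) + Y / (2 * C\<^sup>2)) * C ^ 4 / S\<^sup>2"
    unfolding k2[symmetric] using s by simp
  also have "\<dots> = ((real d - 1) * (1 - Y) * C\<^sup>2 + Y) * C\<^sup>2 / (2 * S\<^sup>2)"
    using s by (simp add: field_simps eval_nat_numeral)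
  finally have Deq: "D = ((real d - 1) * (1 - Y) * C\<^sup>2 + Y) * C\<^sup>2 / (2 * S\<^sup>2)" .
  have dF: "((\<lambda>x. ?F (1 / (cosh x)\<^sup>2)) has_real_derivative D * (- 2 * sinh x / cosh x ^ 3)) (at x)"
    by (rule DERIV_chain2[OF D[unfolded z_def] inverse_cosh_square_has_derivative])
  obtain m where m: "d = Suc (Suc m)" using d by (metis add_2_eq_Suc le_Suc_ex)
  have dc: "((\<lambda>x::real. 1 / (real (d - 1) * cosh x * sinh x ^ (d - 2))) has_real_derivative
      - ((S\<^sup>2 + (real d - 2) * C\<^sup>2) / (real (d - 1) * C\<^sup>2 * S ^ (d - 1)))) (at x)"
  proof -
    define q where "q = real (d - 1)"
    have q: "q > 0" "real d = real m + 2" using d by (simp_all add: q_def m)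
    define f' where "f' = S * S ^ m + real m * S ^ (m - 1) * C * C"
    have f: "((\<lambda>x::real. cosh x * sinh x ^ m) has_real_derivative f') (at x)"
      unfolding f'_def S_def C_def by (auto intro!: derivative_eq_intros)
    have f': "f' * S = S ^ m * (S\<^sup>2 + real m * C\<^sup>2)"
      by (cases m) (simp_all add: f'_def power2_eq_square algebra_simps)
    have "((\<lambda>x::real. 1 / q * inverse (cosh x * sinh x ^ m)) has_real_derivative 1 / q * (- (inverse (C * S ^ m) * f' * inverse (C * S ^ m)))) (at x)"
      unfolding S_def C_def
      by (rule DERIV_cmult[OF DERIV_inverse'[OF f]]) (use x in auto)
    also have "1 / q * (- (inverse (C * S ^ m) * f' * inverse (C * S ^ m))) = - (f' * S) / (q * (C * S ^ m)\<^sup>2 * S)"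
      using s q by (simp add: field_simps power2_eq_square)
    also have "\<dots> = - ((S\<^sup>2 + (real d - 2) * C\<^sup>2) / (q * C\<^sup>2 * S ^ (d - 1)))"
      unfolding f' using s by (simp add: q(2) m power2_eq_square)
    finally show ?thesis
      by (simp add: q_def m field_simps)
  qed
  have d1: "real (d - 1) > 0" using d by simp
  have c: "S ^ (d - 1) = S * S ^ m" "S ^ (d - 2) = S ^ m" by (simp_all add: m)
  have "S ^ m \<noteq> 0" using s by simp
  then have e: "- ((S\<^sup>2 + (real d - 2) * C\<^sup>2) / (real (d - 1) * C\<^sup>2 * S ^ (d - 1))) * Y +
       (D * (- 2 * S / C ^ 3)) * (1 / (real (d - 1) * C * S ^ (d - 2))) = - 1 / S ^ (d - 1)"
  proof -
    define P where "P = S ^ m"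
    define q where "q = real (d - 1)"
    have q: "real d = q + 1" "q > 0" using d1 d by (simp_all add: q_def)
    have P: "P > 0" using s by (simp add: P_def)
    \<comment> \<open>Once \<open>D\<close> is eliminated, the coefficient of \<open>Y\<close> is a
      multiple of \<open>S\<^sup>2 + 1 - C\<^sup>2\<close>, which vanishes.\<close>
    have "- ((S\<^sup>2 + (q - 1) * C\<^sup>2) / (q * C\<^sup>2 * (S * P))) * Y +
       (((q * (1 - Y) * C\<^sup>2 + Y) * C\<^sup>2 / (2 * S\<^sup>2)) * (- 2 * S / C ^ 3)) * (1 / (q * C * P))
      = - (Y * (S\<^sup>2 + 1 - C\<^sup>2) + q * C\<^sup>2) / (q * C\<^sup>2 * (S * P))"
      using s P q(2) by (simp add: field_simps power2_eq_square power3_eq_cube)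
    also have "\<dots> = - 1 / (S * P)"
      using s P q(2) by (simp add: CS[symmetric])
    finally show ?thesis
      unfolding Deq c q_def[symmetric] q(1) P_def[symmetric] by simp
  qed
  show "((\<lambda>x. 1 / (real (d - 1) * cosh x * sinh x ^ (d - 2)) * ?F (1 / (cosh x)\<^sup>2)) has_real_derivative
      - 1 / sinh x ^ (d - 1)) (at x)"
    using DERIV_mult[OF dc dF] e unfolding Y_def z_def S_def C_def by simp
next
  show "((\<lambda>x. 1 / (real (d - 1) * cosh x * sinh x ^ (d - 2)) *
           hyp2F1 (1 / 2) 1 ((real d + 1) / 2) (1 / (cosh x)\<^sup>2)) \<longlongrightarrow> 0) at_top"
  proof -
    have "((\<lambda>x. 1 / (real (d - 1) * cosh x ^ 1) *
           hyp2F1 (1 / 2) 1 ((real d + 1) / 2) (1 / (cosh x)\<^sup>2)) \<longlongrightarrow> 0 * 1) at_top"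
      by (intro tendsto_mult inverse_cosh_power_tendsto hyp2F1_cosh_tendsto) auto
    then have L: "((\<lambda>x. \<bar>1 / (real (d - 1) * cosh x) *
           hyp2F1 (1 / 2) 1 ((real d + 1) / 2) (1 / (cosh x)\<^sup>2)\<bar>) \<longlongrightarrow> 0) at_top"
      using tendsto_rabs_zero by fastforce
    show ?thesis
    proof (rule Lim_null_comparison[OF _ L])
      \<comment> \<open>The power of \<open>sinh\<close> is constant for \<open>d = 2\<close>, so
        the decay is taken from \<open>1 / cosh x\<close> alone; all that is used of the power is
        that it is eventually at least 1.\<close>
      have "\<forall>\<^sub>F x::real in at_top. sinh x \<ge> 1"
        using sinh_real_at_top by (auto simp: filterlim_at_top)
      then show "\<forall>\<^sub>F x in at_top. norm (1 / (real (d - 1) * cosh x * sinh x ^ (d - 2)) *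
           hyp2F1 (1 / 2) 1 ((real d + 1) / 2) (1 / (cosh x)\<^sup>2)) \<le> \<bar>1 / (real (d - 1) * cosh x) *
           hyp2F1 (1 / 2) 1 ((real d + 1) / 2) (1 / (cosh x)\<^sup>2)\<bar>"
      proof eventually_elim
        case (elim x)
        then have "1 \<le> sinh x ^ (d - 2)" by simp
        then have "1 / (real (d - 1) * cosh x * sinh x ^ (d - 2)) \<le> 1 / (real (d - 1) * cosh x)"
          using d by (intro divide_left_mono) (auto intro!: mult_pos_pos)
        moreover have "0 \<le> 1 / (real (d - 1) * cosh x * sinh x ^ (d - 2))"
          by (intro divide_nonneg_nonneg mult_nonneg_nonneg zero_le_power order_trans[OF zero_le_one elim]) auto
        moreover have "\<bar>a * h\<bar> \<le> \<bar>b * h\<bar>" if "a \<le> b" "0 \<le> a" for a b h :: real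
          using that by (simp add: abs_mult mult_right_mono)
        ultimately show ?case
          unfolding real_norm_def by blast
      qed
    qed
  qed
qed

section \<open>Closed forms\<close>

text \<open>The derivative of \<open>cosh x / sinh x ^ d\<close> is
  \<open>- (d - 1) / sinh x ^ (d - 1) - d / sinh x ^ (d + 1)\<close>, because
  \<open>cosh\<^sup>2 = sinh\<^sup>2 + 1\<close>. Integrating this from \<open>\<rho>\<close> to
  infinity gives the recurrence.\<close>

lemma hyp_I_recurrence:
  assumes d: "d \<ge> 2" and \<rho>: "\<rho> > 0"
  shows "hyp_I (d + 2) \<rho> = (cosh \<rho> / sinh \<rho> ^ d - real (d - 1) * hyp_I d \<rho>) / real d"
proof (rule hyp_I_eqI[OF _ _ _ \<rho>])
  show "2 \<le> d + 2" by simp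
next
  fix x :: real assume x: "x > 0"
  define S where "S = sinh x"
  define C where "C = cosh x"
  obtain m where m: "d = Suc (Suc m)" using d by (metis add_2_eq_Suc le_Suc_ex)
  have S: "S > 0" using x by (simp add: S_def)
  have CS: "C\<^sup>2 = S\<^sup>2 + 1" by (simp add: S_def C_def cosh_square_eq)
  have e: "(S * S ^ d - C * (real d * S ^ (d - 1) * C)) / (S ^ d)\<^sup>2 = - real (d - 1) / S ^ (d - 1) - real d / S ^ (d + 1)"
  proof -
    have "(S * S ^ d - C * (real d * S ^ (d - 1) * C)) / (S ^ d)\<^sup>2 = S ^ (d - 1) * (S\<^sup>2 - real d * C\<^sup>2) / (S ^ d)\<^sup>2"
      by (simp add: m power2_eq_square algebra_simps)
    also have "S\<^sup>2 - real d * C\<^sup>2 = - real (d - 1) * S\<^sup>2 - real d"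
      by (simp add: CS m algebra_simps)
    finally show ?thesis using S d by (simp add: m field_simps power2_eq_square)
  qed
  have "((\<lambda>x. (cosh x / sinh x ^ d - real (d - 1) * hyp_I d x) / real d) has_real_derivative
     ((S * S ^ d - C * (real d * S ^ (d - 1) * C)) / (S ^ d)\<^sup>2 - real (d - 1) * (- 1 / S ^ (d - 1))) / real d) (at x)"
    using x d unfolding S_def C_def
    by (auto intro!: derivative_eq_intros hyp_I_has_derivative[OF d x, THEN DERIV_cong] simp: power2_eq_square)
  moreover have "((S * S ^ d - C * (real d * S ^ (d - 1) * C)) / (S ^ d)\<^sup>2 - real (d - 1) * (- 1 / S ^ (d - 1))) / real d = - 1 / sinh x ^ (d + 2 - 1)"
    unfolding e using d by (simp add: S_def diff_divide_distrib)
  ultimately show "((\<lambda>x. (cosh x / sinh x ^ d - real (d - 1) * hyp_I d x) / real d) has_real_derivative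
     - 1 / sinh x ^ (d + 2 - 1)) (at x)" by simp
next
  have 1: "((\<lambda>x::real. 1 / sinh x ^ k) \<longlongrightarrow> 0) at_top" if "k > 0" for k
    by (intro tendsto_divide_0[OF tendsto_const] filterlim_at_top_imp_at_infinity
        filterlim_pow_at_top sinh_real_at_top that)
  have 2: "((\<lambda>x::real. cosh x / sinh x ^ d) \<longlongrightarrow> 0) at_top"
  proof (rule Lim_null_comparison)
    have "((\<lambda>x::real. 1 / sinh x ^ (d - 1) + 1 / sinh x ^ d) \<longlongrightarrow> 0 + 0) at_top"
      by (intro tendsto_add 1) (use d in auto)
    then show "((\<lambda>x::real. 1 / sinh x ^ (d - 1) + 1 / sinh x ^ d) \<longlongrightarrow> 0) at_top" by simp
    show "\<forall>\<^sub>F x::real in at_top. norm (cosh x / sinh x ^ d) \<le> 1 / sinh x ^ (d - 1) + 1 / sinh x ^ d"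
      using eventually_gt_at_top[of 0]
    proof eventually_elim
      case (elim x)
      have "cosh x \<le> sinh x + 1"
        using cosh_minus_sinh[of x] exp_le_one_iff[of "- x"] elim by linarith
      then have "cosh x / sinh x ^ d \<le> (sinh x + 1) / sinh x ^ d"
        using elim by (intro divide_right_mono) auto
      also have "\<dots> = 1 / sinh x ^ (d - 1) + 1 / sinh x ^ d"
        using d elim by (cases d) (auto simp: add_divide_distrib)
      finally show ?case using elim by simp
    qed
  qed
  have "((\<lambda>x. (cosh x / sinh x ^ d - real (d - 1) * hyp_I d x) / real d) \<longlongrightarrow> (0 - real (d - 1) * 0) / real d) at_top"
    by (intro tendsto_intros 2 hyp_I_tendsto_0) (use d in auto)
  then show "((\<lambda>x. (cosh x / sinh x ^ d - real (d - 1) * hyp_I d x) / real d) \<longlongrightarrow> 0) at_top"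
    by simp
qed

lemma cosh_over_sinh_tendsto_1: "((\<lambda>x::real. cosh x / sinh x) \<longlongrightarrow> 1) at_top"
proof -
  have "((\<lambda>x::real. 1 + exp (- x) * (1 / sinh x)) \<longlongrightarrow> 1 + 0 * 0) at_top"
    by (intro tendsto_intros tendsto_divide_0[OF tendsto_const] filterlim_at_top_imp_at_infinity
        sinh_real_at_top filterlim_compose[OF exp_at_bot] filterlim_uminus_at_bot_at_top)
  moreover have "\<forall>\<^sub>F x::real in at_top. 1 + exp (- x) * (1 / sinh x) = cosh x / sinh x"
    using eventually_gt_at_top[of 0]
    by eventually_elim (simp add: field_simps flip: cosh_minus_sinh)
  ultimately show ?thesis
    using Lim_transform_eventually by fastforce
qed

lemma hyp_I_2:
  assumes \<rho>: "\<rho> > 0"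
  shows "hyp_I 2 \<rho> = ln (coth (\<rho> / 2))"
proof (rule hyp_I_eqI[OF _ _ _ \<rho>])
  fix x :: real assume x: "x > 0"
  define S where "S = sinh (x / 2)"
  define C where "C = cosh (x / 2)"
  have S: "S > 0" "C > 0" using x by (simp_all add: S_def C_def)
  have CS: "C\<^sup>2 = S\<^sup>2 + 1" by (simp add: S_def C_def cosh_square_eq)
  have D: "((\<lambda>x. ln (cosh (x / 2) / sinh (x / 2))) has_real_derivative
      (S / C * (S / 2 * S - C * (C / 2)) / (S * S))) (at x)"
    using S unfolding S_def C_def
    by (auto intro!: derivative_eq_intros simp: mult_ac)
  have "S / 2 * S - C * (C / 2) = - 1 / 2"
    using CS by (simp add: power2_eq_square field_simps)
  then have "S / C * (S / 2 * S - C * (C / 2)) / (S * S) = - 1 / (2 * S * C)"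
    using S by (simp only:) (simp add: field_simps)
  moreover have "sinh x = 2 * S * C"
    using sinh_double[of "x / 2"] by (simp add: S_def C_def)
  ultimately show "((\<lambda>x. ln (coth (x / 2))) has_real_derivative - 1 / sinh x ^ (2 - 1)) (at x)"
    using D by (simp add: coth_def)
next
  have "filterlim (\<lambda>x::real. x / 2) at_top at_top"
    unfolding filterlim_at_top
  proof
    fix Z :: real
    show "\<forall>\<^sub>F x in at_top. Z \<le> x / 2"
      using eventually_ge_at_top[of "2 * Z"] by eventually_elim simp
  qed
  from filterlim_compose[OF cosh_over_sinh_tendsto_1 this]
  have "((\<lambda>x. ln (cosh (x / 2) / sinh (x / 2))) \<longlongrightarrow> ln (1::real)) at_top"
    by (intro tendsto_ln) auto
  then show "((\<lambda>x. ln (coth (x / 2))) \<longlongrightarrow> 0) at_top"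
    by (simp add: coth_def)
qed simp

lemma hyp_I_3:
  assumes \<rho>: "\<rho> > 0"
  shows "hyp_I 3 \<rho> = coth \<rho> - 1"
proof (rule hyp_I_eqI[OF _ _ _ \<rho>])
  fix x :: real assume x: "x > 0"
  have "((\<lambda>x. cosh x / sinh x - 1) has_real_derivative ((sinh x)\<^sup>2 - (cosh x)\<^sup>2) / (sinh x)\<^sup>2) (at x)"
    using x by (auto intro!: derivative_eq_intros simp: power2_eq_square)
  then show "((\<lambda>x. coth x - 1) has_real_derivative - 1 / sinh x ^ (3 - 1)) (at x)"
    by (simp add: coth_def cosh_square_eq)
next
  have "((\<lambda>x::real. cosh x / sinh x - 1) \<longlongrightarrow> 1 - 1) at_top"
    by (intro tendsto_intros cosh_over_sinh_tendsto_1)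
  then show "((\<lambda>x. coth x - 1) \<longlongrightarrow> 0) at_top" by (simp add: coth_def)
qed simp

section \<open>Alternating sums with double factorials\<close>

lemma dfact_pos: "dfact n > 0"
  by (induction n rule: dfact.induct) (subst dfact.simps, auto)

text \<open>The bound admits \<open>n = - 1\<close>, where the induction for even dimension
  starts.\<close>

lemma dfact_add_2: "n \<ge> - 1 \<Longrightarrow> dfact (n + 2) = (n + 2) * dfact n"
  by (subst dfact.simps) simp

lemma dfact_simps [simp]: "dfact (-1) = 1" "dfact 0 = 1" "dfact 1 = 1"
  by (simp_all add: dfact.simps)

text \<open>The algebra common to both parities. Here \<open>p\<close> is \<open>d - 1\<close>,
  \<open>s\<close> the sign, \<open>A / B\<close> the quotient of double factorials,
  \<open>c / X\<close> the boundary term of the recurrence and \<open>T\<close> the partial sum. The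
  boundary term becomes the next summand after division by the new prefactor;
  \<open>s * s = 1\<close> removes the sign.\<close>

lemma alternating_recurrence_step:
  fixes p A B X s c L T :: real
  assumes "p > 0" "A > 0" "B > 0" "X > 0" "s * s = 1"
  shows "(c / X - p * (s * (A / B) * (L + c * T))) / (p + 1) =
    - s * (p * A / ((p + 1) * B)) * (L + c * (T + B * (- s) / (p * A * X)))"
proof -
  have "- s * (p * A / ((p + 1) * B)) * (L + c * (T + B * (- s) / (p * A * X))) =
     - (s * (p * A / ((p + 1) * B)) * (L + c * T)) + (s * s) * (p * A / ((p + 1) * B) * (c * B / (p * A * X)))"
    by (simp add: algebra_simps)
  also have "p * A / ((p + 1) * B) * (c * B / (p * A * X)) = c / ((p + 1) * X)"
    using assms by simp
  also have "s * (p * A / ((p + 1) * B)) * (L + c * T) = p * (s * (A / B) * (L + c * T)) / (p + 1)"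
    by (simp add: mult_ac)
  finally show ?thesis
    using assms by (simp add: diff_divide_distrib)
qed

lemma hyp_I_even:
  assumes \<rho>: "\<rho> > 0"
  shows "hyp_I (2 * m + 2) \<rho> =
    (-1) ^ m * (real_of_int (dfact (2 * int m - 1)) / real_of_int (dfact (2 * int m))) *
      (ln (coth (\<rho> / 2)) + cosh \<rho> * (\<Sum>k = 1..m. real_of_int (dfact (2 * int k - 2)) * (-1) ^ k /
               (real_of_int (dfact (2 * int k - 1)) * sinh \<rho> ^ (2 * k))))"
proof (induction m)
  case 0
  then show ?case using hyp_I_2[OF \<rho>] by (simp add: numeral_2_eq_2)
next
  case (Suc m)
  define A where "A = real_of_int (dfact (2 * int m - 1))"
  define B where "B = real_of_int (dfact (2 * int m))"
  define L where "L = ln (coth (\<rho> / 2))"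
  define T where "T = (\<Sum>k = 1..m. real_of_int (dfact (2 * int k - 2)) * (-1) ^ k /
               (real_of_int (dfact (2 * int k - 1)) * sinh \<rho> ^ (2 * k)))"
  have AB: "A > 0" "B > 0" by (simp_all add: A_def B_def dfact_pos)
  have A': "real_of_int (dfact (2 * int (Suc m) - 1)) = (2 * real m + 1) * A"
    using dfact_add_2[of "2 * int m - 1"] by (simp add: A_def algebra_simps)
  have B': "real_of_int (dfact (2 * int (Suc m))) = (2 * real m + 2) * B"
    using dfact_add_2[of "2 * int m"] by (simp add: B_def algebra_simps)
  have B'': "real_of_int (dfact (2 * int (Suc m) - 2)) = B"
    by (simp add: B_def)
  have s: "sinh \<rho> > 0" using \<rho> by simp
  have "hyp_I (2 * Suc m + 2) \<rho> = (cosh \<rho> / sinh \<rho> ^ (2 * m + 2) - (2 * real m + 1) * hyp_I (2 * m + 2) \<rho>) / (2 * real m + 2)"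
    using hyp_I_recurrence[of "2 * m + 2" \<rho>] \<rho> by (simp add: algebra_simps)
  also have "\<dots> = (cosh \<rho> / sinh \<rho> ^ (2 * m + 2) - (2 * real m + 1) * ((-1) ^ m * (A / B) * (L + cosh \<rho> * T))) / (2 * real m + 2)"
    unfolding Suc.IH A_def B_def L_def T_def ..
  also have "\<dots> = (-1) ^ Suc m * ((2 * real m + 1) * A / ((2 * real m + 2) * B)) *
     (L + cosh \<rho> * (T + B * (-1) ^ Suc m / ((2 * real m + 1) * A * sinh \<rho> ^ (2 * Suc m))))"
  proof -
    define p where "p = 2 * real m + 1"
    have p: "p > 0" "2 * real m + 2 = p + 1" by (simp_all add: p_def)
    have "(-1::real) ^ m * (-1) ^ m = 1" by (simp flip: power_add)
    from alternating_recurrence_step[OF p(1) AB _ this, of "sinh \<rho> ^ (2 * m + 2)" "cosh \<rho>" L T]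
    show ?thesis
      unfolding p(2) p_def[symmetric] using s by simp
  qed
  also have "T + B * (-1) ^ Suc m / ((2 * real m + 1) * A * sinh \<rho> ^ (2 * Suc m)) =
     (\<Sum>k = 1..Suc m. real_of_int (dfact (2 * int k - 2)) * (-1) ^ k /
               (real_of_int (dfact (2 * int k - 1)) * sinh \<rho> ^ (2 * k)))"
    by (simp only: sum.cl_ivl_Suc A' B'' T_def) simp
  finally show ?case
    unfolding A' B' L_def[symmetric] .
qed

lemma hyp_I_odd:
  assumes \<rho>: "\<rho> > 0"
  shows "hyp_I (2 * m + 3) \<rho> =
    (-1) ^ Suc m * (real_of_int (dfact (2 * int m)) / real_of_int (dfact (2 * int m + 1))) *
      (1 + cosh \<rho> * (\<Sum>k = 1..Suc m. real_of_int (dfact (2 * int k - 3)) * (-1) ^ k /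
               (real_of_int (dfact (2 * int k - 2)) * sinh \<rho> ^ (2 * k - 1))))"
proof (induction m)
  case 0
  then show ?case using hyp_I_3[OF \<rho>] by (simp add: coth_def)
next
  case (Suc m)
  define A where "A = real_of_int (dfact (2 * int m))"
  define B where "B = real_of_int (dfact (2 * int m + 1))"
  define T where "T = (\<Sum>k = 1..Suc m. real_of_int (dfact (2 * int k - 3)) * (-1) ^ k /
               (real_of_int (dfact (2 * int k - 2)) * sinh \<rho> ^ (2 * k - 1)))"
  have AB: "A > 0" "B > 0" by (simp_all add: A_def B_def dfact_pos)
  have A': "real_of_int (dfact (2 * int (Suc m))) = (2 * real m + 2) * A"
    using dfact_add_2[of "2 * int m"] by (simp add: A_def algebra_simps)
  have B': "real_of_int (dfact (2 * int (Suc m) + 1)) = (2 * real m + 3) * B"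
    using dfact_add_2[of "2 * int m + 1"] by (simp add: B_def algebra_simps)
  have A'': "real_of_int (dfact (2 * int (Suc (Suc m)) - 2)) = (2 * real m + 2) * A"
    using A' by (simp add: algebra_simps)
  have B'': "real_of_int (dfact (2 * int (Suc (Suc m)) - 3)) = B"
    by (simp add: B_def algebra_simps)
  have s: "sinh \<rho> > 0" using \<rho> by simp
  have "hyp_I (2 * Suc m + 3) \<rho> = (cosh \<rho> / sinh \<rho> ^ (2 * m + 3) - (2 * real m + 2) * hyp_I (2 * m + 3) \<rho>) / (2 * real m + 3)"
    using hyp_I_recurrence[of "2 * m + 3" \<rho>] \<rho> by (simp add: algebra_simps)
  also have "\<dots> = (cosh \<rho> / sinh \<rho> ^ (2 * m + 3) - (2 * real m + 2) * ((-1) ^ Suc m * (A / B) * (1 + cosh \<rho> * T))) / (2 * real m + 3)"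
    unfolding Suc.IH A_def B_def T_def ..
  also have "\<dots> = (-1) ^ Suc (Suc m) * ((2 * real m + 2) * A / ((2 * real m + 3) * B)) *
     (1 + cosh \<rho> * (T + B * (-1) ^ Suc (Suc m) / ((2 * real m + 2) * A * sinh \<rho> ^ (2 * m + 3))))"
  proof -
    define p where "p = 2 * real m + 2"
    have p: "p > 0" "2 * real m + 3 = p + 1" by (simp_all add: p_def)
    have "(-1::real) ^ Suc m * (-1) ^ Suc m = 1" by (simp flip: power_add)
    from alternating_recurrence_step[OF p(1) AB _ this, of "sinh \<rho> ^ (2 * m + 3)" "cosh \<rho>" 1 T]
    show ?thesis
      unfolding p(2) p_def[symmetric] using s by simp
  qed
  also have "T + B * (-1) ^ Suc (Suc m) / ((2 * real m + 2) * A * sinh \<rho> ^ (2 * m + 3)) =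
     (\<Sum>k = 1..Suc (Suc m). real_of_int (dfact (2 * int k - 3)) * (-1) ^ k /
               (real_of_int (dfact (2 * int k - 2)) * sinh \<rho> ^ (2 * k - 1)))"
  proof -
    have "2 * Suc (Suc m) - 1 = 2 * m + 3" by simp
    then show ?thesis
      by (simp only: sum.cl_ivl_Suc[of _ _ "Suc m"] A'' B'' T_def) simp
  qed
  finally show ?case unfolding A' B' .
qed

text \<open>The primitive of \<open>(1 - t\<^sup>2) ^ m\<close> that vanishes at \<open>0\<close>.
  It comes from the substitution \<open>t = coth x\<close>, under which
  \<open>1 - t\<^sup>2 = - 1 / (sinh x)\<^sup>2\<close> is also the derivative of \<open>t\<close>;
  this makes the radial integral for \<open>d = 2 * m + 3\<close> polynomial in
  \<open>t\<close>.\<close>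

definition odd_power_sum :: "nat \<Rightarrow> real \<Rightarrow> real" where
  "odd_power_sum m t = (\<Sum>j\<le>m. real (m choose j) * (-1) ^ j * t ^ (2 * j + 1) / real (2 * j + 1))"

lemma odd_power_sum_has_derivative:
  "(odd_power_sum m has_real_derivative (1 - t\<^sup>2) ^ m) (at t)"
proof -
  have "(odd_power_sum m has_real_derivative (\<Sum>j\<le>m. real (m choose j) * (-1) ^ j * (real (2 * j + 1) * t ^ (2 * j)) / real (2 * j + 1))) (at t)"
    unfolding odd_power_sum_def
  proof (intro DERIV_sum DERIV_cdivide DERIV_cmult)
    show "((\<lambda>t. t ^ (2 * j + 1)) has_real_derivative real (2 * j + 1) * t ^ (2 * j)) (at t)" for j
      using DERIV_pow[of "2 * j + 1" t] by simp
  qed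
  also have "(\<Sum>j\<le>m. real (m choose j) * (-1) ^ j * (real (2 * j + 1) * t ^ (2 * j)) / real (2 * j + 1)) = (\<Sum>j\<le>m. real (m choose j) * (- t\<^sup>2) ^ j * 1 ^ (m - j))"
  proof (rule sum.cong)
    fix j
    have "(- t\<^sup>2) ^ j = (-1) ^ j * t ^ (2 * j)"
      by (simp add: power_minus[of "t\<^sup>2"] flip: power_mult)
    then show "real (m choose j) * (-1) ^ j * (real (2 * j + 1) * t ^ (2 * j)) / real (2 * j + 1) = real (m choose j) * (- t\<^sup>2) ^ j * 1 ^ (m - j)"
      by (simp del: of_nat_Suc)
  qed simp
  also have "\<dots> = (- t\<^sup>2 + 1) ^ m"
    by (rule binomial_ring[symmetric])
  finally show ?thesis by simp
qed

text \<open>The reduction formula that integration by parts would give; it is checked by noting that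
  both sides have the same derivative and vanish at \<open>0\<close>.\<close>

lemma odd_power_sum_Suc:
  "(2 * real m + 3) * odd_power_sum (Suc m) t = (2 * real m + 2) * odd_power_sum m t + t * (1 - t\<^sup>2) ^ Suc m"
proof -
  define h where "h t = (2 * real m + 3) * odd_power_sum (Suc m) t - ((2 * real m + 2) * odd_power_sum m t + t * (1 - t\<^sup>2) ^ Suc m)" for t
  have "(h has_real_derivative 0) (at t)" for t
  proof -
    have 1: "((\<lambda>t. (1 - t\<^sup>2) ^ Suc m) has_real_derivative (1 + real m) * ((- (2 * t)) * (1 - t\<^sup>2) ^ m)) (at t)"
      by (rule DERIV_power_Suc) (auto intro!: derivative_eq_intros)
    have "(h has_real_derivative ((2 * real m + 3) * (1 - t\<^sup>2) ^ Suc m - ((2 * real m + 2) * (1 - t\<^sup>2) ^ m +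
       (1 * (1 - t\<^sup>2) ^ Suc m + (1 + real m) * ((- (2 * t)) * (1 - t\<^sup>2) ^ m) * t)))) (at t)"
      unfolding h_def by (intro DERIV_diff DERIV_add DERIV_cmult DERIV_mult odd_power_sum_has_derivative 1 DERIV_ident)
    also have "((2 * real m + 3) * (1 - t\<^sup>2) ^ Suc m - ((2 * real m + 2) * (1 - t\<^sup>2) ^ m +
       (1 * (1 - t\<^sup>2) ^ Suc m + (1 + real m) * ((- (2 * t)) * (1 - t\<^sup>2) ^ m) * t))) = 0"
      by (simp add: algebra_simps power2_eq_square)
    finally show ?thesis .
  qed
  then have "h t = h 0" by (intro DERIV_isconst_all) auto
  also have "h 0 = 0" by (simp add: h_def odd_power_sum_def)
  finally show ?thesis by (simp add: h_def)
qed

text \<open>At \<open>t = 1\<close> the boundary term of the reduction formula vanishes, which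
  leaves Wallis's product.\<close>

lemma odd_power_sum_1:
  "odd_power_sum m 1 = real_of_int (dfact (2 * int m)) / real_of_int (dfact (2 * int m + 1))"
proof (induction m)
  case 0
  show ?case by (simp add: odd_power_sum_def)
next
  case (Suc m)
  have A': "real_of_int (dfact (2 * int (Suc m))) = (2 * real m + 2) * real_of_int (dfact (2 * int m))"
    using dfact_add_2[of "2 * int m"] by (simp add: algebra_simps)
  have B': "real_of_int (dfact (2 * int (Suc m) + 1)) = (2 * real m + 3) * real_of_int (dfact (2 * int m + 1))"
    using dfact_add_2[of "2 * int m + 1"] by (simp add: algebra_simps)
  have "(2 * real m + 3) * odd_power_sum (Suc m) 1 = (2 * real m + 2) * odd_power_sum m 1"
    using odd_power_sum_Suc[of m 1] by simp
  moreover have "2 * real m + 3 \<noteq> 0" by linarith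
  ultimately have "odd_power_sum (Suc m) 1 = (2 * real m + 2) * odd_power_sum m 1 / (2 * real m + 3)"
    by (simp add: nonzero_eq_divide_eq mult.commute)
  then show ?case unfolding A' B' Suc.IH by (simp add: mult.commute)
qed

text \<open>In the variable \<open>coth\<close> the integral runs from \<open>1\<close>, the limit
  at infinity, to \<open>coth \<rho>\<close>. The proof compares recurrences:
  \<open>hyp_I_recurrence\<close> and \<open>odd_power_sum_Suc\<close> agree because
  \<open>1 - (coth \<rho>)\<^sup>2 = - 1 / (sinh \<rho>)\<^sup>2\<close>.\<close>

lemma hyp_I_odd_eq_odd_power_sum:
  assumes \<rho>: "\<rho> > 0"
  shows "hyp_I (2 * m + 3) \<rho> = (-1) ^ Suc m * (odd_power_sum m 1 - odd_power_sum m (coth \<rho>))"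
proof (induction m)
  case 0
  show ?case using hyp_I_3[OF \<rho>] by (simp add: odd_power_sum_def)
next
  case (Suc m)
  have s: "sinh \<rho> > 0" using \<rho> by simp
  have c: "1 - (coth \<rho>)\<^sup>2 = - 1 / (sinh \<rho>)\<^sup>2"
    using s by (simp add: coth_def power_divide field_simps cosh_square_eq)
  have c': "(- 1 / (sinh \<rho>)\<^sup>2) ^ Suc m = - ((-1) ^ m / sinh \<rho> ^ (2 * m + 2))"
    by (simp only: power_divide power_mult[symmetric]) simp
  have "hyp_I (2 * Suc m + 3) \<rho> = (cosh \<rho> / sinh \<rho> ^ (2 * m + 3) - (2 * real m + 2) * hyp_I (2 * m + 3) \<rho>) / (2 * real m + 3)"
    using hyp_I_recurrence[of "2 * m + 3" \<rho>] \<rho> by (simp add: algebra_simps)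
  also have "\<dots> = (-1) ^ m * ((2 * real m + 2) * odd_power_sum m 1 -
      ((2 * real m + 2) * odd_power_sum m (coth \<rho>) + coth \<rho> * (1 - (coth \<rho>)\<^sup>2) ^ Suc m)) / (2 * real m + 3)"
  proof -
    have "coth \<rho> * (1 - (coth \<rho>)\<^sup>2) ^ Suc m = - ((-1) ^ m * (cosh \<rho> / sinh \<rho> ^ (2 * m + 3)))"
      unfolding c c' by (simp add: coth_def power3_eq_cube power_add mult_ac)
    moreover have "(K - p * ((-1) ^ Suc m * (a - b))) / q = (-1) ^ m * (p * a - (p * b + - ((-1) ^ m * K))) / q"
      for K p q a b :: real
      by (cases "even m") (simp_all add: algebra_simps)
    ultimately show ?thesis
      unfolding Suc.IH by (simp only:)
  qed
  also have "\<dots> = (-1) ^ Suc (Suc m) * (odd_power_sum (Suc m) 1 - odd_power_sum (Suc m) (coth \<rho>))"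
  proof -
    have "(2 * real m + 2) * odd_power_sum m 1 = (2 * real m + 3) * odd_power_sum (Suc m) 1"
      using odd_power_sum_Suc[of m 1] by simp
    moreover have "(-1) ^ m * (q * a - q * b) / q = (-1) ^ Suc (Suc m) * (a - b)" if "q > 0" for q a b :: real
      using that by (simp flip: right_diff_distrib)
    moreover have "2 * real m + 3 > 0" by simp
    ultimately show ?thesis
      unfolding odd_power_sum_Suc[symmetric] by (simp only:)
  qed
  finally show ?case .
qed

text \<open>The index shift \<open>k = j + 1\<close> absorbs the minus sign into
  \<open>(-1) ^ k\<close>, and the binomial coefficient is written out in factorials.\<close>

lemma minus_odd_power_sum_eq:
  "- odd_power_sum m t = fact m * (\<Sum>k = 1..Suc m. (-1) ^ k * t ^ (2 * k - 1) /
               (real (2 * k - 1) * fact (k - 1) * fact (Suc m - k)))"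
proof -
  have "(\<Sum>k = 1..Suc m. (-1) ^ k * t ^ (2 * k - 1) / (real (2 * k - 1) * fact (k - 1) * fact (Suc m - k)))
    = (\<Sum>j\<le>m. (-1) ^ Suc j * t ^ (2 * Suc j - 1) / (real (2 * Suc j - 1) * fact (Suc j - 1) * fact (Suc m - Suc j)))"
    using sum.shift_bounds_cl_Suc_ivl[of "\<lambda>k. (-1) ^ k * t ^ (2 * k - 1) / (real (2 * k - 1) * fact (k - 1) * fact (Suc m - k))" 0 m]
    by (simp add: atMost_atLeast0)
  moreover have "fact m * ((-1) ^ Suc j * t ^ (2 * Suc j - 1) / (real (2 * Suc j - 1) * fact (Suc j - 1) * fact (Suc m - Suc j)))
     = - (real (m choose j) * (-1) ^ j * t ^ (2 * j + 1) / real (2 * j + 1))" if "j \<le> m" for j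
    using binomial_fact[OF that, where 'a = real] by (simp add: mult_ac)
  ultimately have "fact m * (\<Sum>k = 1..Suc m. (-1) ^ k * t ^ (2 * k - 1) / (real (2 * k - 1) * fact (k - 1) * fact (Suc m - k)))
     = (\<Sum>j\<le>m. - (real (m choose j) * (-1) ^ j * t ^ (2 * j + 1) / real (2 * j + 1)))"
    by (simp only: sum_distrib_left) (rule sum.cong, auto)
  then show ?thesis
    by (simp only: odd_power_sum_def sum_negf)
qed

lemma Gamma_real_duplication:
  fixes x :: real
  assumes "x > 0"
  shows "Gamma x * Gamma (x + 1 / 2) = 2 powr (1 - 2 * x) * sqrt pi * Gamma (2 * x)"
proof -
  have np: "complex_of_real y \<notin> \<int>\<^sub>\<le>\<^sub>0" if "y > 0" for y
    using that by (auto simp: of_real_in_nonpos_Ints_iff elim!: nonpos_Ints_cases)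
  have h: "complex_of_real x + 1 / 2 = of_real (x + 1 / 2)" by simp
  have "Gamma (complex_of_real x) * Gamma (complex_of_real x + 1 / 2) =
      exp ((1 - 2 * complex_of_real x) * of_real (ln 2)) * of_real (sqrt pi) * Gamma (2 * complex_of_real x)"
    by (rule Gamma_legendre_duplication) (use assms np[of x] np[of "x + 1 / 2"] in simp_all)
  also have "(1 - 2 * complex_of_real x) * of_real (ln 2) = of_real ((1 - 2 * x) * ln 2)" by simp
  also have "2 * complex_of_real x = of_real (2 * x)" by simp
  finally have "complex_of_real (Gamma x * Gamma (x + 1 / 2)) = of_real (exp ((1 - 2 * x) * ln 2) * sqrt pi * Gamma (2 * x))"
    by (simp only: h Gamma_complex_of_real exp_of_real of_real_mult[symmetric])
  then show ?thesis
    by (simp only: of_real_eq_iff powr_def) simp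
qed

section \<open>The Legendre function\<close>

lemma hyp2F1_of_real:
  fixes a b c z :: real
  assumes "c > 0" "\<bar>z\<bar> < 1"
  shows "hyp2F1 (complex_of_real a) (of_real b) (of_real c) (of_real z) = of_real (hyp2F1 a b c z)"
proof -
  have "(\<lambda>n. complex_of_real (pochhammer a n * pochhammer b n / (pochhammer c n * fact n) * z ^ n)) sums
      complex_of_real (hyp2F1 a b c z)"
    unfolding hyp2F1_def
    by (intro sums_of_real summable_sums hypergeom_coeff_summable assms)
  then show ?thesis
    unfolding hyp2F1_def[of "complex_of_real a"]
    by (simp add: sums_iff flip: pochhammer_of_real)
qed

text \<open>For \<open>\<nu> = \<mu> = d / 2 - 1\<close> the series in \<open>legendre_Q\<close> is
  that of \<open>hyp_I_eq_hyp2F1_cosh\<close> with the upper parameters exchanged. The phases and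
  the powers of \<open>sinh\<close> cancel, and the duplication formula at
  \<open>(d - 1) / 2\<close> matches the remaining constants.\<close>

lemma hyp_I_eq_legendre_Q:
  assumes d: "d \<ge> 2" and \<rho>: "\<rho> > 0"
  shows "complex_of_real (hyp_I d \<rho>) =
         exp (- \<i> * of_real (pi * (real d / 2 - 1))) /
         of_real (2 powr (real d / 2 - 1) * Gamma (real d / 2) * sinh \<rho> powr (real d / 2 - 1)) *
         legendre_Q (of_real (real d / 2 - 1)) (of_real (real d / 2 - 1)) (cosh \<rho>)"
proof -
  define \<nu> where "\<nu> = real d / 2 - 1"
  define e where "e = exp (\<i> * of_real pi * complex_of_real \<nu>)"
  define Y where "Y = hyp2F1 ((real d - 1) / 2) (real d / 2) ((real d + 1) / 2) (1 / (cosh \<rho>)\<^sup>2)"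
  have s: "sinh \<rho> > 0" using \<rho> by simp
  have c: "cosh \<rho> > 0" by simp
  have e: "e \<noteq> 0" "exp (- \<i> * of_real (pi * \<nu>)) = inverse e"
    by (simp_all add: e_def exp_minus mult.assoc)
  have \<nu>: "complex_of_real \<nu> + complex_of_real \<nu> + 1 = of_real (real d - 1)"
    "complex_of_real \<nu> + 3 / 2 = of_real ((real d + 1) / 2)"
    "complex_of_real \<nu> + 1 = of_real (real d / 2)"
    "(complex_of_real \<nu> + complex_of_real \<nu> + 2) / 2 = of_real (real d / 2)"
    by (simp_all add: \<nu>_def field_simps)
  have \<nu>': "(complex_of_real \<nu> + complex_of_real \<nu> + 1) / 2 = of_real ((real d - 1) / 2)"
    unfolding \<nu> by simp
  have h: "hyp2F1 (complex_of_real (real d / 2)) (of_real ((real d - 1) / 2)) (of_real ((real d + 1) / 2)) (1 / of_real ((cosh \<rho>)\<^sup>2)) = of_real Y"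
  proof -
    have "hyp2F1 (complex_of_real (real d / 2)) (of_real ((real d - 1) / 2)) (of_real ((real d + 1) / 2)) (of_real (1 / (cosh \<rho>)\<^sup>2))
       = of_real (hyp2F1 (real d / 2) ((real d - 1) / 2) ((real d + 1) / 2) (1 / (cosh \<rho>)\<^sup>2))"
      by (rule hyp2F1_of_real) (use inverse_cosh_square_less_1[OF \<rho>] in auto)
    also have "hyp2F1 (real d / 2) ((real d - 1) / 2) ((real d + 1) / 2) (1 / (cosh \<rho>)\<^sup>2) = Y"
      by (simp add: Y_def hyp2F1_def mult.commute)
    finally show ?thesis by simp
  qed
  have p1: "complex_of_real ((cosh \<rho>)\<^sup>2 - 1) powr (of_real \<nu> / 2) = of_real (sinh \<rho> powr \<nu>)"
  proof -
    have "complex_of_real ((cosh \<rho>)\<^sup>2 - 1) powr (of_real \<nu> / 2) = complex_of_real ((sinh \<rho>)\<^sup>2) powr (of_real (\<nu> / 2))"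
      by (simp add: cosh_square_eq)
    also have "\<dots> = of_real ((sinh \<rho>)\<^sup>2 powr (\<nu> / 2))"
      by (subst powr_of_real) auto
    also have "(sinh \<rho>)\<^sup>2 powr (\<nu> / 2) = sinh \<rho> powr \<nu>"
      using s by (simp add: powr_powr flip: powr_numeral)
    finally show ?thesis .
  qed
  have p2: "(2::complex) powr of_real (real d / 2) = of_real (2 powr (real d / 2))"
    using powr_of_real[of 2 "real d / 2"] by simp
  have p3: "complex_of_real (cosh \<rho>) powr of_real (real d - 1) = of_real (cosh \<rho> ^ (d - 1))"
  proof -
    have "complex_of_real (cosh \<rho>) powr of_real (real d - 1) = of_real (cosh \<rho> powr real (d - 1))"
      using d by (subst powr_of_real) (auto simp: of_nat_diff)
    then show ?thesis by (simp add: powr_realpow)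
  qed
  have G: "Gamma (of_real x) = complex_of_real (Gamma x)" for x
    by (rule Gamma_complex_of_real)
  define r where "r = sqrt pi * Gamma (real d - 1) * sinh \<rho> powr \<nu> / (2 powr (real d / 2) * Gamma ((real d + 1) / 2) * cosh \<rho> ^ (d - 1)) * Y"
  have "legendre_Q (of_real \<nu>) (of_real \<nu>) (cosh \<rho>) = e * of_real r"
    \<comment> \<open>\<open>\<nu>'\<close> has to be applied first, because its left-hand side
      contains that of the first equation in \<open>\<nu>\<close>.\<close>
    unfolding legendre_Q_def \<nu>' unfolding \<nu> h p1 p2 p3 G e_def[symmetric] r_def by simp
  then have *: "exp (- \<i> * of_real (pi * \<nu>)) / of_real (2 powr \<nu> * Gamma (real d / 2) * sinh \<rho> powr \<nu>) *
         legendre_Q (of_real \<nu>) (of_real \<nu>) (cosh \<rho>) = of_real (r / (2 powr \<nu> * Gamma (real d / 2) * sinh \<rho> powr \<nu>))"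
    using e by simp
  have np: "x \<notin> \<int>\<^sub>\<le>\<^sub>0" if "x > 0" for x :: real
    using that by (auto elim!: nonpos_Ints_cases)
  have dup: "Gamma (real d / 2) * Gamma ((real d - 1) / 2) = 2 powr (2 - real d) * sqrt pi * Gamma (real d - 1)"
  proof -
    have "(real d - 1) / 2 > 0" using d by simp
    from Gamma_real_duplication[OF this]
    have "Gamma ((real d - 1) / 2) * Gamma ((real d - 1) / 2 + 1 / 2) = 2 powr (1 - 2 * ((real d - 1) / 2)) * sqrt pi * Gamma (2 * ((real d - 1) / 2))" .
    moreover have "(real d - 1) / 2 + 1 / 2 = real d / 2" "1 - 2 * ((real d - 1) / 2) = 2 - real d" "2 * ((real d - 1) / 2) = real d - 1"
      by (simp_all add: field_simps)
    ultimately show ?thesis by (simp only: mult.commute)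
  qed
  have Gs: "Gamma ((real d + 1) / 2) = (real d - 1) / 2 * Gamma ((real d - 1) / 2)"
  proof -
    have "(real d - 1) / 2 \<notin> \<int>\<^sub>\<le>\<^sub>0" using d by (auto intro!: np simp: field_simps)
    from Gamma_plus1[OF this] show ?thesis by (simp add: field_simps)
  qed
  have pw: "2 powr \<nu> * 2 powr (real d / 2) * 2 powr (2 - real d) = (2::real)"
    by (simp add: \<nu>_def flip: powr_add)
  have pos: "Gamma (real d / 2) > 0" "Gamma ((real d - 1) / 2) > 0" "Gamma (real d - 1) > 0"
    "sinh \<rho> powr \<nu> > 0" "real d - 1 > 0"
    using d s by (auto intro!: Gamma_real_pos)
  have "r / (2 powr \<nu> * Gamma (real d / 2) * sinh \<rho> powr \<nu>) =
     sqrt pi * Gamma (real d - 1) * 2 * Y / (2 powr \<nu> * 2 powr (real d / 2) * (real d - 1) *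
       (Gamma (real d / 2) * Gamma ((real d - 1) / 2)) * cosh \<rho> ^ (d - 1))"
  proof -
    have "sp * G1 * S / (b * (q / 2 * G2) * Cd) * Y / (a * G3 * S) = sp * G1 * 2 * Y / (a * b * q * (G3 * G2) * Cd)"
      if "S > 0" for sp G1 S b q G2 Cd a G3 :: real
      using that by (simp add: mult_ac)
    from this[OF pos(4)] show ?thesis unfolding r_def Gs .
  qed
  also have "\<dots> = sqrt pi * Gamma (real d - 1) * 2 * Y / ((2 powr \<nu> * 2 powr (real d / 2) * 2 powr (2 - real d)) * (real d - 1) *
       (sqrt pi * Gamma (real d - 1)) * cosh \<rho> ^ (d - 1))"
    unfolding dup by (simp add: mult_ac)
  also have "\<dots> = 1 / (real (d - 1) * cosh \<rho> ^ (d - 1)) * Y"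
  proof -
    have "sp * G1 * 2 * Y / (2 * q * (sp * G1) * Cd) = 1 / (q * Cd) * Y"
      if "sp > 0" "G1 > 0" for sp G1 q Cd :: real
      using that by simp
    note * = this[of "sqrt pi" "Gamma (real d - 1)" "real d - 1" "cosh \<rho> ^ (d - 1)"]
    have "real (d - 1) = real d - 1" using d by (simp add: of_nat_diff)
    then show ?thesis unfolding pw by (simp only: *[OF _ pos(3)] real_sqrt_gt_zero pi_gt_zero)
  qed
  also have "\<dots> = hyp_I d \<rho>"
    unfolding Y_def by (rule hyp_I_eq_hyp2F1_cosh[OF d \<rho>, symmetric])
  finally show ?thesis using * unfolding \<nu>_def by simp
qed

section \<open>Integration by parts\<close>

lemma integrable_continuous_bounded_support:
  fixes f :: "'a::euclidean_space \<Rightarrow> real"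
  assumes "continuous_on UNIV f" "\<And>y. norm y > B \<Longrightarrow> f y = 0"
  shows "integrable lborel f"
proof -
  have "integrable lborel (\<lambda>y. indicator (cball 0 B) y *\<^sub>R f y)"
    by (intro borel_integrable_compact compact_cball continuous_on_subset[OF assms(1)]) auto
  moreover have "(\<lambda>y. indicator (cball 0 B) y *\<^sub>R f y) = f"
    using assms(2) by (fastforce simp: indicator_def fun_eq_iff)
  ultimately show ?thesis by simp
qed

lemma has_derivative_bounded_support:
  fixes u :: "'a::real_normed_vector \<Rightarrow> 'b::real_normed_vector"
  assumes der: "(u has_derivative u') (at y)" and supp: "\<And>y. norm y > B \<Longrightarrow> u y = 0" and y: "norm y > B"
  shows "u' = (\<lambda>_. 0)"
proof -
  have "open {y :: 'a. norm y > B}" by (intro open_Collect_less continuous_intros)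
  then have "(u has_derivative (\<lambda>_. 0)) (at y)"
    by (rule has_derivative_transform_within_open[OF has_derivative_const]) (use y supp in auto)
  with der show ?thesis by (rule has_derivative_unique)
qed

text \<open>By translation invariance every difference quotient has integral \<open>0\<close>.\<close>

lemma integral_directional_derivative_eq_0:
  fixes u :: "'a::euclidean_space \<Rightarrow> real"
  assumes der: "\<And>y. (u has_derivative u' y) (at y)"
    and cont: "continuous_on UNIV (\<lambda>y. u' y e)"
    and supp: "\<And>y. norm y > B \<Longrightarrow> u y = 0"
  shows "integral\<^sup>L lborel (\<lambda>y. u' y e) = 0"
proof -
  have contu: "continuous_on UNIV u"
    by (intro continuous_at_imp_continuous_on ballI has_derivative_continuous[OF der])
  have intu: "integrable lborel u"
    by (rule integrable_continuous_bounded_support[OF contu supp])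
  have um: "u \<in> borel_measurable borel"
    by (rule borel_measurable_continuous_onI[OF contu])
  obtain M where M: "\<And>y. \<bar>u' y e\<bar> \<le> M"
  proof -
    have "compact ((\<lambda>y. u' y e) ` cball 0 B)"
      by (intro compact_continuous_image continuous_on_subset[OF cont]) auto
    then obtain M where M: "\<forall>y\<in>cball 0 B. \<bar>u' y e\<bar> \<le> M"
      using compact_imp_bounded[of "(\<lambda>y. u' y e) ` cball 0 B"] by (auto simp: bounded_iff)
    have "\<bar>u' y e\<bar> \<le> max M 0" for y
    proof (cases "norm y > B")
      case True
      then show ?thesis using has_derivative_bounded_support[OF der supp True] by simp
    next
      case False
      then show ?thesis using bspec[OF M, of y] by simp
    qed
    then show ?thesis using that by blast
  qed
  have line: "((\<lambda>t. u (y + t *\<^sub>R e)) has_real_derivative u' (y + t *\<^sub>R e) e) (at t)" for y t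
  proof -
    have "((\<lambda>t. u (y + t *\<^sub>R e)) has_derivative (\<lambda>h. u' (y + t *\<^sub>R e) (h *\<^sub>R e))) (at t)"
      by (rule has_derivative_compose[OF _ der]) (auto intro!: derivative_eq_intros)
    moreover have "(\<lambda>h. u' (y + t *\<^sub>R e) (h *\<^sub>R e)) = (*) (u' (y + t *\<^sub>R e) e)"
      using has_derivative_bounded_linear[OF der] by (auto simp: linear_simps fun_eq_iff)
    ultimately show ?thesis by (simp add: has_field_derivative_def)
  qed
  define q where "q n y = (u (y + (1 / real (Suc n)) *\<^sub>R e) - u y) / (1 / real (Suc n))" for n y
  have trans: "(+) ((1 / real (Suc n)) *\<^sub>R e) \<in> borel_measurable borel" for n by measurable
  have intq': "integrable lborel (\<lambda>y. u (y + (1 / real (Suc n)) *\<^sub>R e))"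
    "integral\<^sup>L lborel (\<lambda>y. u (y + (1 / real (Suc n)) *\<^sub>R e)) = integral\<^sup>L lborel u" for n
    using integrable_distr_eq[of "(+) ((1 / real (Suc n)) *\<^sub>R e)" lborel borel u]
      integral_distr[of "(+) ((1 / real (Suc n)) *\<^sub>R e)" lborel borel u] intu um trans[of n]
    by (simp_all add: lborel_distr_plus add.commute)
  have q0: "integral\<^sup>L lborel (q n) = 0" for n
    unfolding q_def using intq'[of n] intu by simp
  have "(\<lambda>n. integral\<^sup>L lborel (q n)) \<longlonglongrightarrow> integral\<^sup>L lborel (\<lambda>y. u' y e)"
  proof (rule integral_dominated_convergence)
    \<comment> \<open>The increments \<open>1 / Suc n\<close> are at most 1, so every difference
      quotient vanishes outside the ball enlarged by \<open>norm e\<close>.\<close>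
    show "integrable lborel (\<lambda>y. M * indicator (cball 0 (B + norm e)) y)"
      by (intro integrable_mult_right integrable_real_indicator) (use emeasure_bounded_finite[OF bounded_cball] in auto)
    show "(\<lambda>y. u' y e) \<in> borel_measurable lborel"
      using borel_measurable_continuous_onI[OF cont] by simp
    show "q n \<in> borel_measurable lborel" for n
      unfolding q_def using um by measurable
    show "AE y in lborel. (\<lambda>n. q n y) \<longlonglongrightarrow> u' y e"
    proof (rule AE_I2)
      fix y
      have "((\<lambda>h. (u (y + (0 + h) *\<^sub>R e) - u (y + 0 *\<^sub>R e)) / h) \<longlongrightarrow> u' (y + 0 *\<^sub>R e) e) (at 0)"
        using line[of y 0] unfolding DERIV_def .
      then have "((\<lambda>h. (u (y + h *\<^sub>R e) - u y) / h) \<longlongrightarrow> u' y e) (at 0)" by simp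
      moreover have "filterlim (\<lambda>n. 1 / real (Suc n)) (at 0) sequentially"
        using LIMSEQ_inverse_real_of_nat by (simp add: filterlim_at inverse_eq_divide)
      ultimately show "(\<lambda>n. q n y) \<longlonglongrightarrow> u' y e"
        unfolding q_def by (rule filterlim_compose)
    qed
    show "AE y in lborel. norm (q n y) \<le> M * indicator (cball 0 (B + norm e)) y" for n
    proof (rule AE_I2)
      fix y
      let ?h = "1 / real (Suc n)"
      have h: "?h > 0" "?h \<le> 1" by simp_all
      \<comment> \<open>By the mean value theorem a difference quotient is a value of the
        directional derivative, so it inherits the bound \<open>M\<close>.\<close>
      obtain z where "u (y + ?h *\<^sub>R e) - u (y + 0 *\<^sub>R e) = (?h - 0) * u' (y + z *\<^sub>R e) e"
        using MVT2[OF h(1), of "\<lambda>t. u (y + t *\<^sub>R e)" "\<lambda>t. u' (y + t *\<^sub>R e) e"] line by blast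
      then have "q n y = u' (y + z *\<^sub>R e) e"
        using h(1) by (simp add: q_def)
      then have qM: "\<bar>q n y\<bar> \<le> M" using M by simp
      show "norm (q n y) \<le> M * indicator (cball 0 (B + norm e)) y"
      proof (cases "norm y \<le> B + norm e")
        case True
        then show ?thesis using qM by simp
      next
        case False
        have "norm (?h *\<^sub>R e) \<le> norm e"
          using h mult_right_mono[OF h(2) norm_ge_zero[of e]] by simp
        then have "norm (y + ?h *\<^sub>R e) > B"
          using False norm_triangle_ineq4[of "y + ?h *\<^sub>R e" "?h *\<^sub>R e"] by simp
        moreover have "norm y > B" using False norm_ge_zero[of e] by linarith
        ultimately have "q n y = 0" using supp by (simp add: q_def)
        then show ?thesis using False by simp
      qed
    qed
  qed
  then show ?thesis
    unfolding q0 using LIMSEQ_unique tendsto_const by blast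
qed

section \<open>Partial derivatives of continuously differentiable functions\<close>

lemma partialI:
  assumes "(f has_derivative f') (at y)"
  shows "partial i f y = f' (axis i 1)"
  unfolding partial_def using frechet_derivative_at[OF assms] by simp

abbreviation C1 :: "(real ^ 'n \<Rightarrow> real) \<Rightarrow> bool" where
  "C1 f \<equiv> C_k (Suc 0) f"

lemma C1_differentiable: "C1 f \<Longrightarrow> f differentiable (at y)"
  by (simp add: differentiable_on_def)

lemma C1_has_derivative: "C1 f \<Longrightarrow> (f has_derivative frechet_derivative f (at y)) (at y)"
  using C1_differentiable frechet_derivative_works by blast

lemma C1_continuous: "C1 f \<Longrightarrow> continuous_on UNIV f"
  by (simp add: differentiable_imp_continuous_on)

lemma C1_continuous_partial: "C1 f \<Longrightarrow> continuous_on UNIV (partial i f)"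
  by simp

lemma C1I:
  assumes "\<And>y. (f has_derivative f' y) (at y)" "\<And>i. continuous_on UNIV (\<lambda>y. f' y (axis i 1))"
  shows "C1 f"
proof -
  have "partial i f = (\<lambda>y. f' y (axis i 1))" for i
    using partialI[OF assms(1)] by (simp add: fun_eq_iff)
  then show ?thesis
    using assms by (auto simp: differentiable_on_def differentiable_def intro: has_derivative_at_withinI)
qed

lemma partial_mult:
  assumes "C1 f" "C1 g"
  shows "partial i (\<lambda>y. f y * g y) y = f y * partial i g y + partial i f y * g y"
  unfolding partialI[OF has_derivative_mult[OF assms[THEN C1_has_derivative]]] by (simp add: partial_def)

lemma partial_diff:
  assumes "C1 f" "C1 g"
  shows "partial i (\<lambda>y. f y - g y) y = partial i f y - partial i g y"
  unfolding partialI[OF has_derivative_diff[OF assms[THEN C1_has_derivative]]] by (simp add: partial_def)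

lemma C1_mult: 
  assumes "C1 f" "C1 g"
  shows "C1 (\<lambda>y. f y * g y)"
  using assms[THEN C1_continuous] assms[THEN C1_continuous_partial]
  by (intro C1I[OF has_derivative_mult[OF assms[THEN C1_has_derivative]]])
     (auto simp flip: partial_def intro!: continuous_intros)

lemma C1_diff: 
  assumes "C1 f" "C1 g"
  shows "C1 (\<lambda>y. f y - g y)"
  using assms[THEN C1_continuous_partial]
  by (intro C1I[OF has_derivative_diff[OF assms[THEN C1_has_derivative]]])
     (auto simp flip: partial_def intro!: continuous_intros)

lemma C1_add: 
  assumes "C1 f" "C1 g"
  shows "C1 (\<lambda>y. f y + g y)"
  using assms[THEN C1_continuous_partial]
  by (intro C1I[OF has_derivative_add[OF assms[THEN C1_has_derivative]]])
     (auto simp flip: partial_def intro!: continuous_intros)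

lemma C1_const: "C1 (\<lambda>_. c)"
  by (rule C1I[OF has_derivative_const]) auto

lemma C1_component: "C1 (\<lambda>y. y $ i)"
  by (rule C1I[OF bounded_linear_imp_has_derivative[OF bounded_linear_vec_nth]]) auto

lemma C1_sum: "finite A \<Longrightarrow> (\<And>j. j \<in> A \<Longrightarrow> C1 (f j)) \<Longrightarrow> C1 (\<lambda>y. \<Sum>j\<in>A. f j y)"
  by (induction A rule: finite_induct) (auto simp del: C_k.simps intro!: C1_add C1_const)

text \<open>The derivative of \<open>g\<close> is asked for only at values of \<open>f\<close>,
  because the outer functions used later are handled only on part of the line, such as
  \<open>t \<ge> 1\<close> for the radial ones.\<close>

lemma C1_compose:
  assumes f: "C1 f" and g: "\<And>y. (g has_real_derivative g' (f y)) (at (f y))"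
    and g': "continuous_on UNIV (\<lambda>y. g' (f y))"
  shows "C1 (\<lambda>y. g (f y))" "partial i (\<lambda>y. g (f y)) y = g' (f y) * partial i f y"
proof -
  have d: "((\<lambda>y. g (f y)) has_derivative (\<lambda>h. frechet_derivative f (at y) h * g' (f y))) (at y)" for y
    by (rule has_derivative_compose[OF C1_has_derivative[OF f] g[unfolded has_field_derivative_def], THEN has_derivative_eq_rhs])
       (simp add: mult.commute)
  show "partial i (\<lambda>y. g (f y)) y = g' (f y) * partial i f y"
    unfolding partialI[OF d] by (simp add: partial_def)
  show "C1 (\<lambda>y. g (f y))"
    using C1_continuous_partial[OF f] g'
    by (intro C1I[OF d]) (auto simp flip: partial_def intro!: continuous_intros)
qed

lemma integral_partial_eq_0:
  assumes "C1 u" "\<And>y. norm y > B \<Longrightarrow> u y = 0"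
  shows "integral\<^sup>L lborel (partial i u) = 0"
proof -
  have "partial i u = (\<lambda>y. frechet_derivative u (at y) (axis i 1))"
    by (simp add: partial_def fun_eq_iff)
  then show ?thesis
    using integral_directional_derivative_eq_0[OF C1_has_derivative[OF assms(1)] _ assms(2), of "axis i 1"]
      C1_continuous_partial[OF assms(1), of i] by simp
qed

lemma partial_bounded_support:
  assumes "C1 u" "\<And>y. norm y > B \<Longrightarrow> u y = 0" "norm y > B"
  shows "partial i u y = 0"
  using has_derivative_bounded_support[OF C1_has_derivative[OF assms(1)] assms(2,3)] by (simp add: partial_def)

section \<open>The hyperboloid in its global chart\<close>

text \<open>Conjugation by an orthogonal matrix that takes a basis vector to the direction of
  \<open>v\<close> yields a matrix that differs from the identity in column \<open>k\<close> only,
  where Cramer's rule gives the determinant. The index \<open>k\<close> is arbitrary.\<close>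

lemma det_identity_plus_rank_one:
  fixes u v :: "real ^ 'n"
  shows "det (\<chi> i j. (if i = j then 1 else 0) + u $ i * v $ j) = 1 + u \<bullet> v"
proof (cases "v = 0")
  case True
  have "(\<chi> i j. (if i = j then 1 else 0) + u $ i * v $ j) = (mat 1 :: real ^ 'n ^ 'n)"
    using True by (simp add: vec_eq_iff mat_def)
  then show ?thesis using True by simp
next
  case False
  define M :: "real ^ 'n ^ 'n" where "M = (\<chi> i j. (if i = j then 1 else 0) + u $ i * v $ j)"
  have Mv: "M *v x = x + (v \<bullet> x) *\<^sub>R u" for x
  proof -
    have "(\<Sum>j\<in>UNIV. ((if i = j then 1 else 0) + u $ i * v $ j) * x $ j) = x $ i + (v \<bullet> x) * u $ i" for i
    proof -
      have "(\<Sum>j\<in>UNIV. ((if i = j then 1 else 0) + u $ i * v $ j) * x $ j) =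
        (\<Sum>j\<in>UNIV. (if i = j then x $ j else 0) + u $ i * (v $ j * x $ j))"
        by (intro sum.cong) (auto simp: algebra_simps)
      also have "\<dots> = x $ i + u $ i * (v \<bullet> x)"
        by (simp add: sum.distrib inner_vec_def sum_distrib_left)
      finally show ?thesis by (simp add: mult.commute)
    qed
    then show ?thesis
      by (simp add: M_def matrix_vector_mult_def vec_eq_iff)
  qed
  obtain k :: 'n where True by simp
  have "norm (v /\<^sub>R norm v) = 1" using False by simp
  then obtain A where A: "orthogonal_matrix A" "A *v axis k 1 = v /\<^sub>R norm v"
    using orthogonal_matrix_exists_basis by metis
  have AA: "transpose A ** A = mat 1" using A(1) by (simp add: orthogonal_matrix_def)
  have TA: "transpose A *v (A *v x) = x" for x
    by (simp only: matrix_vector_mul_assoc AA matrix_vector_mul_lid)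
  define N where "N = transpose A ** M ** A"
  have Atv: "transpose A *v v = norm v *\<^sub>R axis k 1"
  proof -
    have "v = norm v *\<^sub>R (A *v axis k 1)" using A(2) False by simp
    then have "transpose A *v v = norm v *\<^sub>R (transpose A *v (A *v axis k 1))"
      by (metis matrix_vector_mult_scaleR)
    then show ?thesis unfolding TA .
  qed
  have Nv: "N *v x = x + ((norm v *\<^sub>R axis k 1) \<bullet> x) *\<^sub>R (transpose A *v u)" for x
  proof -
    have "N *v x = transpose A *v (M *v (A *v x))"
      by (simp add: N_def matrix_vector_mul_assoc matrix_mul_assoc)
    also have "\<dots> = x + (v \<bullet> (A *v x)) *\<^sub>R (transpose A *v u)"
      unfolding Mv by (simp only: matrix_vector_right_distrib matrix_vector_mult_scaleR TA)
    also have "v \<bullet> (A *v x) = (transpose A *v v) \<bullet> x"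
      by (metis dot_lmul_matrix inner_commute transpose_matrix_vector)
    finally show ?thesis unfolding Atv .
  qed
  define xx where "xx = axis k 1 + norm v *\<^sub>R (transpose A *v u)"
  have "N = (\<chi> i j. if j = k then (mat 1 *v xx) $ i else (mat 1 :: real ^ 'n ^ 'n) $ i $ j)"
  proof -
    have "N $ i $ j = (N *v axis j 1) $ i" for i j
      by (simp add: matrix_vector_mult_basis column_def)
    then have "N $ i $ j = axis j 1 $ i + (norm v * (if k = j then 1 else 0)) * (transpose A *v u) $ i" for i j
      unfolding Nv by (simp add: inner_axis_axis del: transpose_matrix_vector)
    then show ?thesis
      unfolding matrix_vector_mul_lid by (auto simp: vec_eq_iff xx_def axis_def mat_def)
  qed
  then have "det N = xx $ k * det (mat 1 :: real ^ 'n ^ 'n)"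
    by (simp only: cramer_lemma)
  also have "xx $ k = 1 + norm v * (u \<bullet> (v /\<^sub>R norm v))"
  proof -
    have "(transpose A *v u) $ k = (transpose A *v u) \<bullet> axis k 1"
      by (simp add: inner_axis)
    also have "\<dots> = u \<bullet> (A *v axis k 1)"
      by (metis dot_lmul_matrix inner_commute transpose_matrix_vector)
    finally show ?thesis by (simp add: xx_def A(2))
  qed
  also have "\<dots> * det (mat 1 :: real ^ 'n ^ 'n) = 1 + u \<bullet> v"
    using False by simp
  finally have "det N = 1 + u \<bullet> v" .
  moreover have "det N = det (transpose A ** A) * det M"
    by (simp add: N_def det_mul)
  ultimately show ?thesis
    by (simp add: AA M_def)
qed

definition hyp_height :: "real \<Rightarrow> real ^ 'n \<Rightarrow> real" where
  "hyp_height R y = sqrt (R\<^sup>2 + (norm y)\<^sup>2)"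

lemma hyp_chart_eq: "hyp_chart R y = (hyp_height R y, y)"
  by (simp add: hyp_chart_def hyp_height_def)

lemma hyp_height_pos: "R > 0 \<Longrightarrow> hyp_height R y > 0"
  by (simp add: hyp_height_def add_pos_nonneg)

lemma hyp_height_square: "(hyp_height R y)\<^sup>2 = R\<^sup>2 + y \<bullet> y"
  by (simp add: hyp_height_def power2_norm_eq_inner)

lemma hyp_height_has_derivative:
  fixes y :: "real ^ 'n"
  assumes "R > 0"
  shows "(hyp_height R has_derivative (\<lambda>h. y \<bullet> h / hyp_height R y)) (at y)"
proof -
  have pos: "R\<^sup>2 + y \<bullet> y > 0" using assms by (simp add: add_pos_nonneg)
  have "((\<lambda>y. sqrt (R\<^sup>2 + y \<bullet> y)) has_derivative (\<lambda>h. (y \<bullet> h + h \<bullet> y) * (inverse (sqrt (R\<^sup>2 + y \<bullet> y)) / 2))) (at y)"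
    using pos by (auto intro!: derivative_eq_intros)
  moreover have "(\<lambda>h. (y \<bullet> h + h \<bullet> y) * (inverse (sqrt (R\<^sup>2 + y \<bullet> y)) / 2)) = (\<lambda>h. y \<bullet> h / sqrt (R\<^sup>2 + y \<bullet> y))"
    by (simp add: inner_commute divide_simps fun_eq_iff)
  moreover have "hyp_height R = (\<lambda>y :: real ^ 'n. sqrt (R\<^sup>2 + y \<bullet> y))"
    by (simp add: hyp_height_def power2_norm_eq_inner fun_eq_iff)
  ultimately show ?thesis by (simp only:)
qed

lemma continuous_on_hyp_height [continuous_intros]: "continuous_on S (hyp_height R)"
  unfolding hyp_height_def by (intro continuous_intros)

lemma partial_hyp_chart:
  fixes y :: "real ^ 'n"
  assumes "R > 0"
  shows "partial i (hyp_chart R) y = (y $ i / hyp_height R y, axis i 1)"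
proof -
  have d: "((\<lambda>y. (hyp_height R y, y)) has_derivative (\<lambda>h. (y \<bullet> h / hyp_height R y, h))) (at y)"
    by (intro has_derivative_Pair hyp_height_has_derivative assms has_derivative_ident)
  have "hyp_chart R = (\<lambda>y :: real ^ 'n. (hyp_height R y, y))"
    by (simp add: fun_eq_iff hyp_chart_eq)
  then show ?thesis
    by (simp add: partialI[OF d] inner_axis)
qed

lemma metric_matrix_eq:
  assumes "R > 0"
  shows "metric_matrix R y $ i $ j = (if i = j then 1 else 0) - y $ i * y $ j / (hyp_height R y)\<^sup>2"
proof -
  have "(\<Sum>k\<in>UNIV. axis i (1::real) $ k * axis j 1 $ k) = (if i = j then 1 else 0)"
    using inner_axis_axis[of i "1::real" j 1] by (simp add: inner_vec_def)
  then show ?thesis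
    by (simp add: metric_matrix_def mink_def partial_hyp_chart[OF assms] power2_eq_square)
qed

lemma vol_density_eq:
  assumes "R > 0"
  shows "vol_density R y = R / hyp_height R y"
proof -
  note w = hyp_height_pos[OF assms, of y]
  have "metric_matrix R y = (\<chi> i j. (if i = j then 1 else 0) + (- y /\<^sub>R (hyp_height R y)\<^sup>2) $ i * y $ j)"
    by (simp add: vec_eq_iff metric_matrix_eq[OF assms] divide_inverse mult_ac)
  then have "det (metric_matrix R y) = 1 + (- y /\<^sub>R (hyp_height R y)\<^sup>2) \<bullet> y"
    by (simp only: det_identity_plus_rank_one)
  also have "\<dots> = (R / hyp_height R y)\<^sup>2"
  proof -
    have "R\<^sup>2 + y \<bullet> y > 0" using assms by (simp add: add_pos_nonneg)
    then show ?thesis by (simp add: power_divide hyp_height_square field_simps)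
  qed
  finally show ?thesis
    using w assms by (simp add: vol_density_def)
qed

text \<open>The Sherman-Morrison formula: the metric is a rank-one perturbation of the identity, and
  the denominator \<open>w\<^sup>2 - y \<bullet> y\<close> of the formula is
  \<open>R\<^sup>2\<close>.\<close>

lemma matrix_inv_metric_matrix:
  fixes y :: "real ^ 'n"
  assumes "R > 0"
  shows "matrix_inv (metric_matrix R y) $ i $ j = (if i = j then 1 else 0) + y $ i * y $ j / R\<^sup>2"
proof -
  define w where "w = hyp_height R y"
  have w: "w > 0" using hyp_height_pos[OF assms] by (simp add: w_def)
  have ww: "w\<^sup>2 = R\<^sup>2 + y \<bullet> y" by (simp add: w_def hyp_height_square)
  define N :: "real ^ 'n ^ 'n" where "N = (\<chi> i j. (if i = j then 1 else 0) + y $ i * y $ j / R\<^sup>2)"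
  define M where "M = metric_matrix R y"
  have "(\<Sum>k\<in>UNIV. ((if i = k then 1 else 0) - y $ i * y $ k / w\<^sup>2) * ((if k = j then 1 else 0) + y $ k * y $ j / R\<^sup>2)) = (if i = j then 1 else 0)" for i j
  proof -
    have "(\<Sum>k\<in>UNIV. ((if i = k then 1 else 0) - y $ i * y $ k / w\<^sup>2) * ((if k = j then 1 else 0) + y $ k * y $ j / R\<^sup>2))
      = (\<Sum>k\<in>UNIV. (if i = k then (if k = j then 1 else 0) + y $ k * y $ j / R\<^sup>2 else 0)
          - (if k = j then y $ i * y $ k / w\<^sup>2 else 0) - (y $ i * y $ j / (w\<^sup>2 * R\<^sup>2)) * (y $ k * y $ k))"
      by (intro sum.cong) (auto simp: algebra_simps)
    also have "\<dots> = (if i = j then 1 else 0) + y $ i * y $ j / R\<^sup>2 - y $ i * y $ j / w\<^sup>2 - (y $ i * y $ j / (w\<^sup>2 * R\<^sup>2)) * (y \<bullet> y)"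
      by (simp add: sum_subtractf inner_vec_def sum_distrib_left)
    also have "y \<bullet> y = w\<^sup>2 - R\<^sup>2" by (simp add: ww)
    also have "(if i = j then 1 else 0) + y $ i * y $ j / R\<^sup>2 - y $ i * y $ j / w\<^sup>2 - (y $ i * y $ j / (w\<^sup>2 * R\<^sup>2)) * (w\<^sup>2 - R\<^sup>2) = (if i = j then 1 else 0)"
      using w assms by (simp add: field_simps)
    finally show ?thesis .
  qed
  then have MN: "M ** N = mat 1"
    by (simp add: M_def N_def matrix_matrix_mult_def vec_eq_iff metric_matrix_eq[OF assms] mat_def flip: w_def)
  then have NM: "N ** M = mat 1" by (simp add: matrix_left_right_inverse)
  \<comment> \<open>\<open>matrix_inv\<close> is defined by choice, so its characteristic property
    becomes available only after a two-sided inverse has been exhibited.\<close>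
  have inv: "M ** matrix_inv M = mat 1 \<and> matrix_inv M ** M = mat 1"
    unfolding matrix_inv_def
    by (rule someI[of "\<lambda>A. M ** A = mat 1 \<and> A ** M = mat 1" N]) (use MN NM in blast)
  have "matrix_inv M = matrix_inv M ** (M ** N)"
    unfolding MN matrix_mul_rid ..
  also have "\<dots> = N"
    unfolding matrix_mul_assoc conjunct2[OF inv] matrix_mul_lid ..
  finally have "matrix_inv M = N" .
  then show ?thesis
    by (simp add: M_def N_def)
qed

lemma laplace_beltrami_eq:
  assumes "R > 0"
  shows "laplace_beltrami R \<phi> (hyp_chart R y) = hyp_height R y / R *
     (\<Sum>i\<in>UNIV. partial i (\<lambda>y. R / hyp_height R y *
        (partial i (\<phi> \<circ> hyp_chart R) y + y $ i * (\<Sum>j\<in>UNIV. y $ j * partial j (\<phi> \<circ> hyp_chart R) y) / R\<^sup>2)) y)"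
proof -
  have *: "(\<Sum>j\<in>UNIV. matrix_inv (metric_matrix R y) $ i $ j * a j) = a i + y $ i * (\<Sum>j\<in>UNIV. y $ j * a j) / R\<^sup>2" for i a and y :: "real ^ 'n"
  proof -
    have "(\<Sum>j\<in>UNIV. matrix_inv (metric_matrix R y) $ i $ j * a j) = (\<Sum>j\<in>UNIV. (if i = j then a j else 0) + y $ i / R\<^sup>2 * (y $ j * a j))"
      by (intro sum.cong) (auto simp: matrix_inv_metric_matrix[OF assms] algebra_simps)
    then show ?thesis by (simp only: sum.distrib sum_distrib_left[symmetric]) simp
  qed
  show ?thesis
    unfolding laplace_beltrami_def * vol_density_eq[OF assms] by (simp add: hyp_chart_eq)
qed

text \<open>The chart does not decrease norms, because \<open>y\<close> is a component of its image;
  a bound for the ambient support therefore bounds the support in the chart.\<close>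

lemma test_function_bounded_support:
  assumes "test_function R \<phi>" "R > 0"
  obtains B where "\<And>y. norm y > B \<Longrightarrow> (\<phi> \<circ> hyp_chart R) y = 0"
proof -
  have "bounded {x \<in> hyperboloid R. \<phi> x \<noteq> 0}"
    using assms bounded_subset[OF compact_imp_bounded closure_subset] by (auto simp: test_function_def)
  then obtain B where B: "\<And>x. x \<in> hyperboloid R \<Longrightarrow> \<phi> x \<noteq> 0 \<Longrightarrow> norm x \<le> B"
    by (auto simp: bounded_iff)
  have "(\<phi> \<circ> hyp_chart R) y = 0" if "norm y > B" for y
  proof (rule ccontr)
    assume "(\<phi> \<circ> hyp_chart R) y \<noteq> 0"
    moreover have "hyp_chart R y \<in> hyperboloid R"
      using bij_betw_hyp_chart[OF assms(2), where 'n = 'a] by (auto simp: bij_betw_def)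
    ultimately have "norm (hyp_chart R y) \<le> B" using B by simp
    moreover have "norm y \<le> norm (hyp_chart R y)"
      using norm_snd_le[of "hyp_height R y" y] by (simp add: hyp_chart_eq norm_Pair)
    ultimately show False using that by simp
  qed
  then show ?thesis using that by blast
qed

section \<open>The mass of the elliptic kernel\<close>

lemma det_matrix_rank_one:
  fixes u v :: "real ^ 'n"
  shows "det (matrix (\<lambda>x. x + (v \<bullet> x) *\<^sub>R u)) = 1 + u \<bullet> v"
proof -
  have "matrix (\<lambda>x. x + (v \<bullet> x) *\<^sub>R u) = (\<chi> i j. (if i = j then 1 else 0) + u $ i * v $ j)"
    by (simp add: matrix_def vec_eq_iff inner_axis) (simp add: axis_def)
  then show ?thesis by (simp add: det_identity_plus_rank_one)
qed

lemma linear_rank_one: "linear (\<lambda>x. x + (v \<bullet> x) *\<^sub>R u)"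
  by (rule linearI) (simp_all add: algebra_simps)

lemma det_matrix_compose:
  fixes f g :: "real ^ 'n \<Rightarrow> real ^ 'n"
  assumes "linear f" "linear g"
  shows "det (matrix (\<lambda>x. f (g x))) = det (matrix f) * det (matrix g)"
  using matrix_compose[OF assms(2,1)] by (simp add: det_mul o_def)

text \<open>The gnomonic projection of the unit hyperboloid onto the ball of the Klein model,
  expressed in the global chart.\<close>

definition ball_map :: "real ^ 'n \<Rightarrow> real ^ 'n" where
  "ball_map v = v /\<^sub>R sqrt (1 + v \<bullet> v)"

text \<open>The derivative is arranged as a multiple of a rank-one perturbation of the identity, so
  that its determinant follows from \<open>det_matrix_rank_one\<close>.\<close>

lemma ball_map_has_derivative:
  fixes v :: "real ^ 'n"
  shows "(ball_map has_derivative (\<lambda>h. (1 / sqrt (1 + v \<bullet> v)) *\<^sub>R (h + (v \<bullet> h) *\<^sub>R (- v /\<^sub>R (1 + v \<bullet> v))))) (at v)"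
proof -
  have pos: "1 + v \<bullet> v > 0" by (simp add: add_pos_nonneg)
  have sq: "sqrt (1 + v \<bullet> v) * sqrt (1 + v \<bullet> v) = 1 + v \<bullet> v" using pos by simp
  have "((\<lambda>v. inverse (sqrt (1 + v \<bullet> v)) *\<^sub>R v) has_derivative
     (\<lambda>h. inverse (sqrt (1 + v \<bullet> v)) *\<^sub>R h +
        (- (inverse (sqrt (1 + v \<bullet> v)) * ((v \<bullet> h + h \<bullet> v) * (inverse (sqrt (1 + v \<bullet> v)) / 2)) * inverse (sqrt (1 + v \<bullet> v)))) *\<^sub>R v)) (at v)"
    using pos by (auto intro!: derivative_eq_intros)
  moreover have "inverse (sqrt (1 + v \<bullet> v)) *\<^sub>R h +
        (- (inverse (sqrt (1 + v \<bullet> v)) * ((v \<bullet> h + h \<bullet> v) * (inverse (sqrt (1 + v \<bullet> v)) / 2)) * inverse (sqrt (1 + v \<bullet> v)))) *\<^sub>R v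
     = (1 / sqrt (1 + v \<bullet> v)) *\<^sub>R (h + (v \<bullet> h) *\<^sub>R (- v /\<^sub>R (1 + v \<bullet> v)))" for h
  proof -
    define i j where "i = inverse (sqrt (1 + v \<bullet> v))" and "j = inverse (1 + v \<bullet> v)"
    have "i * i = j"
      unfolding i_def j_def inverse_mult_distrib[symmetric] sq ..
    then have "i * ((v \<bullet> h + h \<bullet> v) * (i / 2)) * i = i * ((v \<bullet> h) * j)"
      by (simp add: inner_commute[of h v] mult_ac)
    then show ?thesis
      unfolding i_def[symmetric] j_def[symmetric] divide_inverse[of 1]
      by (simp add: scaleR_add_right scaleR_diff_right)
  qed
  moreover have "ball_map = (\<lambda>v :: real ^ 'n. inverse (sqrt (1 + v \<bullet> v)) *\<^sub>R v)"
    by (simp add: ball_map_def fun_eq_iff)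
  ultimately show ?thesis by (simp only:)
qed

text \<open>The right-hand side is positive and determines \<open>v \<bullet> v\<close>; this gives
  both injectivity and the inclusion of the range in the unit ball.\<close>

lemma norm_ball_map: "1 - (norm (ball_map v))\<^sup>2 = 1 / (1 + v \<bullet> v)"
proof -
  have pos: "1 + v \<bullet> v > 0" by (simp add: add_pos_nonneg)
  then have "(norm (ball_map v))\<^sup>2 = (v \<bullet> v) / (1 + v \<bullet> v)"
    by (simp add: ball_map_def power_mult_distrib power2_norm_eq_inner power_inverse divide_inverse)
  then show ?thesis using pos by (simp add: field_simps)
qed

lemma inj_ball_map: "inj ball_map"
proof (rule injI)
  fix v w :: "real ^ 'n" assume eq: "ball_map v = ball_map w"
  have "1 / (1 + v \<bullet> v) = 1 / (1 + w \<bullet> w)"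
    using norm_ball_map[of v] norm_ball_map[of w] eq by simp
  then have "v \<bullet> v = w \<bullet> w" by simp
  moreover have "sqrt (1 + w \<bullet> w) > 0" by (simp add: add_pos_nonneg)
  ultimately show "v = w" using eq by (simp add: ball_map_def)
qed

lemma range_ball_map: "range (ball_map :: real ^ 'n \<Rightarrow> _) = ball 0 1"
proof safe
  fix v :: "real ^ 'n"
  have "1 + v \<bullet> v > 0" by (simp add: add_pos_nonneg)
  then have "(norm (ball_map v))\<^sup>2 < 1"
    using norm_ball_map[of v] by (smt (verit) divide_pos_pos)
  then show "ball_map v \<in> ball 0 1"
    by (simp add: abs_square_less_1)
next
  fix z :: "real ^ 'n" assume "z \<in> ball 0 1"
  then have "norm z < 1" by simp
  then have z: "z \<bullet> z < 1" by (simp add: dot_square_norm abs_square_less_1)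
  define v where "v = z /\<^sub>R sqrt (1 - z \<bullet> z)"
  have "1 + v \<bullet> v = 1 / (1 - z \<bullet> z)"
    using z by (simp add: v_def field_simps flip: power2_eq_square)
  then have "ball_map v = z"
    using z by (simp add: ball_map_def v_def real_sqrt_divide)
  then show "z \<in> range ball_map" by blast
qed

lemma integral_elliptic_kernel_wellorder:
  fixes b :: "real ^ 'n::{finite,wellorder}"
  assumes b: "b \<bullet> b < 1" and \<kappa>: "\<kappa> > 0"
  shows "(\<integral>\<^sup>+x. ennreal (1 / sqrt (1 + \<kappa>\<^sup>2 * (x \<bullet> x - (b \<bullet> x)\<^sup>2)) ^ (CARD('n) + 2)) \<partial>lborel) =
    ennreal (unit_ball_vol CARD('n) / (\<kappa> ^ CARD('n) * sqrt (1 - b \<bullet> b)))"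
proof -
  define d where "d = CARD('n)"
  define r where "r = sqrt (1 - b \<bullet> b)"
  have r: "r > 0" "r * r = 1 - b \<bullet> b" using b by (simp_all add: r_def)
  \<comment> \<open>The rank-one map with coefficient \<open>- s\<close> squares to the form
    \<open>x \<bullet> x - (b \<bullet> x)\<^sup>2\<close> exactly when
    \<open>2 * s - s\<^sup>2 * (b \<bullet> b) = 1\<close>. This is the root for which the
    determinant \<open>1 - s * (b \<bullet> b)\<close> is \<open>r > 0\<close>.\<close>
  define s where "s = 1 / (1 + r)"
  define A where "A x = \<kappa> *\<^sub>R (x + (b \<bullet> x) *\<^sub>R (- s *\<^sub>R b))" for x
  have linA: "linear A" unfolding A_def
    by (intro linear_compose_scale_right linear_rank_one)
  have sb: "s * (b \<bullet> b) = 1 - r" "2 * s - s\<^sup>2 * (b \<bullet> b) = 1"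
  proof -
    have "b \<bullet> b = (1 - r) * (1 + r)" using r by (simp add: algebra_simps)
    then show 1: "s * (b \<bullet> b) = 1 - r" using r by (simp add: s_def)
    have "2 * s - s\<^sup>2 * (b \<bullet> b) = s * (2 - s * (b \<bullet> b))" by (simp add: power2_eq_square algebra_simps)
    then show "2 * s - s\<^sup>2 * (b \<bullet> b) = 1" unfolding 1 using r by (simp add: s_def field_simps)
  qed
  have detA: "det (matrix A) = \<kappa> ^ d * r"
  proof -
    have "A = (\<lambda>x. \<kappa> *\<^sub>R (x + (b \<bullet> x) *\<^sub>R (- s *\<^sub>R b)))" by (simp add: A_def fun_eq_iff)
    then have "det (matrix A) = det (matrix ((*\<^sub>R) \<kappa> :: (real, 'n) vec \<Rightarrow> _)) * det (matrix (\<lambda>x. x + (b \<bullet> x) *\<^sub>R (- s *\<^sub>R b)))"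
      using det_matrix_compose[OF linear_scaleR linear_rank_one, of \<kappa> b "- s *\<^sub>R b"] by simp
    also have "\<dots> = \<kappa> ^ d * (1 + (- s *\<^sub>R b) \<bullet> b)"
      unfolding det_matrix_rank_one det_matrix_scaleR d_def ..
    finally show ?thesis using sb by simp
  qed
  have AA: "A x \<bullet> A x = \<kappa>\<^sup>2 * (x \<bullet> x - (b \<bullet> x)\<^sup>2)" for x
  proof -
    have "A x \<bullet> A x = \<kappa>\<^sup>2 * (x \<bullet> x - (2 * s - s\<^sup>2 * (b \<bullet> b)) * (b \<bullet> x)\<^sup>2)"
      by (simp add: A_def inner_add_left inner_add_right inner_diff_left inner_diff_right inner_commute[of x b] power2_eq_square algebra_simps)
    then show ?thesis using sb(2) by simp
  qed
  have bijA: "inj A" "surj A"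
  proof -
    have "det (matrix A) \<noteq> 0" using detA \<kappa> r by simp
    then show "inj A" using det_nz_iff_inj[OF linA] by simp
    then show "surj A" by (rule linear_injective_imp_surjective[OF linA]) simp
  qed
  \<comment> \<open>\<open>A\<close> is a square root of the quadratic form, so the kernel is up to a factor the Jacobian
    determinant of \<open>ball_map \<circ> A\<close>.\<close>
  define g' where "g' x = (\<lambda>h. (1 / sqrt (1 + A x \<bullet> A x)) *\<^sub>R (A h + (A x \<bullet> A h) *\<^sub>R (- A x /\<^sub>R (1 + A x \<bullet> A x))))" for x
  have der: "((\<lambda>x. ball_map (A x)) has_derivative g' x) (at x within UNIV)" for x
    unfolding g'_def
    by (rule has_derivative_compose[OF linear_imp_has_derivative[OF linA] ball_map_has_derivative])
  have det: "\<bar>det (matrix (g' x))\<bar> = \<kappa> ^ d * r * (1 / sqrt (1 + A x \<bullet> A x) ^ (d + 2))" for x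
  proof -
    define v where "v = A x"
    define p where "p = sqrt (1 + v \<bullet> v)"
    have p: "p > 0" "p\<^sup>2 = 1 + v \<bullet> v" by (simp_all add: p_def add_pos_nonneg)
    have "det (matrix (g' x)) = det (matrix (\<lambda>h. (1 / p) *\<^sub>R (h + (v \<bullet> h) *\<^sub>R (- v /\<^sub>R (1 + v \<bullet> v))))) * det (matrix A)"
      unfolding g'_def v_def[symmetric] p_def[symmetric]
      by (rule det_matrix_compose[OF linear_compose_scale_right[OF linear_rank_one] linA])
    \<comment> \<open>The scaling contributes \<open>(1 / p) ^ d\<close> and the rank-one part
      \<open>1 / p\<^sup>2\<close>, whence the exponent \<open>d + 2\<close> of the kernel.\<close>
    also have "det (matrix (\<lambda>h. (1 / p) *\<^sub>R (h + (v \<bullet> h) *\<^sub>R (- v /\<^sub>R (1 + v \<bullet> v))))) =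
       (1 / p) ^ d * (1 + (- v /\<^sub>R (1 + v \<bullet> v)) \<bullet> v)"
      using det_matrix_compose[OF linear_scaleR linear_rank_one, of "1 / p" v "- v /\<^sub>R (1 + v \<bullet> v)"]
      unfolding det_matrix_rank_one det_matrix_scaleR d_def .
    also have "1 + (- v /\<^sub>R (1 + v \<bullet> v)) \<bullet> v = 1 / p\<^sup>2"
    proof -
      have "1 + v \<bullet> v > 0" by (simp add: add_pos_nonneg)
      then show ?thesis unfolding p(2) by (simp add: field_simps)
    qed
    finally have "det (matrix (g' x)) = (1 / p) ^ d * (1 / p\<^sup>2) * det (matrix A)" .
    moreover have "p * p = 1 + v \<bullet> v" using p(2) by (simp add: power2_eq_square)
    ultimately show ?thesis
      using p \<kappa> r unfolding detA v_def[symmetric] p_def[symmetric]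
      by (simp add: abs_mult power_add power_divide mult_ac)
  qed
  have inj: "inj_on (\<lambda>x. ball_map (A x)) UNIV"
    using inj_compose[OF inj_ball_map bijA(1)] by (simp add: o_def)
  have "range (\<lambda>x. ball_map (A x)) = ball_map ` range A" by auto
  then have img: "range (\<lambda>x. ball_map (A x)) = ball 0 1"
    using bijA(2) range_ball_map by simp
  have "ball 0 1 \<in> lmeasurable \<and> measure lebesgue (ball (0 :: (real, 'n) vec) 1) = unit_ball_vol d"
    using content_ball[of 1 "0 :: (real, 'n) vec"] by (simp add: d_def)
  then have "((\<lambda>x. \<bar>det (matrix (g' x))\<bar>) has_integral unit_ball_vol d) UNIV"
    using has_measure_differentiable_image[OF _ der inj, of "unit_ball_vol d"] img by simp
  then have "((\<lambda>x. \<kappa> ^ d * r * (1 / sqrt (1 + A x \<bullet> A x) ^ (d + 2))) has_integral unit_ball_vol d) UNIV"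
    by (simp only: det)
  from has_integral_mult_right[OF this, of "1 / (\<kappa> ^ d * r)"]
  have int: "((\<lambda>x. 1 / sqrt (1 + A x \<bullet> A x) ^ (d + 2)) has_integral unit_ball_vol d / (\<kappa> ^ d * r)) UNIV"
    using \<kappa> r by simp
  have "integral\<^sup>N lborel (\<lambda>x. ennreal (1 / sqrt (1 + A x \<bullet> A x) ^ (d + 2))) = ennreal (unit_ball_vol d / (\<kappa> ^ d * r))"
  proof (rule nn_integral_has_integral_lborel[OF _ _ int])
    show "(\<lambda>x. 1 / sqrt (1 + A x \<bullet> A x) ^ (d + 2)) \<in> borel_measurable borel"
      unfolding A_def by (intro borel_measurable_divide borel_measurable_power) measurable
  qed simp
  then show ?thesis
    by (simp add: AA d_def r_def)
qed

text \<open>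
  The library proves the change of variables formula only for well-ordered index types.  A copy of the
  index type with an arbitrary well-order removes this restriction.
\<close>

typedef 'a wellordered_copy = "UNIV :: 'a set" ..

instance wellordered_copy :: (finite) finite
proof
  have "(UNIV :: 'a wellordered_copy set) = range Abs_wellordered_copy"
    by (metis Rep_wellordered_copy_inverse surjI)
  moreover have "finite (range (Abs_wellordered_copy :: 'a \<Rightarrow> _))"
    by (rule finite_imageI) (rule finite)
  ultimately show "finite (UNIV :: 'a wellordered_copy set)" by (simp only:)
qed

instantiation wellordered_copy :: (finite) wellorder
begin

definition wellordered_copy_index :: "'a wellordered_copy \<Rightarrow> nat" where
  "wellordered_copy_index = (SOME f. inj f)"

definition less_eq_wellordered_copy :: "'a wellordered_copy \<Rightarrow> 'a wellordered_copy \<Rightarrow> bool" where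
  "x \<le> y \<longleftrightarrow> wellordered_copy_index x \<le> wellordered_copy_index y"

definition less_wellordered_copy :: "'a wellordered_copy \<Rightarrow> 'a wellordered_copy \<Rightarrow> bool" where
  "x < y \<longleftrightarrow> wellordered_copy_index x < wellordered_copy_index y"

instance
proof
  have "\<exists>f :: 'a wellordered_copy \<Rightarrow> nat. inj f"
    using finite_imp_inj_to_nat_seg[OF finite[of "UNIV :: 'a wellordered_copy set"]] by metis
  then have inj: "inj (wellordered_copy_index :: 'a wellordered_copy \<Rightarrow> nat)"
    unfolding wellordered_copy_index_def by (rule someI_ex)
  fix x y z :: "'a wellordered_copy"
  show "x = y" if "x \<le> y" "y \<le> x"
    using that by (intro injD[OF inj]) (simp only: less_eq_wellordered_copy_def)
  show "P x" if step: "\<And>x. (\<And>y. y < x \<Longrightarrow> P y) \<Longrightarrow> P x" for P :: "'a wellordered_copy \<Rightarrow> bool"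
  proof (induction x rule: measure_induct_rule[of wellordered_copy_index])
    case (less x)
    show ?case
      by (rule step, rule less) (simp add: less_wellordered_copy_def)
  qed
qed (auto simp: less_eq_wellordered_copy_def less_wellordered_copy_def)

end

lemma bij_Rep_wellordered_copy: "bij Rep_wellordered_copy"
  by (rule bij_betw_byWitness[of _ Abs_wellordered_copy])
     (auto simp: Rep_wellordered_copy_inverse Abs_wellordered_copy_inverse)

definition relabel :: "real ^ ('n wellordered_copy) \<Rightarrow> real ^ 'n" where
  "relabel x = (\<chi> i. x $ Abs_wellordered_copy i)"

definition unlabel :: "real ^ 'n \<Rightarrow> real ^ ('n wellordered_copy)" where
  "unlabel x = (\<chi> i. x $ Rep_wellordered_copy i)"

lemma relabel_unlabel: "relabel (unlabel x) = x"
  by (simp add: relabel_def unlabel_def vec_eq_iff Abs_wellordered_copy_inverse)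

lemma inner_relabel: "relabel x \<bullet> y = x \<bullet> unlabel y"
proof -
  have "(\<Sum>i\<in>UNIV. x $ i * y $ Rep_wellordered_copy i) = (\<Sum>i\<in>UNIV. x $ Abs_wellordered_copy i * y $ i)"
    using sum.reindex_bij_betw[OF bij_Rep_wellordered_copy, of "\<lambda>i. x $ Abs_wellordered_copy i * y $ i"]
    by (simp add: Rep_wellordered_copy_inverse)
  then show ?thesis by (simp add: inner_vec_def relabel_def unlabel_def)
qed

lemma unlabel_relabel: "unlabel (relabel x) = x"
  by (simp add: relabel_def unlabel_def vec_eq_iff Rep_wellordered_copy_inverse)

lemma prod_Basis_vec:
  fixes x :: "real ^ 'n"
  shows "(\<Prod>b\<in>Basis. x \<bullet> b) = (\<Prod>i\<in>UNIV. x $ i)"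
proof -
  have B: "(Basis :: (real ^ 'n) set) = range (\<lambda>i. axis i 1)"
    by (auto simp: Basis_vec_def)
  have inj: "inj (\<lambda>i :: 'n. axis i (1 :: real))"
    by (auto simp: inj_def axis_eq_axis)
  have "(\<Prod>b\<in>Basis. x \<bullet> b) = (\<Prod>i\<in>UNIV. x \<bullet> axis i 1)"
    unfolding B prod.reindex[OF inj] by simp
  then show ?thesis
    by (simp add: inner_axis)
qed

text \<open>Lebesgue measure is determined by its values on boxes, and the preimage of a box is the
  box with its sides permuted.\<close>

lemma distr_relabel: "distr lborel borel relabel = (lborel :: (real ^ 'n) measure)"
proof (rule lborel_eqI[symmetric])
  have cont: "continuous_on UNIV (relabel :: real ^ 'n wellordered_copy \<Rightarrow> _)"
    unfolding relabel_def by (intro continuous_intros)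
  then have m: "(relabel :: real ^ 'n wellordered_copy \<Rightarrow> _) \<in> borel_measurable lborel"
    using borel_measurable_continuous_onI by simp
  fix l u :: "real ^ 'n" assume lu: "\<And>b. b \<in> Basis \<Longrightarrow> l \<bullet> b \<le> u \<bullet> b"
  have lu': "l $ i \<le> u $ i" for i
    using lu[of "axis i 1"] by (simp add: inner_axis)
  have "relabel -` box l u = box (unlabel l) (unlabel u)"
  proof -
    have "(\<forall>i. l $ i < x $ Abs_wellordered_copy i \<and> x $ Abs_wellordered_copy i < u $ i) \<longleftrightarrow>
        (\<forall>i. l $ Rep_wellordered_copy i < x $ i \<and> x $ i < u $ Rep_wellordered_copy i)" for x
      by (metis Abs_wellordered_copy_inverse Rep_wellordered_copy_inverse UNIV_I)
    then show ?thesis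
      by (auto simp: mem_box_cart relabel_def unlabel_def)
  qed
  then have "emeasure (distr lborel borel relabel) (box l u) = emeasure lborel (box (unlabel l) (unlabel u))"
    using m by (simp add: emeasure_distr)
  also have "\<dots> = ennreal (\<Prod>b\<in>Basis. (unlabel u - unlabel l) \<bullet> b)"
    by (rule emeasure_lborel_box) (auto simp: Basis_vec_def inner_axis unlabel_def lu')
  also have "(\<Prod>b\<in>Basis. (unlabel u - unlabel l) \<bullet> b) = (\<Prod>b\<in>Basis. (u - l) \<bullet> b)"
    unfolding prod_Basis_vec
    using prod.reindex_bij_betw[OF bij_Rep_wellordered_copy, of "\<lambda>i. (u - l) $ i"]
    by (simp add: unlabel_def)
  finally show "emeasure (distr lborel borel relabel) (box l u) = (\<Prod>b\<in>Basis. (u - l) \<bullet> b)" .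
qed simp

lemma card_wellordered_copy: "CARD('n wellordered_copy) = CARD('n)"
  by (rule bij_betw_same_card[OF bij_Rep_wellordered_copy])

text \<open>Relabelling the coordinates preserves Lebesgue measure and inner products, so the value
  carries over. Nonnegativity of the kernel comes from Cauchy-Schwarz and
  \<open>b \<bullet> b < 1\<close>.\<close>

lemma integral_elliptic_kernel:
  fixes b :: "real ^ 'n"
  assumes b: "b \<bullet> b < 1" and \<kappa>: "\<kappa> > 0"
  shows "integrable lborel (\<lambda>x. 1 / sqrt (1 + \<kappa>\<^sup>2 * (x \<bullet> x - (b \<bullet> x)\<^sup>2)) ^ (CARD('n) + 2))" (is "integrable _ ?f")
    "integral\<^sup>L lborel (\<lambda>x. 1 / sqrt (1 + \<kappa>\<^sup>2 * (x \<bullet> x - (b \<bullet> x)\<^sup>2)) ^ (CARD('n) + 2)) =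
      unit_ball_vol CARD('n) / (\<kappa> ^ CARD('n) * sqrt (1 - b \<bullet> b))"
proof -
  have m: "(\<lambda>x. ennreal (?f x)) \<in> borel_measurable borel" by measurable
  have "continuous_on UNIV (relabel :: real ^ 'n wellordered_copy \<Rightarrow> _)"
    unfolding relabel_def by (intro continuous_intros)
  then have m': "(relabel :: real ^ 'n wellordered_copy \<Rightarrow> _) \<in> borel_measurable lborel"
    using borel_measurable_continuous_onI by simp
  have nonneg: "?f x \<ge> 0" for x
  proof -
    have "(b \<bullet> x)\<^sup>2 \<le> (b \<bullet> b) * (x \<bullet> x)" by (rule Cauchy_Schwarz_ineq)
    also have "\<dots> \<le> 1 * (x \<bullet> x)" using b by (intro mult_right_mono) auto
    finally show ?thesis by simp
  qed
  have e: "relabel x \<bullet> relabel x = x \<bullet> x" "b \<bullet> relabel x = unlabel b \<bullet> x" for x :: "real ^ 'n wellordered_copy"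
    by (simp_all add: inner_relabel unlabel_relabel inner_commute[of b] inner_commute[of "unlabel b"])
  have bb: "unlabel b \<bullet> unlabel b = b \<bullet> b"
    using inner_relabel[of "unlabel b" b] by (simp add: relabel_unlabel)
  have "(\<integral>\<^sup>+x. ennreal (?f x) \<partial>lborel) = (\<integral>\<^sup>+x. ennreal (?f x) \<partial>(distr lborel borel relabel))"
    by (simp add: distr_relabel)
  also have "\<dots> = (\<integral>\<^sup>+x. ennreal (?f (relabel x)) \<partial>lborel)"
    using m m' by (subst nn_integral_distr) auto
  also have "\<dots> = ennreal (unit_ball_vol CARD('n) / (\<kappa> ^ CARD('n) * sqrt (1 - b \<bullet> b)))"
    unfolding e using integral_elliptic_kernel_wellorder[of "unlabel b" \<kappa>] b \<kappa>
    by (simp add: bb card_wellordered_copy)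
  finally have I: "(\<integral>\<^sup>+x. ennreal (?f x) \<partial>lborel) = ennreal (unit_ball_vol CARD('n) / (\<kappa> ^ CARD('n) * sqrt (1 - b \<bullet> b)))" .
  have fm: "?f \<in> borel_measurable lborel" by measurable
  show "integrable lborel ?f"
    by (rule integrableI_nonneg[OF fm]) (use nonneg I in auto)
  show "integral\<^sup>L lborel ?f = unit_ball_vol CARD('n) / (\<kappa> ^ CARD('n) * sqrt (1 - b \<bullet> b))"
    using I b \<kappa> nonneg by (subst integral_eq_nn_integral[OF fm]) auto
qed

section \<open>Regularised radial solutions\<close>

lemma hyp_height_nonzero: "R > 0 \<Longrightarrow> hyp_height R y \<noteq> 0"
  using hyp_height_pos[of R y] by simp

lemma hyp_height_C1: "R > 0 \<Longrightarrow> C1 (hyp_height R)"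
  "R > 0 \<Longrightarrow> partial i (hyp_height R) y = y $ i / hyp_height R y"
proof -
  assume R: "R > 0"
  show "partial i (hyp_height R) y = y $ i / hyp_height R y"
    by (simp add: partialI[OF hyp_height_has_derivative[OF R]] inner_axis)
  show "C1 (hyp_height R)"
  proof (rule C1I[OF hyp_height_has_derivative[OF R]])
    show "continuous_on UNIV (\<lambda>y. y \<bullet> axis i 1 / hyp_height R y)" for i
      by (intro continuous_intros ballI) (simp add: hyp_height_nonzero[OF R])
  qed
qed

lemma inverse_hyp_height_C1:
  fixes y :: "real ^ 'n"
  assumes R: "R > 0"
  shows "C1 (\<lambda>y :: real ^ 'n. 1 / hyp_height R y)"
    "partial i (\<lambda>y. 1 / hyp_height R y) y = - (y $ i) / hyp_height R y ^ 3"
proof -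
  have nz: "hyp_height R y \<noteq> 0" for y :: "real ^ 'n" using hyp_height_pos[OF R, of y] by simp
  have g: "((\<lambda>t. 1 / t) has_real_derivative - 1 / (hyp_height R y)\<^sup>2) (at (hyp_height R y))" for y :: "real ^ 'n"
    using nz[of y] by (auto intro!: derivative_eq_intros simp: power2_eq_square)
  have c: "continuous_on UNIV (\<lambda>y :: real ^ 'n. - 1 / (hyp_height R y)\<^sup>2)"
    using nz by (intro continuous_intros) auto
  note comp = C1_compose[OF hyp_height_C1(1)[OF R] g c]
  show "C1 (\<lambda>y :: real ^ 'n. 1 / hyp_height R y)" by (rule comp(1))
  show "partial i (\<lambda>y. 1 / hyp_height R y) y = - (y $ i) / hyp_height R y ^ 3"
    unfolding comp(2) hyp_height_C1(2)[OF R] by (simp add: power2_eq_square power3_eq_cube)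
qed

text \<open>\<open>v\<close> is the chart coordinate of the pole, which stays fixed
  throughout.\<close>

locale hyperboloid_point =
  fixes R :: real and v :: "real ^ 'n"
  assumes R: "R > 0"
begin

abbreviation "w \<equiv> hyp_height R"

definition "cosh_dist y = (w v * w y - v \<bullet> y) / R\<^sup>2"

lemma w_pos: "w y > 0"
  by (rule hyp_height_pos[OF R])

lemma w_nonzero: "w y \<noteq> 0"
  using w_pos[of y] by simp

lemma w_square: "w y * w y = R\<^sup>2 + y \<bullet> y"
  using hyp_height_square[of R y] by (simp add: power2_eq_square)

lemma R_square_cosh_dist: "R\<^sup>2 * cosh_dist y = w v * w y - v \<bullet> y"
  using R by (simp add: cosh_dist_def)

lemma mink_hyp_chart: "mink (hyp_chart R v /\<^sub>R R) (hyp_chart R y /\<^sub>R R) = cosh_dist y"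
proof -
  have "(\<Sum>i\<in>UNIV. v $ i / R * (y $ i / R)) = (v \<bullet> y) / R\<^sup>2"
    by (simp add: inner_vec_def sum_divide_distrib power2_eq_square)
  then show ?thesis
    by (simp add: mink_def hyp_chart_eq cosh_dist_def power2_eq_square divide_inverse mult_ac left_diff_distrib right_diff_distrib)
qed

lemma cosh_dist_center: "cosh_dist v = 1"
  using w_square[of v] R by (simp add: cosh_dist_def)

text \<open>A preliminary bound: the sharp bound \<open>cosh_dist_ge_1\<close> rests on
  \<open>cosh_dist_lower_bound\<close>, where \<open>1 + cosh_dist y\<close> has to be a nonnegative
  factor.\<close>

lemma cosh_dist_pos: "cosh_dist y > 0"
proof -
  have "norm y < w y" for y
    unfolding hyp_height_def using R by (intro real_less_rsqrt) simp
  then have "norm v * norm y < w v * w y"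
    by (intro mult_strict_mono') auto
  moreover have "v \<bullet> y \<le> norm v * norm y" by (rule norm_cauchy_schwarz)
  ultimately show ?thesis using R by (simp add: cosh_dist_def)
qed

text \<open>The right-hand side is minus the Minkowski square of the chord between the two
  points.\<close>

lemma two_R_square_cosh_dist_minus_1:
  "2 * R\<^sup>2 * (cosh_dist y - 1) = (y - v) \<bullet> (y - v) - (w y - w v)\<^sup>2"
proof -
  have "2 * R\<^sup>2 * (cosh_dist y - 1) = 2 * (R\<^sup>2 * cosh_dist y) - 2 * R\<^sup>2" by (simp add: algebra_simps)
  also have "\<dots> = (y - v) \<bullet> (y - v) - (w y - w v)\<^sup>2"
    unfolding R_square_cosh_dist using w_square[of y] w_square[of v]
    by (simp add: power2_diff power2_eq_square[of "w y"] power2_eq_square[of "w v"] inner_diff_left inner_diff_right inner_commute[of y v])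
  finally show ?thesis .
qed

lemma w_diff: "(w y - w v) * (w y + w v) = (y - v) \<bullet> (y + v)"
  using w_square[of y] w_square[of v]
  by (simp add: algebra_simps inner_add_right inner_diff_left inner_commute)

text \<open>The chord formula is multiplied by \<open>(w y + w v)\<^sup>2\<close>. Then
  \<open>w_diff\<close> and Cauchy-Schwarz bound the negative part by means of
  \<open>(y + v) \<bullet> (y + v)\<close>, and the analogous formula \<open>s\<close> for the sum
  of the two points evaluates what remains.\<close>

lemma cosh_dist_lower_bound:
  "norm (y - v) ^ 2 * (1 + cosh_dist y) \<le> (cosh_dist y - 1) * (w y + w v)\<^sup>2"
proof -
  have s: "(w y + w v)\<^sup>2 - (y + v) \<bullet> (y + v) = 2 * R\<^sup>2 * (1 + cosh_dist y)"
  proof -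
    have "2 * R\<^sup>2 * (1 + cosh_dist y) = 2 * R\<^sup>2 + 2 * (R\<^sup>2 * cosh_dist y)" by (simp add: algebra_simps)
    then show ?thesis
      unfolding R_square_cosh_dist using w_square[of y] w_square[of v]
      by (simp add: power2_sum power2_eq_square[of "w y"] power2_eq_square[of "w v"] inner_add_left inner_add_right inner_commute[of y v])
  qed
  have "2 * R\<^sup>2 * ((cosh_dist y - 1) * (w y + w v)\<^sup>2) = (2 * R\<^sup>2 * (cosh_dist y - 1)) * (w y + w v)\<^sup>2" by simp
  also have "\<dots> = ((y - v) \<bullet> (y - v)) * (w y + w v)\<^sup>2 - ((w y - w v) * (w y + w v))\<^sup>2"
    unfolding two_R_square_cosh_dist_minus_1 by (simp only: left_diff_distrib[of "(y - v) \<bullet> (y - v)"] power_mult_distrib)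
  also have "\<dots> \<ge> ((y - v) \<bullet> (y - v)) * (w y + w v)\<^sup>2 - ((y - v) \<bullet> (y - v)) * ((y + v) \<bullet> (y + v))"
    unfolding w_diff using Cauchy_Schwarz_ineq[of "y - v" "y + v"] by simp
  also have "((y - v) \<bullet> (y - v)) * (w y + w v)\<^sup>2 - ((y - v) \<bullet> (y - v)) * ((y + v) \<bullet> (y + v))
     = 2 * R\<^sup>2 * (((y - v) \<bullet> (y - v)) * (1 + cosh_dist y))"
    unfolding right_diff_distrib[symmetric] s by simp
  finally show ?thesis
    using R by (simp add: power2_norm_eq_inner)
qed

lemma cosh_dist_ge_1: "cosh_dist y \<ge> 1"
proof -
  have "0 \<le> norm (y - v) ^ 2 * (1 + cosh_dist y)" using cosh_dist_pos[of y] by simp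
  also note cosh_dist_lower_bound
  finally show ?thesis
    using w_pos[of y] w_pos[of v] by (simp add: zero_le_mult_iff)
qed

lemma cosh_dist_gt_1: "y \<noteq> v \<Longrightarrow> cosh_dist y > 1"
proof -
  assume "y \<noteq> v"
  then have "0 < norm (y - v) ^ 2 * (1 + cosh_dist y)" using cosh_dist_pos[of y] by simp
  also note cosh_dist_lower_bound
  finally show ?thesis
    using w_pos[of y] w_pos[of v] by (simp add: zero_less_mult_iff)
qed

text \<open>Quadratic growth at the pole, uniform on bounded sets. It controls both the rescaled
  integrands and the sublevel sets of the distance.\<close>

lemma cosh_dist_square_lower_bound:
  "norm (y - v) ^ 2 / (w y + w v)\<^sup>2 \<le> (cosh_dist y)\<^sup>2 - 1"
proof -
  have p: "(w y + w v)\<^sup>2 > 0" using w_pos[of y] w_pos[of v] by simp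
  have "norm (y - v) ^ 2 * 1 \<le> norm (y - v) ^ 2 * ((1 + cosh_dist y) * (1 + cosh_dist y))"
  proof (rule mult_left_mono)
    have "1 * 1 \<le> (1 + cosh_dist y) * (1 + cosh_dist y)"
      using cosh_dist_pos[of y] by (intro mult_mono) auto
    then show "1 \<le> (1 + cosh_dist y) * (1 + cosh_dist y)" by simp
  qed simp
  also have "\<dots> = norm (y - v) ^ 2 * (1 + cosh_dist y) * (1 + cosh_dist y)" by simp
  also have "\<dots> \<le> (cosh_dist y - 1) * (w y + w v)\<^sup>2 * (1 + cosh_dist y)"
    using cosh_dist_pos[of y] by (intro mult_right_mono cosh_dist_lower_bound) auto
  also have "\<dots> = ((cosh_dist y)\<^sup>2 - 1) * (w y + w v)\<^sup>2"
    by (simp add: power2_eq_square algebra_simps)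
  finally show ?thesis using p by (simp add: pos_divide_le_eq)
qed

lemma C1_cosh_dist: "C1 cosh_dist"
  and partial_cosh_dist: "partial i cosh_dist y = (w v * y $ i / w y - v $ i) / R\<^sup>2"
proof -
  have d: "(cosh_dist has_derivative (\<lambda>h. (w v * (y \<bullet> h / w y) - v \<bullet> h) / R\<^sup>2)) (at y)" for y
    unfolding cosh_dist_def[abs_def] divide_inverse[of _ "R\<^sup>2"]
    by (intro has_derivative_mult_left has_derivative_diff has_derivative_mult_right
        hyp_height_has_derivative[OF R] has_derivative_inner_right has_derivative_ident)
  show "partial i cosh_dist y = (w v * y $ i / w y - v $ i) / R\<^sup>2"
    by (simp add: partialI[OF d] inner_axis)
  show "C1 cosh_dist"
  proof (rule C1I[OF d])
    show "continuous_on UNIV (\<lambda>y. (w v * (y \<bullet> axis i 1 / w y) - v \<bullet> axis i 1) / R\<^sup>2)" for i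
      using w_nonzero R by (intro continuous_intros) auto
  qed
qed

lemma continuous_on_cosh_dist [continuous_intros]: "continuous_on S cosh_dist"
  by (rule continuous_on_subset[OF C1_continuous[OF C1_cosh_dist]]) simp

text \<open>The derivative of the regularised radial function \<open>radial_F_approx\<close>;
  gradient and Laplacian depend on that function only through this derivative.\<close>

definition "radial_G \<epsilon> t = - 1 / sqrt (t\<^sup>2 - 1 + \<epsilon>) ^ CARD('n)"

lemma radial_G_has_derivative:
  fixes t :: real
  assumes "\<epsilon> > 0" "t \<ge> 1"
  shows "(radial_G \<epsilon> has_real_derivative CARD('n) * t / sqrt (t\<^sup>2 - 1 + \<epsilon>) ^ (CARD('n) + 2)) (at t)"
proof -
  define d where "d = CARD('n)"
  have d: "d > 0" unfolding d_def by simp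
  have "t\<^sup>2 \<ge> 1" using assms by simp
  then have p: "t\<^sup>2 - 1 + \<epsilon> > 0" using assms by linarith
  define s where "s = sqrt (t\<^sup>2 - 1 + \<epsilon>)"
  have s: "s > 0" using p by (simp add: s_def)
  have ds: "((\<lambda>t. sqrt (t\<^sup>2 - 1 + \<epsilon>)) has_real_derivative t / s) (at t)"
    using p by (auto intro!: derivative_eq_intros simp: s_def field_simps)
  obtain m where m: "d = Suc m" using d gr0_implies_Suc by blast
  have "((\<lambda>t. sqrt (t\<^sup>2 - 1 + \<epsilon>) ^ Suc m) has_real_derivative (1 + real m) * (t / s * s ^ m)) (at t)"
    using DERIV_power_Suc[OF ds, of m] by (simp add: s_def)
  from DERIV_minus[OF DERIV_inverse'[OF this]]
  have "((\<lambda>t. - inverse (sqrt (t\<^sup>2 - 1 + \<epsilon>) ^ Suc m)) has_real_derivative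
      - (- (inverse (s ^ Suc m) * ((1 + real m) * (t / s * s ^ m)) * inverse (s ^ Suc m)))) (at t)"
    using s by (simp add: s_def)
  moreover have "- (- (inverse (s ^ Suc m) * ((1 + real m) * (t / s * s ^ m)) * inverse (s ^ Suc m))) = d * t / s ^ (d + 2)"
    using s by (simp add: m field_simps)
  moreover have "radial_G \<epsilon> = (\<lambda>t. - inverse (sqrt (t\<^sup>2 - 1 + \<epsilon>) ^ Suc m))"
    by (simp add: radial_G_def fun_eq_iff divide_inverse m flip: d_def)
  ultimately show ?thesis by (simp only: d_def s_def)
qed

text \<open>
  The components of the gradient of a function of \<open>cosh_dist\<close> with derivative \<open>radial_G \<epsilon>\<close>, multiplied by
  the volume density.
\<close>

definition "flux \<epsilon> i y = (radial_G \<epsilon> (cosh_dist y) * (1 / w y)) * ((cosh_dist y * y $ i - v $ i) * (1 / R))"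

lemma radial_G_cosh_dist_C1:
  assumes "\<epsilon> > 0"
  shows "C1 (\<lambda>y. radial_G \<epsilon> (cosh_dist y))"
    "partial i (\<lambda>y. radial_G \<epsilon> (cosh_dist y)) y = CARD('n) * cosh_dist y / sqrt ((cosh_dist y)\<^sup>2 - 1 + \<epsilon>) ^ (CARD('n) + 2) * partial i cosh_dist y"
proof -
  have nz: "(cosh_dist y)\<^sup>2 - 1 + \<epsilon> > 0" for y
  proof -
    have "(cosh_dist y)\<^sup>2 \<ge> 1" using cosh_dist_ge_1[of y] by simp
    then show ?thesis using assms by linarith
  qed
  have c: "continuous_on UNIV (\<lambda>y. CARD('n) * cosh_dist y / sqrt ((cosh_dist y)\<^sup>2 - 1 + \<epsilon>) ^ (CARD('n) + 2))"
    by (intro continuous_intros ballI) (use nz in \<open>simp add: less_imp_neq[THEN not_sym]\<close>)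
  note comp = C1_compose[where g' = "\<lambda>t :: real. CARD('n) * t / sqrt (t\<^sup>2 - 1 + \<epsilon>) ^ (CARD('n) + 2)", OF C1_cosh_dist radial_G_has_derivative[OF assms cosh_dist_ge_1] c]
  show "C1 (\<lambda>y. radial_G \<epsilon> (cosh_dist y))" by (rule comp(1))
  show "partial i (\<lambda>y. radial_G \<epsilon> (cosh_dist y)) y = CARD('n) * cosh_dist y / sqrt ((cosh_dist y)\<^sup>2 - 1 + \<epsilon>) ^ (CARD('n) + 2) * partial i cosh_dist y"
    by (rule comp(2))
qed

lemma C1_flux:
  assumes "\<epsilon> > 0"
  shows "C1 (flux \<epsilon> i)"
  unfolding flux_def[abs_def]
  by (intro C1_mult C1_diff C1_const C1_component C1_cosh_dist radial_G_cosh_dist_C1(1)[OF assms] inverse_hyp_height_C1(1)[OF R])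

lemma inner_cosh_dist_gradient:
  "(\<Sum>i\<in>UNIV. y $ i * partial i cosh_dist y) = cosh_dist y - w v / w y"
proof -
  have "(\<Sum>i\<in>UNIV. y $ i * partial i cosh_dist y) = (\<Sum>i\<in>UNIV. w v / (w y * R\<^sup>2) * (y $ i * y $ i) - 1 / R\<^sup>2 * (v $ i * y $ i))"
    unfolding partial_cosh_dist by (intro sum.cong) (auto simp: algebra_simps diff_divide_distrib)
  also have "\<dots> = w v / (w y * R\<^sup>2) * (y \<bullet> y) - 1 / R\<^sup>2 * (v \<bullet> y)"
    by (simp only: sum_subtractf sum_distrib_left[symmetric] inner_vec_def inner_real_def)
  also have "y \<bullet> y = w y * w y - R\<^sup>2" using w_square[of y] by simp
  also have "w v / (w y * R\<^sup>2) * (w y * w y - R\<^sup>2) - 1 / R\<^sup>2 * (v \<bullet> y) = cosh_dist y - w v / w y"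
    using w_pos[of y] R by (simp add: cosh_dist_def field_simps)
  finally show ?thesis .
qed

text \<open>Up to the density, the divergence is \<open>G' * (c\<^sup>2 - 1) + G * (d * c)\<close>
  divided by \<open>R\<^sup>2\<close>: the function \<open>c\<close> has squared gradient length
  \<open>(c\<^sup>2 - 1) / R\<^sup>2\<close>, which is the content of \<open>S3\<close>, and
  Laplacian \<open>d * c / R\<^sup>2\<close>.\<close>

lemma divergence_flux:
  assumes \<epsilon>: "\<epsilon> > 0"
  shows "(\<Sum>i\<in>UNIV. partial i (flux \<epsilon> i) y) =
     - (CARD('n) * cosh_dist y * \<epsilon> / (R * w y * sqrt ((cosh_dist y)\<^sup>2 - 1 + \<epsilon>) ^ (CARD('n) + 2)))"
proof -
  define c where "c = cosh_dist y"
  define W where "W = w y"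
  define G where "G = radial_G \<epsilon> c"
  define G' where "G' = CARD('n) * c / sqrt (c\<^sup>2 - 1 + \<epsilon>) ^ (CARD('n) + 2)"
  have W: "W > 0" using w_pos by (simp add: W_def)
  have yy: "y \<bullet> y = W * W - R\<^sup>2" using w_square[of y] by (simp add: W_def)
  have vv: "v \<bullet> v = w v * w v - R\<^sup>2" using w_square[of v] by simp
  have vy: "v \<bullet> y = w v * W - R\<^sup>2 * c" using R_square_cosh_dist[of y] by (simp add: W_def c_def)
  have p: "partial i (flux \<epsilon> i) y = G * (1 / W) * ((partial i cosh_dist y * y $ i + c) * (1 / R)) +
      (G' * partial i cosh_dist y * (1 / W) + G * (- (y $ i) / W ^ 3)) * ((c * y $ i - v $ i) * (1 / R))" for i
  proof -
    have ax: "partial i (\<lambda>y. y $ i) y = 1"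
      using partialI[OF bounded_linear_imp_has_derivative[OF bounded_linear_vec_nth], of i i y] by simp
    have cst: "partial i (\<lambda>y. a) y = 0" for a :: real
      by (simp add: partialI[OF has_derivative_const])
    note C1 = C1_mult[OF C1_cosh_dist C1_component]
    note C2 = C1_diff[OF C1 C1_const]
    note C3 = C1_mult[OF radial_G_cosh_dist_C1(1)[OF \<epsilon>] inverse_hyp_height_C1(1)[OF R]]
    have "partial i (\<lambda>y. (cosh_dist y * y $ i - v $ i) * (1 / R)) y = (partial i cosh_dist y * y $ i + c) * (1 / R)"
      unfolding partial_mult[OF C2 C1_const] partial_diff[OF C1 C1_const] partial_mult[OF C1_cosh_dist C1_component]
      by (simp add: ax cst c_def algebra_simps)
    moreover have "partial i (\<lambda>y. radial_G \<epsilon> (cosh_dist y) * (1 / w y)) y = G' * partial i cosh_dist y * (1 / W) + G * (- (y $ i) / W ^ 3)"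
      unfolding partial_mult[OF radial_G_cosh_dist_C1(1)[OF \<epsilon>] inverse_hyp_height_C1(1)[OF R]]
        radial_G_cosh_dist_C1(2)[OF \<epsilon>] inverse_hyp_height_C1(2)[OF R]
      by (simp add: G_def G'_def c_def W_def)
    ultimately show ?thesis
      unfolding flux_def[abs_def] partial_mult[OF C3 C1_mult[OF C2 C1_const]] by (simp add: c_def W_def G_def)
  qed
  have S1: "(\<Sum>i\<in>UNIV. partial i cosh_dist y * y $ i) = c - w v / W"
    using inner_cosh_dist_gradient[of y] by (simp add: c_def W_def mult.commute)
  have S2: "(\<Sum>i\<in>UNIV. y $ i * (c * y $ i - v $ i)) = W * (c * W - w v)"
  proof -
    have "(\<Sum>i\<in>UNIV. y $ i * (c * y $ i - v $ i)) = c * (y \<bullet> y) - v \<bullet> y"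
      by (simp add: inner_vec_def sum_subtractf sum_distrib_left algebra_simps)
    then show ?thesis unfolding yy vy by (simp add: algebra_simps)
  qed
  have S3: "(\<Sum>i\<in>UNIV. partial i cosh_dist y * (c * y $ i - v $ i)) = c\<^sup>2 - 1"
  proof -
    have "(\<Sum>i\<in>UNIV. partial i cosh_dist y * (c * y $ i - v $ i)) =
       c * (\<Sum>i\<in>UNIV. partial i cosh_dist y * y $ i) - (\<Sum>i\<in>UNIV. partial i cosh_dist y * v $ i)"
      by (simp add: sum_subtractf sum_distrib_left algebra_simps)
    also have "(\<Sum>i\<in>UNIV. partial i cosh_dist y * v $ i) = w v / (W * R\<^sup>2) * (v \<bullet> y) - 1 / R\<^sup>2 * (v \<bullet> v)"
      unfolding partial_cosh_dist W_def[symmetric] inner_vec_def inner_real_def sum_distrib_left sum_subtractf[symmetric]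
      by (intro sum.cong) (auto simp: algebra_simps diff_divide_distrib)
    also have "w v / (W * R\<^sup>2) * (v \<bullet> y) - 1 / R\<^sup>2 * (v \<bullet> v) = 1 - w v * c / W"
      unfolding vy vv using W R by (simp add: field_simps)
    finally show ?thesis unfolding S1 by (simp add: power2_eq_square algebra_simps)
  qed
  have "(\<Sum>i\<in>UNIV. partial i (flux \<epsilon> i) y) =
     (\<Sum>i\<in>UNIV. G / (R * W) * (partial i cosh_dist y * y $ i) + G / (R * W) * c +
        G' / (R * W) * (partial i cosh_dist y * (c * y $ i - v $ i)) - G / (R * W ^ 3) * (y $ i * (c * y $ i - v $ i)))"
    unfolding p by (intro sum.cong refl) (simp add: divide_inverse algebra_simps)
  also have "\<dots> = G / (R * W) * (c - w v / W) + G / (R * W) * c * CARD('n) + G' / (R * W) * (c\<^sup>2 - 1) - G / (R * W ^ 3) * (W * (c * W - w v))"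
    by (simp only: sum.distrib sum_subtractf sum_distrib_left[symmetric] S1 S2 S3 sum_constant) simp
  also have "\<dots> = (G * (CARD('n) * c) + G' * (c\<^sup>2 - 1)) / (R * W)"
    using W R by (simp add: field_simps power3_eq_cube)
  \<comment> \<open>Writing \<open>c\<^sup>2 - 1 = s\<^sup>2 - \<epsilon>\<close>, the
    \<open>s\<^sup>2\<close> part of the second term cancels the first term.\<close>
  also have "G * (CARD('n) * c) + G' * (c\<^sup>2 - 1) = - (CARD('n) * c * \<epsilon> / sqrt (c\<^sup>2 - 1 + \<epsilon>) ^ (CARD('n) + 2))"
  proof -
    have "c\<^sup>2 \<ge> 1" using cosh_dist_ge_1[of y] by (simp add: c_def)
    then have p: "c\<^sup>2 - 1 + \<epsilon> > 0" using \<epsilon> by linarith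
    define s where "s = sqrt (c\<^sup>2 - 1 + \<epsilon>)"
    have s: "s > 0" "c\<^sup>2 - 1 = s\<^sup>2 - \<epsilon>" using p by (simp_all add: s_def)
    show ?thesis
      unfolding G_def G'_def radial_G_def s_def[symmetric] using s(1)
      unfolding s(2) by (simp add: field_simps power_add power2_eq_square)
  qed
  finally show ?thesis by (simp add: c_def W_def mult_ac)
qed

end

section \<open>The radial function and its rescaling\<close>

definition radial_F :: "nat \<Rightarrow> real \<Rightarrow> real" where
  "radial_F d c = hyp_I d (arcosh c)"

text \<open>The derivative \<open>1 / sqrt (c\<^sup>2 - 1)\<close> of \<open>arcosh\<close> raises
  the exponent from \<open>d - 1\<close> to \<open>d\<close>.\<close>

lemma radial_F_has_derivative:
  assumes "d \<ge> 2" "c > 1"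
  shows "(radial_F d has_real_derivative - 1 / sqrt (c\<^sup>2 - 1) ^ d) (at c)"
proof -
  have "arcosh c > 0" using assms by simp
  then have "(hyp_I d has_real_derivative - 1 / sqrt (c\<^sup>2 - 1) ^ (d - 1)) (at (arcosh c))"
    using hyp_I_has_derivative[OF assms(1), of "arcosh c"] assms(2) by (simp add: sinh_arcosh_real)
  from DERIV_chain2[OF this arcosh_real_has_field_derivative[OF assms(2)]]
  have "((\<lambda>c. hyp_I d (arcosh c)) has_real_derivative - 1 / sqrt (c\<^sup>2 - 1) ^ (d - 1) * (1 / sqrt (c\<^sup>2 - 1))) (at c)" .
  moreover have "- 1 / sqrt (c\<^sup>2 - 1) ^ (d - 1) * (1 / sqrt (c\<^sup>2 - 1)) = - 1 / sqrt (c\<^sup>2 - 1) ^ d"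
    using assms(1) by (cases d) (auto simp: mult.commute)
  ultimately show ?thesis
    by (simp add: radial_F_def[abs_def])
qed

lemma radial_F_nonneg: "c \<ge> 1 \<Longrightarrow> radial_F d c \<ge> 0"
  by (simp add: radial_F_def hyp_I_nonneg)

lemma radial_F_antimono:
  assumes "d \<ge> 2" "1 < a" "a \<le> b"
  shows "radial_F d b \<le> radial_F d a"
proof (rule DERIV_nonpos_imp_nonincreasing[OF assms(3)])
  fix t assume "a \<le> t"
  then have "t > 1" using assms by simp
  moreover have "t\<^sup>2 - 1 \<ge> 0" using \<open>t > 1\<close> by simp
  ultimately show "\<exists>y. (radial_F d has_real_derivative y) (at t) \<and> y \<le> 0"
    using radial_F_has_derivative[OF assms(1)] by (intro exI[of _ "- 1 / sqrt (t\<^sup>2 - 1) ^ d"]) auto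
qed

lemma isCont_radial_F: "d \<ge> 2 \<Longrightarrow> c > 1 \<Longrightarrow> isCont (radial_F d) c"
  using radial_F_has_derivative DERIV_isCont by blast

text \<open>
  Rescaling the argument of \<open>radial_F\<close> shifts \<open>c\<^sup>2 - 1\<close> to \<open>c\<^sup>2 - 1 + \<epsilon>\<close> in the derivative, which removes
  the singularity at \<open>c = 1\<close> without changing the shape of the function.
\<close>

definition radial_F_approx :: "nat \<Rightarrow> real \<Rightarrow> real \<Rightarrow> real" where
  "radial_F_approx d \<epsilon> c = (1 / sqrt (1 - \<epsilon>)) ^ (d - 1) * radial_F d (1 / sqrt (1 - \<epsilon>) * c)"

lemma radial_F_approx_has_derivative:
  assumes d: "d \<ge> 2" and \<epsilon>: "0 < \<epsilon>" "\<epsilon> < 1" and c: "c \<ge> 1"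
  shows "(radial_F_approx d \<epsilon> has_real_derivative - 1 / sqrt (c\<^sup>2 - 1 + \<epsilon>) ^ d) (at c)"
proof -
  define \<mu> where "\<mu> = 1 / sqrt (1 - \<epsilon>)"
  have \<mu>: "\<mu> > 1" using \<epsilon> by (simp add: \<mu>_def)
  have \<mu>2: "\<mu>\<^sup>2 * (1 - \<epsilon>) = 1" using \<epsilon> by (simp add: \<mu>_def power_divide)
  have "\<mu> * 1 \<le> \<mu> * c" using \<mu> c by (intro mult_left_mono) auto
  then have \<mu>c: "\<mu> * c > 1" using \<mu> by linarith
  have "c\<^sup>2 \<ge> 1" using c by simp
  then have s: "c\<^sup>2 - 1 + \<epsilon> > 0" using \<epsilon> by linarith
  have "(\<mu> * c)\<^sup>2 - 1 = \<mu>\<^sup>2 * (c\<^sup>2 - 1 + \<epsilon>)"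
    using \<mu>2 by (simp add: power_mult_distrib algebra_simps)
  then have sq: "sqrt ((\<mu> * c)\<^sup>2 - 1) = \<mu> * sqrt (c\<^sup>2 - 1 + \<epsilon>)"
    using \<mu> by (simp add: real_sqrt_mult)
  have inner: "((\<lambda>c. \<mu> * c) has_real_derivative \<mu>) (at c)"
    by (auto intro!: derivative_eq_intros)
  have "((\<lambda>c. \<mu> ^ (d - 1) * radial_F d (\<mu> * c)) has_real_derivative \<mu> ^ (d - 1) * (- 1 / sqrt ((\<mu> * c)\<^sup>2 - 1) ^ d * \<mu>)) (at c)"
    by (rule DERIV_cmult[OF DERIV_chain2[OF radial_F_has_derivative[OF d \<mu>c] inner]])
  moreover have "\<mu> ^ (d - 1) * (- 1 / sqrt ((\<mu> * c)\<^sup>2 - 1) ^ d * \<mu>) = - 1 / sqrt (c\<^sup>2 - 1 + \<epsilon>) ^ d"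
    unfolding sq using \<mu> s d by (cases d) (auto simp: power_mult_distrib)
  moreover have "radial_F_approx d \<epsilon> = (\<lambda>c. \<mu> ^ (d - 1) * radial_F d (\<mu> * c))"
    by (simp add: radial_F_approx_def \<mu>_def fun_eq_iff)
  ultimately show ?thesis by (simp only:)
qed

text \<open>For \<open>\<epsilon> \<le> 1 / 4\<close> the scaling factor lies between 1 and 2.
  Monotonicity lets the rescaled argument be replaced by \<open>c\<close>, so the bound does not
  depend on \<open>\<epsilon>\<close>.\<close>

lemma radial_F_approx_bounds:
  assumes d: "d \<ge> 2" and \<epsilon>: "0 < \<epsilon>" "\<epsilon> \<le> 1 / 4" and c: "c > 1"
  shows "0 \<le> radial_F_approx d \<epsilon> c" "radial_F_approx d \<epsilon> c \<le> 2 ^ (d - 1) * radial_F d c"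
proof -
  define \<mu> where "\<mu> = 1 / sqrt (1 - \<epsilon>)"
  have \<mu>: "\<mu> > 1" using \<epsilon> by (simp add: \<mu>_def)
  have "sqrt (1 - \<epsilon>) \<ge> 1 / 2"
    using \<epsilon> by (intro real_le_rsqrt) (simp add: power2_eq_square)
  moreover from this have "sqrt (1 - \<epsilon>) > 0" by linarith
  ultimately have \<mu>2: "\<mu> \<le> 2" by (simp add: \<mu>_def divide_le_eq)
  have \<mu>c: "c \<le> \<mu> * c" using \<mu> c by simp
  have nn: "0 \<le> radial_F d (\<mu> * c)" 
    by (rule radial_F_nonneg, rule order_trans[OF _ \<mu>c]) (use c in simp)
  show "0 \<le> radial_F_approx d \<epsilon> c"
    unfolding radial_F_approx_def \<mu>_def[symmetric] using nn \<mu> by simp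
  show "radial_F_approx d \<epsilon> c \<le> 2 ^ (d - 1) * radial_F d c"
    unfolding radial_F_approx_def \<mu>_def[symmetric]
    using \<mu> \<mu>2 nn by (intro mult_mono power_mono radial_F_antimono[OF d c \<mu>c]) auto
qed

lemma radial_F_approx_tendsto:
  assumes d: "d \<ge> 2" and c: "c > 1" and e: "e \<longlonglongrightarrow> 0"
  shows "(\<lambda>n. radial_F_approx d (e n) c) \<longlonglongrightarrow> radial_F d c"
proof -
  have m: "(\<lambda>n. 1 / sqrt (1 - e n)) \<longlonglongrightarrow> 1 / sqrt (1 - 0)"
    by (intro tendsto_intros e) simp
  then have "(\<lambda>n. 1 / sqrt (1 - e n) * c) \<longlonglongrightarrow> 1 / sqrt (1 - 0) * c"
    by (rule tendsto_mult[OF _ tendsto_const])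
  then have "(\<lambda>n. radial_F d (1 / sqrt (1 - e n) * c)) \<longlonglongrightarrow> radial_F d c"
    using isCont_tendsto_compose[OF isCont_radial_F[OF d c]] by simp
  from tendsto_mult[OF tendsto_power[OF m] this]
  show ?thesis by (simp add: radial_F_approx_def)
qed

lemma lborel_integral_affine:
  fixes g :: "'a::euclidean_space \<Rightarrow> real"
  assumes g: "g \<in> borel_measurable borel" and c: "c > 0"
  shows "integral\<^sup>L lborel g = c ^ DIM('a) * integral\<^sup>L lborel (\<lambda>x. g (t + c *\<^sub>R x))"
proof -
  have "integral\<^sup>L lborel g = integral\<^sup>L (density (distr lborel borel (\<lambda>x. t + c *\<^sub>R x)) (\<lambda>_. ennreal (\<bar>c\<bar> ^ DIM('a)))) g"
    using lborel_affine[of c t] c by simp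
  also have "\<dots> = integral\<^sup>L (distr lborel borel (\<lambda>x. t + c *\<^sub>R x)) (\<lambda>x. \<bar>c\<bar> ^ DIM('a) *\<^sub>R g x)"
    using g by (intro integral_density) auto
  also have "\<dots> = integral\<^sup>L lborel (\<lambda>x. \<bar>c\<bar> ^ DIM('a) *\<^sub>R g (t + c *\<^sub>R x))"
    using g by (intro integral_distr) auto
  finally show ?thesis using c by simp
qed

section \<open>Green's formula and concentration at the pole\<close>

context hyperboloid_point
begin

text \<open>
  Gradient and Laplacian are both multiplied by the volume density, so that they are related by the flat
  divergence.
\<close>

definition "grad f i y = R / w y * (partial i f y + y $ i * (\<Sum>j\<in>UNIV. y $ j * partial j f y) / R\<^sup>2)"

definition "lap f y = (\<Sum>i\<in>UNIV. partial i (grad f i) y)"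

lemma C1_grad:
  assumes "\<And>i. C1 (partial i f)"
  shows "C1 (grad f i)"
proof -
  have "grad f i = (\<lambda>y. (R * (1 / w y)) * (partial i f y + (y $ i * (\<Sum>j\<in>UNIV. y $ j * partial j f y)) * (1 / R\<^sup>2)))"
    by (simp add: grad_def fun_eq_iff)
  moreover have "C1 (\<lambda>y. (R * (1 / w y)) * (partial i f y + (y $ i * (\<Sum>j\<in>UNIV. y $ j * partial j f y)) * (1 / R\<^sup>2)))"
    by (intro C1_mult C1_add C1_const C1_component C1_sum assms inverse_hyp_height_C1(1)[OF R]) auto
  ultimately show ?thesis by (simp only:)
qed

lemma continuous_on_lap:
  assumes "\<And>i. C1 (partial i f)"
  shows "continuous_on UNIV (lap f)"
  unfolding lap_def[abs_def]
  by (intro continuous_on_sum C1_continuous_partial C1_grad assms)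

lemma grad_bounded_support:
  assumes "C1 f" "\<And>y. norm y > B \<Longrightarrow> f y = 0" "norm y > B"
  shows "grad f i y = 0"
  using partial_bounded_support[OF assms] by (simp add: grad_def)

lemma lap_bounded_support:
  assumes "C1 f" "\<And>i. C1 (partial i f)" "\<And>y. norm y > B \<Longrightarrow> f y = 0" "norm y > B"
  shows "lap f y = 0"
  unfolding lap_def
  using partial_bounded_support[OF C1_grad[OF assms(2)] grad_bounded_support[OF assms(1,3)] assms(4)] by simp

text \<open>Symmetry of the metric: the gradient of \<open>f\<close> paired with the differential of
  \<open>cosh_dist\<close> equals the differential of \<open>f\<close> paired with the gradient of
  \<open>cosh_dist\<close>.\<close>

lemma sum_grad_partial_cosh_dist:
  "(\<Sum>i\<in>UNIV. grad f i y * partial i cosh_dist y) = (\<Sum>i\<in>UNIV. partial i f y * ((cosh_dist y * y $ i - v $ i) / (R * w y)))"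
proof -
  define T where "T = (\<Sum>j\<in>UNIV. y $ j * partial j f y)"
  have W: "w y > 0" by (rule w_pos)
  have "(\<Sum>i\<in>UNIV. grad f i y * partial i cosh_dist y) =
      (\<Sum>i\<in>UNIV. R / w y * (partial i f y * partial i cosh_dist y) + T / (R * w y) * (y $ i * partial i cosh_dist y))"
    unfolding grad_def T_def[symmetric] using R W
    by (intro sum.cong refl) (simp add: field_simps power2_eq_square)
  also have "\<dots> = (\<Sum>i\<in>UNIV. R / w y * (partial i f y * partial i cosh_dist y)) + T / (R * w y) * (cosh_dist y - w v / w y)"
    by (simp only: sum.distrib sum_distrib_left[symmetric] inner_cosh_dist_gradient)
  also have "\<dots> = (\<Sum>i\<in>UNIV. R / w y * (partial i f y * partial i cosh_dist y) + 1 / (R * w y) * (cosh_dist y - w v / w y) * (y $ i * partial i f y))"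
    by (simp only: sum.distrib sum_distrib_left[symmetric] T_def) (simp add: mult_ac)
  also have "\<dots> = (\<Sum>i\<in>UNIV. partial i f y * ((cosh_dist y * y $ i - v $ i) / (R * w y)))"
    unfolding partial_cosh_dist using R W
    by (intro sum.cong refl) (simp add: field_simps power2_eq_square)
  finally show ?thesis .
qed

lemma integral_lap_approx:
  assumes d: "CARD('n) \<ge> 2" and f: "C1 f" "\<And>i. C1 (partial i f)" and supp: "\<And>y. norm y > B \<Longrightarrow> f y = 0"
    and \<epsilon>: "0 < \<epsilon>" "\<epsilon> < 1"
  shows "integral\<^sup>L lborel (\<lambda>y. - lap f y * radial_F_approx CARD('n) \<epsilon> (cosh_dist y)) =
     integral\<^sup>L lborel (\<lambda>y. f y * (CARD('n) * cosh_dist y * \<epsilon> / (R * w y * sqrt ((cosh_dist y)\<^sup>2 - 1 + \<epsilon>) ^ (CARD('n) + 2))))"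
    (is "_ = integral\<^sup>L lborel (\<lambda>y. f y * ?K y)")
proof -
  define u where "u y = radial_F_approx CARD('n) \<epsilon> (cosh_dist y)" for y
  have der: "(radial_F_approx CARD('n) \<epsilon> has_real_derivative radial_G \<epsilon> (cosh_dist y)) (at (cosh_dist y))" for y
    unfolding radial_G_def by (rule radial_F_approx_has_derivative[OF d \<epsilon> cosh_dist_ge_1])
  note comp = C1_compose[OF C1_cosh_dist der C1_continuous[OF radial_G_cosh_dist_C1(1)[OF \<epsilon>(1)]], folded u_def]
  have C1u: "C1 u" using comp(1) by (simp only: u_def[abs_def])
  have pu: "partial i u y = radial_G \<epsilon> (cosh_dist y) * partial i cosh_dist y" for i y
    using comp(2) by (simp only: u_def[abs_def])
  \<comment> \<open>Green's vector field. Its support is controlled by \<open>f\<close> alone, and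
    by \<open>cross\<close> the products of first derivatives drop out of its divergence.\<close>
  define X where "X i y = grad f i y * u y - f y * flux \<epsilon> i y" for i y
  note C1g = C1_mult[OF C1_grad[OF f(2)] C1u]
  note C1f = C1_mult[OF f(1) C1_flux[OF \<epsilon>(1)]]
  have C1X: "C1 (X i)" for i
    unfolding X_def[abs_def] by (rule C1_diff[OF C1g C1f])
  have suppX: "X i y = 0" if "norm y > B" for i y
    using supp[OF that] grad_bounded_support[OF f(1) supp that] by (simp add: X_def)
  have pX: "partial i (X i) y = (grad f i y * partial i u y + partial i (grad f i) y * u y) -
      (f y * partial i (flux \<epsilon> i) y + partial i f y * flux \<epsilon> i y)" for i y
    unfolding X_def[abs_def] partial_diff[OF C1g C1f] partial_mult[OF C1_grad[OF f(2)] C1u] partial_mult[OF f(1) C1_flux[OF \<epsilon>(1)]] ..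
  have cross: "(\<Sum>i\<in>UNIV. grad f i y * partial i u y) = (\<Sum>i\<in>UNIV. partial i f y * flux \<epsilon> i y)" for y
  proof -
    have "(\<Sum>i\<in>UNIV. grad f i y * partial i u y) = radial_G \<epsilon> (cosh_dist y) * (\<Sum>i\<in>UNIV. grad f i y * partial i cosh_dist y)"
      by (simp add: pu sum_distrib_left mult_ac)
    also have "\<dots> = (\<Sum>i\<in>UNIV. partial i f y * flux \<epsilon> i y)"
      unfolding sum_grad_partial_cosh_dist sum_distrib_left flux_def
      by (intro sum.cong) (auto simp: divide_inverse mult_ac)
    finally show ?thesis .
  qed
  have sumX: "(\<Sum>i\<in>UNIV. partial i (X i) y) = f y * ?K y - - lap f y * u y" for y
  proof -
    have "(\<Sum>i\<in>UNIV. partial i (X i) y) = lap f y * u y - f y * (\<Sum>i\<in>UNIV. partial i (flux \<epsilon> i) y)"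
      unfolding pX sum_subtractf sum.distrib cross lap_def by (simp add: sum_distrib_right sum_distrib_left)
    then show ?thesis unfolding divergence_flux[OF \<epsilon>(1)] by simp
  qed
  have intX: "integrable lborel (partial i (X i))" for i
    by (rule integrable_continuous_bounded_support[OF C1_continuous_partial[OF C1X] partial_bounded_support[OF C1X suppX]])
  have i1: "integrable lborel (\<lambda>y. - lap f y * u y)"
    by (rule integrable_continuous_bounded_support[of _ B])
       (use lap_bounded_support[OF f supp] in \<open>auto intro!: continuous_intros continuous_on_lap f(2) C1_continuous[OF C1u]\<close>)
  have i2: "integrable lborel (\<lambda>y. f y * ?K y)"
  proof -
    have "integrable lborel (\<lambda>y. (\<Sum>i\<in>UNIV. partial i (X i) y) + - lap f y * u y)"
      by (intro Bochner_Integration.integrable_add Bochner_Integration.integrable_sum intX i1)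
    then show ?thesis unfolding sumX by simp
  qed
  have "0 = (\<Sum>i\<in>UNIV. integral\<^sup>L lborel (partial i (X i)))"
    using integral_partial_eq_0[OF C1X suppX] by simp
  also have "\<dots> = integral\<^sup>L lborel (\<lambda>y. \<Sum>i\<in>UNIV. partial i (X i) y)"
    by (rule Bochner_Integration.integral_sum[symmetric]) (rule intX)
  also have "\<dots> = integral\<^sup>L lborel (\<lambda>y. f y * ?K y) - integral\<^sup>L lborel (\<lambda>y. - lap f y * u y)"
    unfolding sumX by (rule Bochner_Integration.integral_diff[OF i2 i1])
  finally show ?thesis by (simp add: u_def)
qed

lemma continuous_bounded_support_bound:
  fixes g :: "real ^ 'n \<Rightarrow> real"
  assumes "continuous_on UNIV g" "\<And>y. norm y > B \<Longrightarrow> g y = 0"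
  obtains M where "M \<ge> 0" "\<And>y. \<bar>g y\<bar> \<le> M"
proof -
  have "compact (g ` cball 0 B)"
    by (intro compact_continuous_image continuous_on_subset[OF assms(1)]) auto
  then obtain M where M: "\<forall>y\<in>cball 0 B. \<bar>g y\<bar> \<le> M"
    using compact_imp_bounded[of "g ` cball 0 B"] by (auto simp: bounded_iff)
  have "\<bar>g y\<bar> \<le> max M 0" for y
  proof (cases "norm y > B")
    case True
    then show ?thesis using assms(2) by simp
  next
    case False
    then show ?thesis using bspec[OF M, of y] by simp
  qed
  then show ?thesis using that[of "max M 0"] by simp
qed

text \<open>On the ball of radius \<open>B\<close> this is a lower bound for
  \<open>1 / (w y + w v)\<close>, the constant in the quadratic growth of
  \<open>cosh_dist\<close>.\<close>

definition "dist_bound B = 1 / (sqrt (R\<^sup>2 + B\<^sup>2) + w v)"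

lemma dist_bound_pos: "dist_bound B > 0"
  unfolding dist_bound_def using w_pos[of v] by (intro divide_pos_pos add_nonneg_pos) auto

lemma cosh_dist_square_ge:
  assumes "norm y \<le> B"
  shows "(dist_bound B)\<^sup>2 * norm (y - v) ^ 2 \<le> (cosh_dist y)\<^sup>2 - 1"
proof -
  have "w y \<le> sqrt (R\<^sup>2 + B\<^sup>2)"
    unfolding hyp_height_def using assms by (intro real_sqrt_le_mono add_left_mono power_mono) auto
  then have "(w y + w v)\<^sup>2 \<le> (sqrt (R\<^sup>2 + B\<^sup>2) + w v)\<^sup>2"
    using w_pos[of y] w_pos[of v] by (intro power_mono) auto
  moreover have "(w y + w v)\<^sup>2 > 0" using w_pos[of y] w_pos[of v] by simp
  ultimately have "norm (y - v) ^ 2 / (sqrt (R\<^sup>2 + B\<^sup>2) + w v)\<^sup>2 \<le> norm (y - v) ^ 2 / (w y + w v)\<^sup>2"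
    by (intro divide_left_mono mult_pos_pos) (auto simp del: zero_less_power2)
  also note cosh_dist_square_lower_bound
  finally show ?thesis by (simp add: dist_bound_def power_divide)
qed

text \<open>An exact identity from the chord formula and \<open>w_diff\<close>, with no Taylor
  expansion. The right-hand side is continuous at \<open>\<delta> = 0\<close>, where it is the
  metric form at \<open>v\<close> divided by \<open>R\<^sup>2\<close>.\<close>

lemma cosh_dist_square_difference_quotient:
  assumes "\<delta> > 0"
  shows "((cosh_dist (v + \<delta> *\<^sub>R x))\<^sup>2 - 1) / \<delta>\<^sup>2 =
    (cosh_dist (v + \<delta> *\<^sub>R x) + 1) / (2 * R\<^sup>2) * (x \<bullet> x - ((x \<bullet> (v + \<delta> *\<^sub>R x + v)) / (w (v + \<delta> *\<^sub>R x) + w v))\<^sup>2)"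
proof -
  define y where "y = v + \<delta> *\<^sub>R x"
  have yv: "y - v = \<delta> *\<^sub>R x" by (simp add: y_def)
  have p: "w y + w v > 0" using w_pos[of y] w_pos[of v] by simp
  have "(w y - w v) * (w y + w v) = \<delta> * (x \<bullet> (y + v))"
    unfolding w_diff yv by simp
  then have wd: "w y - w v = \<delta> * (x \<bullet> (y + v) / (w y + w v))"
    using p by (simp add: field_simps)
  have "2 * R\<^sup>2 * (cosh_dist y - 1) = \<delta>\<^sup>2 * (x \<bullet> x - (x \<bullet> (y + v) / (w y + w v))\<^sup>2)"
    unfolding two_R_square_cosh_dist_minus_1 yv wd by (simp add: power2_eq_square algebra_simps)
  then have "cosh_dist y - 1 = \<delta>\<^sup>2 * (x \<bullet> x - (x \<bullet> (y + v) / (w y + w v))\<^sup>2) / (2 * R\<^sup>2)"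
    using R by (simp add: field_simps)
  moreover have "(cosh_dist y)\<^sup>2 - 1 = (cosh_dist y - 1) * (cosh_dist y + 1)"
    by (simp add: power2_eq_square algebra_simps)
  ultimately have "((cosh_dist y)\<^sup>2 - 1) / \<delta>\<^sup>2 = (cosh_dist y + 1) / (2 * R\<^sup>2) * (x \<bullet> x - (x \<bullet> (y + v) / (w y + w v))\<^sup>2)"
    using assms by simp
  then show ?thesis unfolding y_def .
qed

lemma approximate_identity:
  assumes d: "CARD('n) \<ge> 2" and f: "continuous_on UNIV f" and supp: "\<And>y. norm y > B \<Longrightarrow> f y = 0"
    and \<delta>: "\<And>n. \<delta> n > 0" "\<delta> \<longlonglongrightarrow> 0"
  shows "(\<lambda>n. integral\<^sup>L lborel (\<lambda>y. f y * (CARD('n) * cosh_dist y * (\<delta> n)\<^sup>2 / (R * w y * sqrt ((cosh_dist y)\<^sup>2 - 1 + (\<delta> n)\<^sup>2) ^ (CARD('n) + 2)))))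
     \<longlonglongrightarrow> f v * (CARD('n) * unit_ball_vol CARD('n) * R ^ (CARD('n) - 2))"
proof -
  define d where "d = CARD('n)"
  define K where "K y = f y * (d * cosh_dist y / (R * w y))" for y
  have Kc: "continuous_on UNIV K"
    unfolding K_def using w_nonzero R by (intro continuous_intros f) auto
  have Ks: "K y = 0" if "norm y > B" for y using supp[OF that] by (simp add: K_def)
  obtain M where M: "M \<ge> 0" "\<And>y. \<bar>K y\<bar> \<le> M"
    using continuous_bounded_support_bound[OF Kc Ks] by blast
  define \<kappa> where "\<kappa> = dist_bound B"
  have \<kappa>: "\<kappa> > 0" by (simp add: \<kappa>_def dist_bound_pos)
  \<comment> \<open>The gradient of the height at the pole; the metric at \<open>v\<close> is the
    quadratic form \<open>x \<bullet> x - (b \<bullet> x)\<^sup>2\<close>.\<close>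
  define b where "b = v /\<^sub>R w v"
  have bb: "1 - b \<bullet> b = R\<^sup>2 / (w v)\<^sup>2"
  proof -
    have "b \<bullet> b = (v \<bullet> v) / (w v)\<^sup>2" by (simp add: b_def power2_eq_square divide_inverse)
    also have "v \<bullet> v = (w v)\<^sup>2 - R\<^sup>2" using w_square[of v] by (simp add: power2_eq_square)
    finally show ?thesis using w_nonzero[of v] by (simp add: diff_divide_distrib)
  qed
  have b1: "b \<bullet> b < 1" 
  proof -
    have "R\<^sup>2 / (w v)\<^sup>2 > 0" using R w_pos[of v] by simp
    then show ?thesis using bb by linarith
  qed
  define h where "h n x = K (v + \<delta> n *\<^sub>R x) / sqrt (1 + ((cosh_dist (v + \<delta> n *\<^sub>R x))\<^sup>2 - 1) / (\<delta> n)\<^sup>2) ^ (d + 2)" for n x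
  define L where "L x = K v * (1 / sqrt (1 + (1 / R)\<^sup>2 * (x \<bullet> x - (b \<bullet> x)\<^sup>2)) ^ (d + 2))" for x
  have resc: "integral\<^sup>L lborel (\<lambda>y. f y * (d * cosh_dist y * (\<delta> n)\<^sup>2 / (R * w y * sqrt ((cosh_dist y)\<^sup>2 - 1 + (\<delta> n)\<^sup>2) ^ (d + 2)))) = integral\<^sup>L lborel (h n)" for n
  proof -
    \<comment> \<open>The substitution contributes \<open>\<delta> n ^ d\<close>. Together with the
      numerator \<open>(\<delta> n)\<^sup>2\<close> it cancels the power \<open>d + 2\<close> of
      \<open>\<delta> n\<close> that is taken out of the root.\<close>
    define g where "g y = K y * ((\<delta> n)\<^sup>2 / sqrt ((cosh_dist y)\<^sup>2 - 1 + (\<delta> n)\<^sup>2) ^ (d + 2))" for y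
    have pos: "(cosh_dist y)\<^sup>2 - 1 + (\<delta> n)\<^sup>2 > 0" for y
    proof -
      have "(cosh_dist y)\<^sup>2 \<ge> 1" using cosh_dist_ge_1[of y] by simp
      moreover have "(\<delta> n)\<^sup>2 > 0" using \<delta>(1)[of n] by simp
      ultimately show ?thesis by linarith
    qed
    have "continuous_on UNIV g"
      unfolding g_def by (intro continuous_intros Kc ballI) (simp add: pos less_imp_neq[THEN not_sym])
    then have gm: "g \<in> borel_measurable borel" by (rule borel_measurable_continuous_onI)
    have "(\<lambda>y. f y * (d * cosh_dist y * (\<delta> n)\<^sup>2 / (R * w y * sqrt ((cosh_dist y)\<^sup>2 - 1 + (\<delta> n)\<^sup>2) ^ (d + 2)))) = g"
      by (simp add: g_def K_def fun_eq_iff)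
    then have "integral\<^sup>L lborel (\<lambda>y. f y * (d * cosh_dist y * (\<delta> n)\<^sup>2 / (R * w y * sqrt ((cosh_dist y)\<^sup>2 - 1 + (\<delta> n)\<^sup>2) ^ (d + 2))))
       = \<delta> n ^ d * integral\<^sup>L lborel (\<lambda>x. g (v + \<delta> n *\<^sub>R x))"
      using lborel_integral_affine[OF gm \<delta>(1), of n v] by (simp add: d_def)
    also have "\<dots> = integral\<^sup>L lborel (\<lambda>x. \<delta> n ^ d * g (v + \<delta> n *\<^sub>R x))" by simp
    also have "(\<lambda>x. \<delta> n ^ d * g (v + \<delta> n *\<^sub>R x)) = h n"
    proof
      fix x
      define C where "C = (cosh_dist (v + \<delta> n *\<^sub>R x))\<^sup>2 - 1"
      have "C + (\<delta> n)\<^sup>2 = (\<delta> n)\<^sup>2 * (1 + C / (\<delta> n)\<^sup>2)" using \<delta>(1)[of n] by (simp add: field_simps)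
      then have "sqrt (C + (\<delta> n)\<^sup>2) = \<delta> n * sqrt (1 + C / (\<delta> n)\<^sup>2)"
        using \<delta>(1)[of n] by (simp add: real_sqrt_mult)
      then show "\<delta> n ^ d * g (v + \<delta> n *\<^sub>R x) = h n x"
        using \<delta>(1)[of n] unfolding g_def h_def C_def[symmetric]
        by (simp add: power_mult_distrib power_add power2_eq_square)
    qed
    finally show ?thesis .
  qed
  have Lint: "integral\<^sup>L lborel L = K v * (unit_ball_vol d / ((1 / R) ^ d * sqrt (1 - b \<bullet> b)))"
  proof -
    have "1 / R > 0" using R by simp
    from integral_elliptic_kernel(2)[OF b1 this] show ?thesis
      unfolding L_def d_def integral_mult_right_zero by (simp only:)
  qed
  have "(\<lambda>n. integral\<^sup>L lborel (h n)) \<longlonglongrightarrow> integral\<^sup>L lborel L"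
  proof (rule integral_dominated_convergence)
    \<comment> \<open>The dominating function is again an elliptic kernel, now with
      \<open>b = 0\<close> and the scale \<open>\<kappa>\<close> from the distance bound. That bound
      holds only for \<open>norm y \<le> B\<close>; beyond it \<open>K\<close> vanishes.\<close>
    have "integrable lborel (\<lambda>x :: real ^ 'n. 1 / sqrt (1 + \<kappa>\<^sup>2 * (x \<bullet> x - (0 \<bullet> x)\<^sup>2)) ^ (d + 2))"
      unfolding d_def by (rule integral_elliptic_kernel(1)[OF _ \<kappa>]) simp
    then have "integrable lborel (\<lambda>x :: real ^ 'n. 1 / sqrt (1 + \<kappa>\<^sup>2 * (x \<bullet> x)) ^ (d + 2))"
      by simp
    then show "integrable lborel (\<lambda>x :: real ^ 'n. M * (1 / sqrt (1 + \<kappa>\<^sup>2 * (x \<bullet> x)) ^ (d + 2)))"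
      by (rule integrable_mult_right)
    show "L \<in> borel_measurable lborel"
      unfolding L_def by measurable
    show "h n \<in> borel_measurable lborel" for n
    proof -
      have "continuous_on UNIV (\<lambda>x. K (v + \<delta> n *\<^sub>R x))" "continuous_on UNIV (\<lambda>x. cosh_dist (v + \<delta> n *\<^sub>R x))"
        by (intro continuous_on_compose2[OF Kc] continuous_on_compose2[OF continuous_on_cosh_dist[of UNIV]] continuous_intros; simp)+
      then have [measurable]: "(\<lambda>x. K (v + \<delta> n *\<^sub>R x)) \<in> borel_measurable borel" "(\<lambda>x. cosh_dist (v + \<delta> n *\<^sub>R x)) \<in> borel_measurable borel"
        by (auto intro: borel_measurable_continuous_onI)
      show ?thesis unfolding h_def by measurable
    qed
    show "AE x in lborel. (\<lambda>n. h n x) \<longlonglongrightarrow> L x"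
    proof (rule AE_I2)
      fix x
      have y: "(\<lambda>n. v + \<delta> n *\<^sub>R x) \<longlonglongrightarrow> v"
        using tendsto_add[OF tendsto_const tendsto_scaleR[OF \<delta>(2) tendsto_const], of v x] by simp
      have lim: "(\<lambda>n. g (v + \<delta> n *\<^sub>R x)) \<longlonglongrightarrow> g v" if "continuous_on UNIV g" for g :: "real ^ 'n \<Rightarrow> real"
        using that y by (intro isCont_tendsto_compose[OF _ y]) (simp add: continuous_on_eq_continuous_at)
      note limc = lim[OF continuous_on_cosh_dist] and limw = lim[OF continuous_on_hyp_height[of UNIV R]]
      have "(\<lambda>n. (cosh_dist (v + \<delta> n *\<^sub>R x) + 1) / (2 * R\<^sup>2) * (x \<bullet> x - ((x \<bullet> (v + \<delta> n *\<^sub>R x + v)) / (w (v + \<delta> n *\<^sub>R x) + w v))\<^sup>2))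
         \<longlonglongrightarrow> (cosh_dist v + 1) / (2 * R\<^sup>2) * (x \<bullet> x - ((x \<bullet> (v + v)) / (w v + w v))\<^sup>2)"
        using R w_pos[of v] by (intro tendsto_intros limc limw y) auto
      also have "(cosh_dist v + 1) / (2 * R\<^sup>2) * (x \<bullet> x - ((x \<bullet> (v + v)) / (w v + w v))\<^sup>2) = (1 / R)\<^sup>2 * (x \<bullet> x - (b \<bullet> x)\<^sup>2)"
      proof -
        have "(x \<bullet> (v + v)) / (w v + w v) = b \<bullet> x"
          unfolding inner_add_right inner_commute[of x] b_def by (simp, simp only: divide_inverse mult.commute)
        then show ?thesis unfolding cosh_dist_center by (simp add: power_divide)
      qed
      finally have q: "(\<lambda>n. ((cosh_dist (v + \<delta> n *\<^sub>R x))\<^sup>2 - 1) / (\<delta> n)\<^sup>2) \<longlonglongrightarrow> (1 / R)\<^sup>2 * (x \<bullet> x - (b \<bullet> x)\<^sup>2)"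
        unfolding cosh_dist_square_difference_quotient[OF \<delta>(1)] .
      have nonneg: "(1 / R)\<^sup>2 * (x \<bullet> x - (b \<bullet> x)\<^sup>2) \<ge> 0"
      proof -
        have "(b \<bullet> x)\<^sup>2 \<le> (b \<bullet> b) * (x \<bullet> x)" by (rule Cauchy_Schwarz_ineq)
        also have "\<dots> \<le> 1 * (x \<bullet> x)" using b1 by (intro mult_right_mono) auto
        finally show ?thesis by simp
      qed
      have nz: "sqrt (1 + (1 / R)\<^sup>2 * (x \<bullet> x - (b \<bullet> x)\<^sup>2)) ^ (d + 2) \<noteq> 0"
      proof -
        have "sqrt (1 + (1 / R)\<^sup>2 * (x \<bullet> x - (b \<bullet> x)\<^sup>2)) > 0"
          using nonneg by (intro real_sqrt_gt_zero) linarith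
        then show ?thesis by (intro power_not_zero) linarith
      qed
      have "(\<lambda>n. h n x) \<longlonglongrightarrow> K v / sqrt (1 + (1 / R)\<^sup>2 * (x \<bullet> x - (b \<bullet> x)\<^sup>2)) ^ (d + 2)"
        unfolding h_def by (intro tendsto_intros lim[OF Kc] q nz)
      then show "(\<lambda>n. h n x) \<longlonglongrightarrow> L x" by (simp add: L_def)
    qed
    show "AE x in lborel. norm (h n x) \<le> M * (1 / sqrt (1 + \<kappa>\<^sup>2 * (x \<bullet> x)) ^ (d + 2))" for n
    proof (rule AE_I2)
      fix x
      define y where "y = v + \<delta> n *\<^sub>R x"
      have s0: "sqrt (1 + \<kappa>\<^sup>2 * (x \<bullet> x)) > 0" by (simp add: add_pos_nonneg)
      show "norm (h n x) \<le> M * (1 / sqrt (1 + \<kappa>\<^sup>2 * (x \<bullet> x)) ^ (d + 2))"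
      proof (cases "norm y > B")
        case True
        then show ?thesis using Ks[OF True] M(1) s0 by (simp add: h_def flip: y_def)
      next
        case False
        have nyv: "norm (y - v) ^ 2 = (\<delta> n)\<^sup>2 * (x \<bullet> x)"
          by (simp add: y_def power_mult_distrib power2_norm_eq_inner)
        from False have "\<kappa>\<^sup>2 * norm (y - v) ^ 2 \<le> (cosh_dist y)\<^sup>2 - 1"
          unfolding \<kappa>_def by (intro cosh_dist_square_ge) simp
        then have "(\<delta> n)\<^sup>2 * (\<kappa>\<^sup>2 * (x \<bullet> x)) \<le> (cosh_dist y)\<^sup>2 - 1"
          unfolding nyv by (simp only: mult_ac)
        then have "\<kappa>\<^sup>2 * (x \<bullet> x) \<le> ((cosh_dist y)\<^sup>2 - 1) / (\<delta> n)\<^sup>2"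
          using \<delta>(1)[of n] by (simp add: field_simps)
        then have le: "sqrt (1 + \<kappa>\<^sup>2 * (x \<bullet> x)) \<le> sqrt (1 + ((cosh_dist y)\<^sup>2 - 1) / (\<delta> n)\<^sup>2)" by simp
        have "norm (h n x) = \<bar>K y\<bar> * (1 / sqrt (1 + ((cosh_dist y)\<^sup>2 - 1) / (\<delta> n)\<^sup>2) ^ (d + 2))"
          using s0 le by (simp add: h_def y_def abs_divide power_abs)
        also have "\<dots> \<le> M * (1 / sqrt (1 + \<kappa>\<^sup>2 * (x \<bullet> x)) ^ (d + 2))"
          using M s0 le by (intro mult_mono divide_left_mono power_mono) auto
        finally show ?thesis .
      qed
    qed
  qed
  moreover have "K v * (unit_ball_vol d / ((1 / R) ^ d * sqrt (1 - b \<bullet> b))) = f v * (d * unit_ball_vol d * R ^ (d - 2))"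
  proof -
    \<comment> \<open>This root contributes \<open>w v / R\<close> and \<open>K v\<close>
      contributes \<open>1 / (R * w v)\<close>, so the height of the pole cancels and
      \<open>R ^ d\<close> is reduced to \<open>R ^ (d - 2)\<close>.\<close>
    have "sqrt (1 - b \<bullet> b) = R / w v" unfolding bb using R w_pos[of v] by (simp add: real_sqrt_divide)
    moreover obtain m where "d = Suc (Suc m)" using assms(1) unfolding d_def by (metis add_2_eq_Suc le_Suc_ex)
    ultimately show ?thesis
      using R w_pos[of v] by (simp add: K_def cosh_dist_center power_divide field_simps)
  qed
  ultimately show ?thesis
    unfolding d_def[symmetric] resc Lint by (simp only:)
qed

end

section \<open>Local integrability of the kernel and passage to the limit\<close>

context hyperboloid_point
begin

text \<open>At the pole \<open>radial_F\<close> would take the junk value of a divergent integral.\<close>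

definition green_kernel :: "real ^ 'n \<Rightarrow> real" where
  "green_kernel y = indicator (- {v}) y * radial_F CARD('n) (cosh_dist y)"

lemma green_kernel_nonneg: "green_kernel y \<ge> 0"
  by (simp add: green_kernel_def radial_F_nonneg cosh_dist_ge_1)

lemma borel_measurable_green_kernel:
  assumes "CARD('n) \<ge> 2"
  shows "green_kernel \<in> borel_measurable borel"
proof -
  have "continuous_on {1<..} (radial_F CARD('n))"
    by (intro continuous_at_imp_continuous_on ballI isCont_radial_F assms) simp
  then have "continuous_on (- {v}) (\<lambda>y. radial_F CARD('n) (cosh_dist y))"
    by (rule continuous_on_compose2[OF _ continuous_on_cosh_dist]) (use cosh_dist_gt_1 in auto)
  then have "(\<lambda>y. indicator (- {v}) y *\<^sub>R radial_F CARD('n) (cosh_dist y)) \<in> borel_measurable borel"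
    by (intro borel_measurable_continuous_on_indicator) auto
  then show ?thesis by (simp add: green_kernel_def[abs_def])
qed

definition "hdist y = arcosh (cosh_dist y)"

lemma hdist_nonneg: "hdist y \<ge> 0"
  by (simp add: hdist_def cosh_dist_ge_1)

lemma hdist_sublevel:
  assumes "norm y \<le> B" "hdist y < t"
  shows "y \<in> ball v (sinh t / dist_bound B)"
proof -
  have "(dist_bound B * norm (y - v))\<^sup>2 \<le> (cosh_dist y)\<^sup>2 - 1"
    using cosh_dist_square_ge[OF assms(1)] by (simp add: power_mult_distrib)
  then have "dist_bound B * norm (y - v) \<le> sqrt ((cosh_dist y)\<^sup>2 - 1)"
    by (rule real_le_rsqrt)
  also have "\<dots> = sinh (hdist y)"
    by (simp add: hdist_def sinh_arcosh_real cosh_dist_ge_1)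
  also have "\<dots> < sinh t" using assms(2) by simp
  finally show ?thesis
    using dist_bound_pos[of B] by (simp add: dist_norm norm_minus_commute pos_less_divide_eq mult.commute)
qed

text \<open>
  Tonelli's theorem, with \<open>radial_F\<close> written as an integral over \<open>t\<close>, reduces local integrability to the
  volume of the sublevel sets of \<open>hdist\<close>, which lie in Euclidean balls of radius comparable to \<open>sinh t\<close>.
\<close>

lemma nn_integral_green_kernel_finite:
  assumes d: "CARD('n) \<ge> 2"
  shows "(\<integral>\<^sup>+y. indicator (cball 0 B) y * ennreal (green_kernel y) \<partial>lborel) < \<infinity>"
proof -
  define d where "d = CARD('n)"
  define \<kappa> where "\<kappa> = dist_bound B"
  have \<kappa>: "\<kappa> > 0" by (simp add: \<kappa>_def dist_bound_pos)
  define V where "V = unit_ball_vol (real d)"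
  have V: "V \<ge> 0" by (simp add: V_def)
  have contd: "continuous_on UNIV hdist"
    unfolding hdist_def 
    by (rule continuous_on_compose2[of "{1..}", OF continuous_on_arcosh continuous_on_cosh_dist]) (auto simp: cosh_dist_ge_1)
  have [measurable]: "hdist \<in> borel_measurable borel"
    by (rule borel_measurable_continuous_onI[OF contd])
  have "continuous_on UNIV (sinh :: real \<Rightarrow> real)" by (intro continuous_intros)
  then have [measurable]: "(sinh :: real \<Rightarrow> real) \<in> borel_measurable borel"
    by (rule borel_measurable_continuous_onI)
  define h :: "(real ^ 'n) \<times> real \<Rightarrow> ennreal" where
    "h = (\<lambda>(y, t). indicator (cball 0 B) y * (ennreal (1 / sinh t ^ (d - 1)) * indicator {s. hdist y < s} t))"
  have hm: "h \<in> borel_measurable (lborel \<Otimes>\<^sub>M lborel)"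
  proof -
    have "h = (\<lambda>p. if norm (fst p) \<le> B \<and> hdist (fst p) < snd p then ennreal (1 / sinh (snd p) ^ (d - 1)) else 0)"
      by (auto simp: h_def indicator_def fun_eq_iff)
    also have "\<dots> \<in> borel_measurable (borel \<Otimes>\<^sub>M borel)"
      by measurable
    finally show ?thesis
      by (simp cong: measurable_cong_sets sets_pair_measure_cong)
  qed
  have le: "indicator (cball 0 B) y * ennreal (green_kernel y) \<le> (\<integral>\<^sup>+t. h (y, t) \<partial>lborel)" for y
  proof (cases "y = v")
    case True
    then show ?thesis by (simp add: green_kernel_def)
  next
    case False
    have "hdist y > 0" using cosh_dist_gt_1[OF False] by (simp add: hdist_def)
    then have "(\<integral>\<^sup>+t. ennreal (1 / sinh t ^ (d - 1)) * indicator {hdist y<..} t \<partial>lborel) = ennreal (hyp_I d (hdist y))"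
      using hyp_I_has_nn_integral[of d] d by (simp add: d_def)
    moreover have "green_kernel y = hyp_I d (hdist y)"
      using False by (simp add: green_kernel_def radial_F_def hdist_def d_def)
    moreover have "(\<integral>\<^sup>+t. h (y, t) \<partial>lborel) = indicator (cball 0 B) y * (\<integral>\<^sup>+t. ennreal (1 / sinh t ^ (d - 1)) * indicator {hdist y<..} t \<partial>lborel)"
      unfolding h_def by (simp add: nn_integral_cmult greaterThan_def)
    ultimately show ?thesis by simp
  qed
  have inner: "(\<integral>\<^sup>+y. h (y, t) \<partial>lborel) \<le> ennreal (V / \<kappa> ^ d * sinh 1) * indicator {0..1} t +
      emeasure lborel (cball (0 :: real ^ 'n) B) * (ennreal (1 / sinh t ^ (d - 1)) * indicator {1<..} t)" for t
  proof -
    have eq: "(\<integral>\<^sup>+y. h (y, t) \<partial>lborel) = ennreal (1 / sinh t ^ (d - 1)) * emeasure lborel {y \<in> cball 0 B. hdist y < t}"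
    proof -
      have "{y \<in> cball 0 B. hdist y < t} \<in> sets lborel" by measurable
      then have "ennreal (1 / sinh t ^ (d - 1)) * emeasure lborel {y \<in> cball 0 B. hdist y < t} =
          (\<integral>\<^sup>+y. ennreal (1 / sinh t ^ (d - 1)) * indicator {y \<in> cball 0 B. hdist y < t} y \<partial>lborel)"
        by (rule nn_integral_cmult_indicator[symmetric])
      also have "\<dots> = (\<integral>\<^sup>+y. h (y, t) \<partial>lborel)"
        unfolding h_def by (intro nn_integral_cong) (auto simp: indicator_def)
      finally show ?thesis ..
    qed
    \<comment> \<open>For \<open>t \<le> 0\<close> the sublevel set is empty. For
      \<open>0 < t \<le> 1\<close> its volume is of order \<open>sinh t ^ d\<close>, which leaves
      the bounded factor \<open>sinh t\<close>. For \<open>t > 1\<close> the volume of the whole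
      ball suffices, because the integrand decays.\<close>
    consider "t \<le> 0" | "0 < t" "t \<le> 1" | "t > 1" by linarith
    then show ?thesis
    proof cases
      case 1
      then have "\<not> hdist y < t" for y using hdist_nonneg[of y] by linarith
      then have "{y \<in> cball 0 B. hdist y < t} = {}" by simp
      then show ?thesis unfolding eq by (simp only: emeasure_empty mult_zero_right zero_le)
    next
      case 2
      have s: "sinh t > 0" using 2 by simp
      have "emeasure lborel {y \<in> cball 0 B. hdist y < t} \<le> emeasure lborel (ball v (sinh t / \<kappa>))"
        using hdist_sublevel by (intro emeasure_mono) (auto simp: \<kappa>_def)
      also have "\<dots> = ennreal (V * (sinh t / \<kappa>) ^ d)"
        using s \<kappa> by (simp add: emeasure_ball V_def d_def)
      finally have "(\<integral>\<^sup>+y. h (y, t) \<partial>lborel) \<le> ennreal (1 / sinh t ^ (d - 1)) * ennreal (V * (sinh t / \<kappa>) ^ d)"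
        unfolding eq by (intro mult_left_mono) auto
      also have "\<dots> = ennreal (1 / sinh t ^ (d - 1) * (V * (sinh t / \<kappa>) ^ d))"
        using s V \<kappa> by (intro ennreal_mult[symmetric]) auto
      also have "1 / sinh t ^ (d - 1) * (V * (sinh t / \<kappa>) ^ d) = V / \<kappa> ^ d * sinh t"
      proof -
        have "d = Suc (d - 1)" using d by (simp add: d_def)
        then have "sinh t ^ d = sinh t * sinh t ^ (d - 1)" by (metis power_Suc)
        then show ?thesis using s by (simp add: power_divide)
      qed
      also have "ennreal (V / \<kappa> ^ d * sinh t) \<le> ennreal (V / \<kappa> ^ d * sinh 1)"
        using 2 V \<kappa> by (intro ennreal_leI mult_left_mono) auto
      finally show ?thesis using 2 by simp
    next
      case 3
      have "(\<integral>\<^sup>+y. h (y, t) \<partial>lborel) \<le> ennreal (1 / sinh t ^ (d - 1)) * emeasure lborel (cball (0 :: real ^ 'n) B)"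
        unfolding eq by (intro mult_left_mono emeasure_mono) auto
      then show ?thesis using 3 by (simp add: mult.commute)
    qed
  qed
  have "(\<integral>\<^sup>+y. indicator (cball 0 B) y * ennreal (green_kernel y) \<partial>lborel) \<le> (\<integral>\<^sup>+y. (\<integral>\<^sup>+t. h (y, t) \<partial>lborel) \<partial>lborel)"
    by (intro nn_integral_mono le)
  also have "\<dots> = (\<integral>\<^sup>+t. (\<integral>\<^sup>+y. h (y, t) \<partial>lborel) \<partial>lborel)"
    by (rule lborel_pair.Fubini[OF hm, symmetric, simplified])
  also have "\<dots> \<le> (\<integral>\<^sup>+t. ennreal (V / \<kappa> ^ d * sinh 1) * indicator {0..1} t +
      emeasure lborel (cball (0 :: real ^ 'n) B) * (ennreal (1 / sinh t ^ (d - 1)) * indicator {1<..} t) \<partial>lborel)"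
    by (intro nn_integral_mono inner)
  also have "\<dots> = (\<integral>\<^sup>+t. ennreal (V / \<kappa> ^ d * sinh 1) * indicator {0..1::real} t \<partial>lborel) +
      (\<integral>\<^sup>+t. emeasure lborel (cball (0 :: real ^ 'n) B) * (ennreal (1 / sinh t ^ (d - 1)) * indicator {1<..} t) \<partial>lborel)"
    by (intro nn_integral_add) measurable
  also have "(\<integral>\<^sup>+t. ennreal (V / \<kappa> ^ d * sinh 1) * indicator {0..1::real} t \<partial>lborel) = ennreal (V / \<kappa> ^ d * sinh 1)"
    by (subst nn_integral_cmult_indicator) auto
  also have "(\<integral>\<^sup>+t. emeasure lborel (cball (0 :: real ^ 'n) B) * (ennreal (1 / sinh t ^ (d - 1)) * indicator {1<..} t) \<partial>lborel)
     = emeasure lborel (cball (0 :: real ^ 'n) B) * ennreal (hyp_I d 1)"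
    using hyp_I_has_nn_integral[of d 1] d by (subst nn_integral_cmult) (auto simp: d_def)
  also have "ennreal (V / \<kappa> ^ d * sinh 1) + emeasure lborel (cball (0 :: real ^ 'n) B) * ennreal (hyp_I d 1) < \<infinity>"
    using emeasure_bounded_finite[OF bounded_cball, of "0 :: real ^ 'n" B] by (simp add: ennreal_mult_less_top)
  finally show ?thesis .
qed

lemma integrable_times_green_kernel:
  assumes d: "CARD('n) \<ge> 2" and g: "continuous_on UNIV g" and supp: "\<And>y. norm y > B \<Longrightarrow> g y = 0"
  shows "integrable lborel (\<lambda>y. g y * green_kernel y)"
proof -
  obtain M where M: "M \<ge> 0" "\<And>y. \<bar>g y\<bar> \<le> M"
    using continuous_bounded_support_bound[OF g supp] by blast
  have [measurable]: "green_kernel \<in> borel_measurable borel" by (rule borel_measurable_green_kernel[OF d])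
  have [measurable]: "g \<in> borel_measurable borel" by (rule borel_measurable_continuous_onI[OF g])
  have le: "(\<integral>\<^sup>+y. ennreal (norm (g y * green_kernel y)) \<partial>lborel) \<le> (\<integral>\<^sup>+y. ennreal M * (indicator (cball 0 B) y * ennreal (green_kernel y)) \<partial>lborel)"
  proof (rule nn_integral_mono)
    fix y
    show "ennreal (norm (g y * green_kernel y)) \<le> ennreal M * (indicator (cball 0 B) y * ennreal (green_kernel y))"
    proof (cases "norm y > B")
      case True
      then show ?thesis using supp by simp
    next
      case False
      have "norm (g y * green_kernel y) \<le> M * green_kernel y"
        using M(2)[of y] green_kernel_nonneg[of y] by (simp add: abs_mult mult_right_mono)
      then show ?thesis
        using False M(1) green_kernel_nonneg[of y] by (simp add: ennreal_leI flip: ennreal_mult)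
    qed
  qed
  have [measurable]: "cball (0 :: real ^ 'n) B \<in> sets lborel" "green_kernel \<in> borel_measurable lborel" by simp_all
  have "(\<integral>\<^sup>+y. ennreal M * (indicator (cball 0 B) y * ennreal (green_kernel y)) \<partial>lborel) = ennreal M * (\<integral>\<^sup>+y. indicator (cball 0 B) y * ennreal (green_kernel y) \<partial>lborel)"
    by (intro nn_integral_cmult) measurable
  also have "\<dots> < \<infinity>"
    using nn_integral_green_kernel_finite[OF d, of B] by (simp add: ennreal_mult_less_top)
  finally have "(\<integral>\<^sup>+y. ennreal (norm (g y * green_kernel y)) \<partial>lborel) < \<infinity>"
    using le by (rule order.strict_trans1[rotated])
  then show ?thesis
    by (intro integrableI_bounded) measurable
qed

lemma integral_lap_green_kernel:
  assumes d: "CARD('n) \<ge> 2" and f: "C1 f" "\<And>i. C1 (partial i f)" and supp: "\<And>y. norm y > B \<Longrightarrow> f y = 0"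
  shows "integrable lborel (\<lambda>y. - lap f y * green_kernel y)"
    "integral\<^sup>L lborel (\<lambda>y. - lap f y * green_kernel y) = f v * (CARD('n) * unit_ball_vol CARD('n) * R ^ (CARD('n) - 2))"
proof -
  have lc: "continuous_on UNIV (lap f)" by (rule continuous_on_lap[OF f(2)])
  have lm [measurable]: "lap f \<in> borel_measurable borel" by (rule borel_measurable_continuous_onI[OF lc])
  have [measurable]: "green_kernel \<in> borel_measurable borel" by (rule borel_measurable_green_kernel[OF d])
  have ls: "lap f y = 0" if "norm y > B" for y by (rule lap_bounded_support[OF f supp that])
  show int: "integrable lborel (\<lambda>y. - lap f y * green_kernel y)"
    by (rule integrable_times_green_kernel[OF d, of _ B]) (use lc ls in \<open>auto intro!: continuous_intros\<close>)
  \<comment> \<open>Starting at \<open>1 / 2\<close> keeps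
    \<open>(\<delta> n)\<^sup>2 \<le> 1 / 4\<close>, the range of the uniform bound for the
    approximations.\<close>
  define \<delta> :: "nat \<Rightarrow> real" where "\<delta> n = 1 / real (Suc (Suc n))" for n
  have \<delta>: "\<delta> n > 0" "\<delta> n \<le> 1 / 2" for n by (simp_all add: \<delta>_def field_simps)
  have \<delta>0: "\<delta> \<longlonglongrightarrow> 0"
    using LIMSEQ_Suc[OF LIMSEQ_inverse_real_of_nat] by (simp add: \<delta>_def[abs_def] inverse_eq_divide)
  have \<epsilon>: "0 < (\<delta> n)\<^sup>2" "(\<delta> n)\<^sup>2 \<le> 1 / 4" "(\<delta> n)\<^sup>2 < 1" for n
  proof -
    show "0 < (\<delta> n)\<^sup>2" using \<delta>(1)[of n] by simp
    have "(\<delta> n)\<^sup>2 \<le> (1 / 2)\<^sup>2" using \<delta>[of n] by (intro power_mono) auto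
    then show "(\<delta> n)\<^sup>2 \<le> 1 / 4" by (simp add: power2_eq_square)
    then show "(\<delta> n)\<^sup>2 < 1" by linarith
  qed
  have \<epsilon>0: "(\<lambda>n. (\<delta> n)\<^sup>2) \<longlonglongrightarrow> 0"
    using tendsto_power[OF \<delta>0, of 2] by simp
  \<comment> \<open>One sequence is given two limits: here by domination with the singular kernel,
    below through Green's formula and the approximate identity.\<close>
  have "(\<lambda>n. integral\<^sup>L lborel (\<lambda>y. - lap f y * radial_F_approx CARD('n) ((\<delta> n)\<^sup>2) (cosh_dist y)))
      \<longlonglongrightarrow> integral\<^sup>L lborel (\<lambda>y. - lap f y * green_kernel y)"
  proof (rule integral_dominated_convergence)
    have "integrable lborel (\<lambda>y. 2 ^ (CARD('n) - 1) * norm (- lap f y * green_kernel y))"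
      using int by (intro integrable_mult_right integrable_norm)
    then show "integrable lborel (\<lambda>y. 2 ^ (CARD('n) - 1) * norm (- lap f y * green_kernel y))" .
    show "(\<lambda>y. - lap f y * green_kernel y) \<in> borel_measurable lborel" by measurable
    show "(\<lambda>y. - lap f y * radial_F_approx CARD('n) ((\<delta> n)\<^sup>2) (cosh_dist y)) \<in> borel_measurable lborel" for n
    proof -
      have "continuous_on {1..} (radial_F_approx CARD('n) ((\<delta> n)\<^sup>2))"
        by (intro continuous_at_imp_continuous_on ballI DERIV_isCont[OF radial_F_approx_has_derivative[OF d \<epsilon>(1,3)]]) simp
      then have "continuous_on UNIV (\<lambda>y. radial_F_approx CARD('n) ((\<delta> n)\<^sup>2) (cosh_dist y))"
        by (rule continuous_on_compose2[OF _ continuous_on_cosh_dist]) (auto simp: cosh_dist_ge_1)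
      then have [measurable]: "(\<lambda>y. radial_F_approx CARD('n) ((\<delta> n)\<^sup>2) (cosh_dist y)) \<in> borel_measurable borel"
        by (rule borel_measurable_continuous_onI)
      show ?thesis by measurable
    qed
    \<comment> \<open>At the pole the approximations need not converge to the value \<open>0\<close>
      assigned to \<open>green_kernel\<close>.\<close>
    have ae: "AE y in lborel. y \<noteq> v" by (rule AE_lborel_singleton)
    show "AE y in lborel. (\<lambda>n. - lap f y * radial_F_approx CARD('n) ((\<delta> n)\<^sup>2) (cosh_dist y)) \<longlonglongrightarrow> - lap f y * green_kernel y"
      using ae
    proof eventually_elim
      case (elim y)
      then show ?case
        using radial_F_approx_tendsto[OF d cosh_dist_gt_1[OF elim] \<epsilon>0]
        by (intro tendsto_intros) (simp add: green_kernel_def)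
    qed
    show "AE y in lborel. norm (- lap f y * radial_F_approx CARD('n) ((\<delta> n)\<^sup>2) (cosh_dist y)) \<le> 2 ^ (CARD('n) - 1) * norm (- lap f y * green_kernel y)" for n
      using ae
    proof eventually_elim
      case (elim y)
      note b = radial_F_approx_bounds[OF d \<epsilon>(1,2) cosh_dist_gt_1[OF elim], of n]
      have k: "green_kernel y = radial_F CARD('n) (cosh_dist y)" using elim by (simp add: green_kernel_def)
      have "norm (- lap f y * radial_F_approx CARD('n) ((\<delta> n)\<^sup>2) (cosh_dist y)) = \<bar>lap f y\<bar> * radial_F_approx CARD('n) ((\<delta> n)\<^sup>2) (cosh_dist y)"
        using b(1) by (simp add: abs_mult)
      also have "\<dots> \<le> \<bar>lap f y\<bar> * (2 ^ (CARD('n) - 1) * green_kernel y)"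
        unfolding k by (intro mult_left_mono b(2)) simp
      also have "\<dots> = 2 ^ (CARD('n) - 1) * norm (- lap f y * green_kernel y)"
        using green_kernel_nonneg[of y] by (simp add: abs_mult)
      finally show ?case .
    qed
  qed
  moreover have "(\<lambda>n. integral\<^sup>L lborel (\<lambda>y. - lap f y * radial_F_approx CARD('n) ((\<delta> n)\<^sup>2) (cosh_dist y)))
      \<longlonglongrightarrow> f v * (CARD('n) * unit_ball_vol CARD('n) * R ^ (CARD('n) - 2))"
    using approximate_identity[OF d C1_continuous[OF f(1)] supp \<delta>(1) \<delta>0]
    by (simp only: integral_lap_approx[OF d f supp \<epsilon>(1) \<epsilon>(3)])
  ultimately show "integral\<^sup>L lborel (\<lambda>y. - lap f y * green_kernel y) = f v * (CARD('n) * unit_ball_vol CARD('n) * R ^ (CARD('n) - 2))"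
    by (rule LIMSEQ_unique)
qed

lemma laplace_beltrami_hyp_chart:
  "laplace_beltrami R \<phi> (hyp_chart R y) = w y / R * lap (\<phi> \<circ> hyp_chart R) y"
  unfolding laplace_beltrami_eq[OF R] lap_def grad_def[abs_def] ..

end

section \<open>The fundamental solution\<close>

text \<open>\<open>real d * unit_ball_vol (real d)\<close> is the area
  \<open>2 * pi powr (d / 2) / Gamma (d / 2)\<close> of the unit sphere, so the normalisation of
  \<open>hyp_H\<close> is the reciprocal of the limiting mass.\<close>

lemma hyp_H_constant:
  assumes "d > 0" "R > 0"
  shows "Gamma (real d / 2) / (2 * pi powr (real d / 2) * R ^ (d - 2)) * (a * (real d * unit_ball_vol (real d) * R ^ (d - 2))) = a"
proof -
  have "real d / 2 > 0" using assms by simp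
  then have "real d / 2 \<notin> \<int>\<^sub>\<le>\<^sub>0" by (auto elim!: nonpos_Ints_cases)
  from Gamma_plus1[OF this] have G: "Gamma (real d / 2 + 1) = real d / 2 * Gamma (real d / 2)" .
  have "Gamma (real d / 2) > 0" using assms by (intro Gamma_real_pos) simp
  then have "Gamma (real d / 2) \<noteq> 0" by linarith
  then show ?thesis
    unfolding unit_ball_vol_def G using assms by simp
qed

lemma sets_borel_hyperboloid: "(hyperboloid R :: (real \<times> (real ^ 'n)) set) \<in> sets borel"
proof -
  have "(hyperboloid R :: (real \<times> (real ^ 'n)) set) = {x. mink x x = R\<^sup>2} \<inter> {x. 0 < fst x}"
    by (auto simp: hyperboloid_def)
  moreover have "closed {x :: real \<times> (real ^ 'n). mink x x = R\<^sup>2}"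
    unfolding mink_def by (intro closed_Collect_eq continuous_intros)
  moreover have "open {x :: real \<times> (real ^ 'n). 0 < fst x}"
    by (intro open_Collect_less continuous_intros)
  ultimately show ?thesis by (simp add: borel_closed borel_open sets.Int)
qed

lemma fundamental_solution_hyp_H:
  assumes d: "CARD('n) \<ge> 2" and R: "R > 0"
  shows "fundamental_solution R (hyp_H R :: real \<times> (real ^ 'n) \<Rightarrow> real \<times> (real ^ 'n) \<Rightarrow> real)"
  unfolding fundamental_solution_def
proof (intro allI impI)
  fix \<phi> :: "real \<times> (real ^ 'n) \<Rightarrow> real" and x :: "real \<times> (real ^ 'n)"
  assume \<phi>: "test_function R \<phi>" and x: "x \<in> hyperboloid R"
  define f where "f = \<phi> \<circ> hyp_chart R"
  have Ck: "C_k k f" for k using \<phi> by (simp add: test_function_def f_def)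
  have f: "C1 f" "C1 (partial i f)" for i
    using Ck[of "Suc 0"] Ck[of "Suc (Suc 0)"] by simp_all
  obtain B where B: "\<And>y. norm y > B \<Longrightarrow> f y = 0"
    using test_function_bounded_support[OF \<phi> R] unfolding f_def by blast
  have bij: "bij_betw (hyp_chart R) (UNIV :: (real ^ 'n) set) (hyperboloid R)"
    by (rule bij_betw_hyp_chart[OF R])
  have chart: "hyp_chart R y \<in> hyperboloid R" for y :: "real ^ 'n"
    using bij by (auto simp: bij_betw_def)
  have chart_snd: "hyp_chart R (snd z) = z" if "z \<in> hyperboloid R" for z :: "real \<times> (real ^ 'n)"
  proof -
    have "z \<in> range (hyp_chart R)"
      using that by (simp only: bij_betw_imp_surj_on[OF bij])
    then obtain y where "z = hyp_chart R y" by (rule imageE)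
    then show ?thesis by (simp add: hyp_chart_eq)
  qed
  define v where "v = snd x"
  have xv: "x = hyp_chart R v" unfolding v_def using chart_snd[OF x] by simp
  interpret hyperboloid_point R v by unfold_locales (rule R)
  define K where "K = Gamma (real CARD('n) / 2) / (2 * pi powr (real CARD('n) / 2) * R ^ (CARD('n) - 2))"
  \<comment> \<open>\<open>\<Phi>\<close> is the integrand on the ambient space, with the pole
    removed by the indicator; \<open>\<Psi>\<close> is its pull-back to the chart.\<close>
  define \<Phi> where "\<Phi> x' = indicator (hyperboloid R - {x}) x' *\<^sub>R (- laplace_beltrami R \<phi> x' * hyp_H R x x')" for x'
  define \<Psi> where "\<Psi> y = w y / R * (K * (- lap f y * green_kernel y))" for y
  have \<Phi>\<Psi>: "\<Phi> (hyp_chart R y) = \<Psi> y" for y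
  proof (cases "y = v")
    case True
    then show ?thesis by (simp add: \<Phi>_def \<Psi>_def xv green_kernel_def)
  next
    case False
    then have "hyp_chart R y \<noteq> x" by (simp add: xv hyp_chart_eq)
    moreover have "hyp_H R x (hyp_chart R y) = K * green_kernel y"
      using False by (simp add: hyp_H_def K_def hyp_rho_def xv mink_hyp_chart green_kernel_def radial_F_def)
    ultimately show ?thesis
      using chart[of y] by (simp add: \<Phi>_def \<Psi>_def laplace_beltrami_hyp_chart f_def)
  qed
  have [measurable]: "green_kernel \<in> borel_measurable borel" by (rule borel_measurable_green_kernel[OF d])
  have [measurable]: "lap f \<in> borel_measurable borel"
    by (rule borel_measurable_continuous_onI[OF continuous_on_lap[OF f(2)]])
  have [measurable]: "w \<in> borel_measurable borel"
    by (rule borel_measurable_continuous_onI[OF continuous_on_hyp_height])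
  have \<Psi>m [measurable]: "\<Psi> \<in> borel_measurable borel"
    unfolding \<Psi>_def by measurable
  have [measurable]: "hyperboloid R \<in> sets borel" by (rule sets_borel_hyperboloid)
  \<comment> \<open>Transfer along the push-forward requires \<open>\<Phi>\<close> to be Borel on
    the ambient space. On the hyperboloid \<open>snd\<close> inverts the chart, and elsewhere
    \<open>\<Phi>\<close> vanishes.\<close>
  have "\<Phi> = (\<lambda>z. indicator (hyperboloid R) z * \<Psi> (snd z))"
  proof
    fix z :: "real \<times> (real ^ 'n)"
    show "\<Phi> z = indicator (hyperboloid R) z * \<Psi> (snd z)"
      using \<Phi>\<Psi>[of "snd z"] chart_snd[of z] by (cases "z \<in> hyperboloid R") (auto simp: \<Phi>_def)
  qed
  moreover have "snd \<in> borel_measurable (borel :: (real \<times> (real ^ 'n)) measure)"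
    by (intro borel_measurable_continuous_onI continuous_intros)
  ultimately have \<Phi>m: "\<Phi> \<in> borel_measurable borel" by simp
  have "continuous_on UNIV (hyp_chart R :: real ^ 'n \<Rightarrow> _)"
    unfolding hyp_chart_def by (intro continuous_intros)
  then have chartm: "hyp_chart R \<in> measurable (density lborel (\<lambda>y :: real ^ 'n. ennreal (vol_density R y))) borel"
    using borel_measurable_continuous_onI by simp
  have volm: "vol_density R \<in> borel_measurable (lborel :: (real ^ 'n) measure)"
    unfolding vol_density_eq[OF R, abs_def] by simp
  have vol0: "AE y :: real ^ 'n in lborel. 0 \<le> vol_density R y"
    using R by (intro AE_I2) (simp add: vol_density_eq[OF R] less_imp_le[OF w_pos])
  \<comment> \<open>The volume density \<open>R / w y\<close> cancels the factor
    \<open>w y / R\<close> that separates \<open>lap\<close> from the Laplace-Beltrami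
    operator.\<close>
  have vol\<Psi>: "vol_density R y *\<^sub>R \<Psi> y = K * (- lap f y * green_kernel y)" for y
    using w_nonzero[of y] R by (simp add: vol_density_eq[OF R] \<Psi>_def)
  have main: "integrable lborel (\<lambda>y. - lap f y * green_kernel y)"
    "integral\<^sup>L lborel (\<lambda>y. - lap f y * green_kernel y) = f v * (CARD('n) * unit_ball_vol CARD('n) * R ^ (CARD('n) - 2))"
    by (rule integral_lap_green_kernel[OF d f B], assumption)+
  have "integrable (hyp_vol R) \<Phi> \<longleftrightarrow> integrable lborel (\<lambda>y. vol_density R y *\<^sub>R \<Psi> y)"
    unfolding hyp_vol_def integrable_distr_eq[OF chartm \<Phi>m] \<Phi>\<Psi>
    using volm vol0 \<Psi>m by (intro integrable_density) auto
  then have 1: "integrable (hyp_vol R) \<Phi>"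
    unfolding vol\<Psi> using integrable_mult_right[OF main(1), of K] by (simp only:)
  have "integral\<^sup>L (hyp_vol R) \<Phi> = integral\<^sup>L lborel (\<lambda>y. vol_density R y *\<^sub>R \<Psi> y)"
    unfolding hyp_vol_def integral_distr[OF chartm \<Phi>m] \<Phi>\<Psi>
    using volm vol0 \<Psi>m by (intro integral_density) auto
  also have "\<dots> = K * (f v * (CARD('n) * unit_ball_vol CARD('n) * R ^ (CARD('n) - 2)))"
    unfolding vol\<Psi> integral_mult_right_zero main(2) ..
  also have "\<dots> = f v"
    unfolding K_def using hyp_H_constant[of "CARD('n)" R "f v"] d R by simp
  also have "\<dots> = \<phi> x" by (simp add: f_def xv)
  finally have 2: "integral\<^sup>L (hyp_vol R) \<Phi> = \<phi> x" .
  show "set_integrable (hyp_vol R) (hyperboloid R - {x}) (\<lambda>x'. - laplace_beltrami R \<phi> x' * hyp_H R x x') \<and>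
      (LINT x':hyperboloid R - {x}|hyp_vol R. - laplace_beltrami R \<phi> x' * hyp_H R x x') = \<phi> x"
    using 1 2 unfolding set_integrable_def set_lebesgue_integral_def \<Phi>_def[symmetric] by simp
qed

theorem theorem3p1:
  fixes d :: nat and R :: real
  assumes d: "CARD('n::finite) = d" "d \<ge> 2" and R: "R > 0"
  shows
    "fundamental_solution R (hyp_H R :: real \<times> (real ^ 'n) \<Rightarrow> real \<times> (real ^ 'n) \<Rightarrow> real) \<and>
     (\<forall>\<rho>>0.
       (even d \<longrightarrow>
          hyp_I d \<rho> =
            (-1) ^ (d div 2 - 1) * (real_of_int (dfact (int d - 3)) / real_of_int (dfact (int d - 2))) *
            (ln (coth (\<rho> / 2)) +
             cosh \<rho> * (\<Sum>k = 1..d div 2 - 1.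
               real_of_int (dfact (2 * int k - 2)) * (-1) ^ k /
               (real_of_int (dfact (2 * int k - 1)) * sinh \<rho> ^ (2 * k))))) \<and>
       (odd d \<longrightarrow>
          hyp_I d \<rho> =
            (-1) ^ ((d - 1) div 2) *
            (real_of_int (dfact (int d - 3)) / real_of_int (dfact (int d - 2)) +
             fact ((d - 3) div 2) * (\<Sum>k = 1..(d - 1) div 2.
               (-1) ^ k * coth \<rho> ^ (2 * k - 1) /
               (real (2 * k - 1) * fact (k - 1) * fact ((d - 2 * k - 1) div 2)))) \<and>
          hyp_I d \<rho> =
            (-1) ^ ((d - 1) div 2) * (real_of_int (dfact (int d - 3)) / real_of_int (dfact (int d - 2))) *
            (1 +
             cosh \<rho> * (\<Sum>k = 1..(d - 1) div 2.
               real_of_int (dfact (2 * int k - 3)) * (-1) ^ k /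
               (real_of_int (dfact (2 * int k - 2)) * sinh \<rho> ^ (2 * k - 1))))) \<and>
       hyp_I d \<rho> =
         1 / (real (d - 1) * cosh \<rho> ^ (d - 1)) *
         hyp2F1 ((real d - 1) / 2) (real d / 2) ((real d + 1) / 2) (1 / (cosh \<rho>)\<^sup>2) \<and>
       hyp_I d \<rho> =
         1 / (real (d - 1) * cosh \<rho> * sinh \<rho> ^ (d - 2)) *
         hyp2F1 (1 / 2) 1 ((real d + 1) / 2) (1 / (cosh \<rho>)\<^sup>2) \<and>
       complex_of_real (hyp_I d \<rho>) =
         exp (- \<i> * of_real (pi * (real d / 2 - 1))) /
         of_real (2 powr (real d / 2 - 1) * Gamma (real d / 2) * sinh \<rho> powr (real d / 2 - 1)) *
         legendre_Q (of_real (real d / 2 - 1)) (of_real (real d / 2 - 1)) (cosh \<rho>))"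
proof (intro conjI allI impI)
  show "fundamental_solution R (hyp_H R :: real \<times> (real ^ 'n) \<Rightarrow> real \<times> (real ^ 'n) \<Rightarrow> real)"
    using fundamental_solution_hyp_H[OF _ R, where 'n = 'n] d by simp
next
  fix \<rho> :: real assume \<rho>: "\<rho> > 0" and "even d"
  then obtain m where m: "d = 2 * m + 2"
    using d(2) by (metis add.commute dvd_def le_Suc_ex dvd_add_right_iff dvd_refl)
  have "d div 2 - 1 = m" "int d - 3 = 2 * int m - 1" "int d - 2 = 2 * int m"
    by (simp_all add: m)
  then show "hyp_I d \<rho> =
            (-1) ^ (d div 2 - 1) * (real_of_int (dfact (int d - 3)) / real_of_int (dfact (int d - 2))) *
            (ln (coth (\<rho> / 2)) +
             cosh \<rho> * (\<Sum>k = 1..d div 2 - 1.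
               real_of_int (dfact (2 * int k - 2)) * (-1) ^ k /
               (real_of_int (dfact (2 * int k - 1)) * sinh \<rho> ^ (2 * k))))"
    using hyp_I_even[OF \<rho>, of m] by (simp only: m)
next
  fix \<rho> :: real assume \<rho>: "\<rho> > 0" and "odd d"
  then obtain n where n: "d = 2 * n + 1" by (auto elim: oddE)
  define m where "m = n - 1"
  have m: "d = 2 * m + 3" using n d(2) by (simp add: m_def)
  have e: "(d - 1) div 2 = Suc m" "(d - 3) div 2 = m" "int d - 3 = 2 * int m" "int d - 2 = 2 * int m + 1"
    by (simp_all add: m)
  \<comment> \<open>With \<open>d = 2 * m + 3\<close> the division is exact for
    \<open>k \<le> Suc m\<close>; for larger \<open>k\<close> truncated subtraction makes both sides
    \<open>0\<close>.\<close>
  have k: "(d - 2 * k - 1) div 2 = Suc m - k" for k by (simp add: m)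
  show "hyp_I d \<rho> =
            (-1) ^ ((d - 1) div 2) *
            (real_of_int (dfact (int d - 3)) / real_of_int (dfact (int d - 2)) +
             fact ((d - 3) div 2) * (\<Sum>k = 1..(d - 1) div 2.
               (-1) ^ k * coth \<rho> ^ (2 * k - 1) /
               (real (2 * k - 1) * fact (k - 1) * fact ((d - 2 * k - 1) div 2))))"
    using hyp_I_odd_eq_odd_power_sum[OF \<rho>, of m, folded m] minus_odd_power_sum_eq[of m "coth \<rho>"]
    unfolding e k odd_power_sum_1 by simp
  show "hyp_I d \<rho> =
            (-1) ^ ((d - 1) div 2) * (real_of_int (dfact (int d - 3)) / real_of_int (dfact (int d - 2))) *
            (1 +
             cosh \<rho> * (\<Sum>k = 1..(d - 1) div 2.
               real_of_int (dfact (2 * int k - 3)) * (-1) ^ k /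
               (real_of_int (dfact (2 * int k - 2)) * sinh \<rho> ^ (2 * k - 1))))"
    unfolding e using hyp_I_odd[OF \<rho>, of m, folded m] .
qed (use d(2) hyp_I_eq_hyp2F1_cosh hyp_I_eq_hyp2F1_sinh hyp_I_eq_legendre_Q in blast)+

end
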